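(* Every 5-dimensional compact nilmanifold $N=\Gamma\backslash G$ has an invariant balanced $\mathrm{SU}(2)$-structure. That is, there is an $\mathrm{SU}(2)$-structure $(\eta,\omega_1,\omega_2,\omega_3)$ on $N$, all of whose forms are induced by left-invariant forms on $G$, such that $d(\omega_1\wedge\eta)=0$, $d(\omega_2\wedge\eta)=0$ and $d(\omega_3\wedge\omega_3)=0$.
   Context: A compact nilmanifold is a quotient $\Gamma\backslash G$ of a simply-connected nilpotent Lie group $G$ by a uniform (cocompact) discrete subgroup $\Gamma$. A form on $\Gamma\backslash G$ is invariant if it is induced by a left-invariant form on $G$. An $\mathrm{SU}(2)$-structure on a 5-manifold $N$ (an $\mathrm{SU}(2)$-reduction of the linear frame bundle) is identified with a quadruplet $(\eta,\omega_1,\omega_2,\omega_3)$, where $\eta$ is a 1-form and the $\omega_i$ are 2-forms on $N$ such that $\omega_i\wedge\omega_j=\delta_{ij}v$ for some 4-form $v$ with $v\wedge\eta$ nowhere zero, and such that $i_X\omega_3=i_Y\omega_1$ implies $\omega_2(X,Y)\ge 0$ (here $i_X$ is contraction by $X$). Equivalently, locally there is a basis of 1-forms $e^1,\dots,e^5$ with $\eta=e^1$, $\omega_1=e^{24}+e^{53}$, $\omega_2=e^{25}+e^{34}$, $\omega_3=e^{23}+e^{45}$, where $e^{ij}=e^i\wedge e^j$. The $\mathrm{SU}(2)$-structure is called balanced if $d(\omega_1\wedge\eta)=d(\omega_2\wedge\eta)=d(\omega_3\wedge\omega_3)=0$. *)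

theory Defs
  imports "HOL-Analysis.Analysis" "HOL-Algebra.Generated_Groups" "HOL-Combinatorics.Permutations"
begin

section \<open>Smooth maps between open subsets of normed spaces\<close>

text \<open>Meant for open \<open>S\<close>: total derivatives exist on \<open>S\<close> to order \<open>k\<close>, and all iterated
  directional derivatives are continuous there.\<close>

primrec Ck_on :: "nat \<Rightarrow> 'a::real_normed_vector set \<Rightarrow> ('a \<Rightarrow> 'b::real_normed_vector) \<Rightarrow> bool" where
  "Ck_on 0 S f \<longleftrightarrow> continuous_on S f"
| "Ck_on (Suc k) S f \<longleftrightarrow> (\<forall>x\<in>S. f differentiable (at x)) \<and>
     (\<forall>v. Ck_on k S (\<lambda>x. frechet_derivative f (at x) v))"

definition smooth_on :: "'a::real_normed_vector set \<Rightarrow> ('a \<Rightarrow> 'b::real_normed_vector) \<Rightarrow> bool" where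
  "smooth_on S f \<longleftrightarrow> (\<forall>k. Ck_on k S f)"


section \<open>Smooth manifolds\<close>

text \<open>A chart is a pair \<open>(U, \<phi>)\<close>; the values of \<open>\<phi>\<close> outside \<open>U\<close> are irrelevant. Atlases are
  not required to be maximal.\<close>

type_synonym ('a, 'e) chart = "'a set \<times> ('a \<Rightarrow> 'e)"
type_synonym ('a, 'e) atlas = "('a, 'e) chart set"

definition is_chart :: "'a topology \<Rightarrow> ('a, 'e::euclidean_space) chart \<Rightarrow> bool" where
  "is_chart X c \<longleftrightarrow> (case c of (U, \<phi>) \<Rightarrow>
     openin X U \<and> open (\<phi> ` U) \<and>
     homeomorphic_map (subtopology X U) (top_of_set (\<phi> ` U)) \<phi>)"

definition smooth_manifold :: "'a topology \<Rightarrow> ('a, 'e::euclidean_space) atlas \<Rightarrow> bool" where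
  "smooth_manifold X A \<longleftrightarrow>
     Hausdorff_space X \<and> second_countable X \<and>
     (\<forall>c\<in>A. is_chart X c) \<and> (\<Union>(U, \<phi>)\<in>A. U) = topspace X \<and>
     (\<forall>(U, \<phi>)\<in>A. \<forall>(V, \<psi>)\<in>A. smooth_on (\<phi> ` (U \<inter> V)) (\<psi> \<circ> inv_into U \<phi>))"

definition smooth_map ::
  "'a topology \<Rightarrow> ('a, 'e::euclidean_space) atlas \<Rightarrow>
   'b topology \<Rightarrow> ('b, 'f::euclidean_space) atlas \<Rightarrow> ('a \<Rightarrow> 'b) \<Rightarrow> bool" where
  "smooth_map X A Y B f \<longleftrightarrow> continuous_map X Y f \<and>
     (\<forall>(U, \<phi>)\<in>A. \<forall>(V, \<psi>)\<in>B.
        smooth_on (\<phi> ` {p \<in> U. f p \<in> V}) (\<psi> \<circ> f \<circ> inv_into U \<phi>))"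

definition prod_atlas ::
  "('a, 'e) atlas \<Rightarrow> ('b, 'f) atlas \<Rightarrow> ('a \<times> 'b, 'e \<times> 'f) atlas" where
  "prod_atlas A B = {(U \<times> V, map_prod \<phi> \<psi>) | U \<phi> V \<psi>. (U, \<phi>) \<in> A \<and> (V, \<psi>) \<in> B}"


section \<open>Lie groups and compact nilmanifolds\<close>

definition lie_group ::
  "('g::topological_space, 'm) monoid_scheme \<Rightarrow> ('g, 'e::euclidean_space) atlas \<Rightarrow> bool" where
  "lie_group G A \<longleftrightarrow> group G \<and>
     (let X = top_of_set (carrier G) in
        smooth_manifold X A \<and>
        smooth_map (prod_topology X X) (prod_atlas A A) X A (\<lambda>(x, y). x \<otimes>\<^bsub>G\<^esub> y) \<and>
        smooth_map X A X A (\<lambda>x. inv\<^bsub>G\<^esub> x))"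

primrec lower_central_series :: "('g, 'm) monoid_scheme \<Rightarrow> nat \<Rightarrow> 'g set" where
  "lower_central_series G 0 = carrier G"
| "lower_central_series G (Suc n) = generate G
     (\<Union>x\<in>carrier G. \<Union>y\<in>lower_central_series G n. {x \<otimes>\<^bsub>G\<^esub> y \<otimes>\<^bsub>G\<^esub> inv\<^bsub>G\<^esub> x \<otimes>\<^bsub>G\<^esub> inv\<^bsub>G\<^esub> y})"

definition nilpotent_group :: "('g, 'm) monoid_scheme \<Rightarrow> bool" where
  "nilpotent_group G \<longleftrightarrow> (\<exists>n. lower_central_series G n = {\<one>\<^bsub>G\<^esub>})"

text \<open>The points of \<open>\<Gamma>\<setminus>G\<close> are the sets \<open>\<Gamma> #> g = {\<gamma>g | \<gamma> \<in> \<Gamma>}\<close>, which form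
  \<open>rcosets \<Gamma>\<close>. The preimage of a set \<open>V\<close> of cosets under the projection is \<open>\<Union>V\<close>.\<close>

definition coset_proj :: "('g, 'm) monoid_scheme \<Rightarrow> 'g set \<Rightarrow> 'g \<Rightarrow> 'g set" where
  "coset_proj G \<Gamma> g = \<Gamma> #>\<^bsub>G\<^esub> g"

definition coset_topology ::
  "('g::topological_space, 'm) monoid_scheme \<Rightarrow> 'g set \<Rightarrow> 'g set topology" where
  "coset_topology G \<Gamma> = topology (\<lambda>V. V \<subseteq> rcosets\<^bsub>G\<^esub> \<Gamma> \<and> openin (top_of_set (carrier G)) (\<Union>V))"

lemma openin_coset_topology:
  assumes "group G" "subgroup \<Gamma> G"
  shows "openin (coset_topology G \<Gamma>) V \<longleftrightarrow>
    V \<subseteq> rcosets\<^bsub>G\<^esub> \<Gamma> \<and> openin (top_of_set (carrier G)) (\<Union>V)"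
proof -
  let ?P = "\<lambda>V. V \<subseteq> rcosets\<^bsub>G\<^esub> \<Gamma> \<and> openin (top_of_set (carrier G)) (\<Union>V)"
  have disj: "C = D" if "C \<in> rcosets\<^bsub>G\<^esub> \<Gamma>" "D \<in> rcosets\<^bsub>G\<^esub> \<Gamma>" "x \<in> C" "x \<in> D" for C D x
    using group.rcos_disjoint[OF assms] that by (auto simp: pairwise_def disjnt_def)
  have "istopology ?P"
    unfolding istopology_def
  proof (intro conjI allI impI)
    fix S T assume S: "?P S" and T: "?P T"
    have eq: "\<Union>(S \<inter> T) = \<Union>S \<inter> \<Union>T"
      using S T disj by blast
    show "S \<inter> T \<subseteq> rcosets\<^bsub>G\<^esub> \<Gamma>" using S by blast
    show "openin (top_of_set (carrier G)) (\<Union>(S \<inter> T))"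
      unfolding eq using S T by blast
  next
    fix K assume K: "\<forall>S\<in>K. ?P S"
    then show "\<Union>K \<subseteq> rcosets\<^bsub>G\<^esub> \<Gamma>" by blast
    have eq: "\<Union>(\<Union>K) = \<Union>(Union ` K)" by blast
    show "openin (top_of_set (carrier G)) (\<Union>(\<Union>K))"
      unfolding eq using K by (intro openin_Union) blast
  qed
  then show ?thesis
    by (simp add: coset_topology_def topology_inverse')
qed

text \<open>The smooth structure making the projection a local diffeomorphism: every chart of \<open>G\<close>,
  restricted to an open set on which the projection is injective, is transported to
  the quotient.\<close>

definition coset_atlas ::
  "('g::topological_space, 'm) monoid_scheme \<Rightarrow> 'g set \<Rightarrow> ('g, 'e) atlas \<Rightarrow> ('g set, 'e) atlas" where
  "coset_atlas G \<Gamma> A = {(coset_proj G \<Gamma> ` W, \<phi> \<circ> inv_into W (coset_proj G \<Gamma>)) | W U \<phi>.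
     (U, \<phi>) \<in> A \<and> W \<subseteq> U \<and> openin (top_of_set (carrier G)) W \<and> inj_on (coset_proj G \<Gamma>) W}"

definition compact_nilmanifold ::
  "('g::topological_space, 'm) monoid_scheme \<Rightarrow> 'g set \<Rightarrow> ('g, 'e::euclidean_space) atlas \<Rightarrow> bool" where
  "compact_nilmanifold G \<Gamma> A \<longleftrightarrow>
     lie_group G A \<and> simply_connected (carrier G) \<and> nilpotent_group G \<and>
     subgroup \<Gamma> G \<and> discrete \<Gamma> \<and> compact_space (coset_topology G \<Gamma>)"

lemma coset_atlas_covers:
  assumes "lie_group G A" and sub: "subgroup \<Gamma> G" and "discrete \<Gamma>"
  shows "(\<Union>(V, \<psi>)\<in>coset_atlas G \<Gamma> A. V) = rcosets\<^bsub>G\<^esub> \<Gamma>"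
proof -
  let ?X = "top_of_set (carrier G)"
  interpret group G using assms(1) by (simp add: lie_group_def)
  have mult: "continuous_map (prod_topology ?X ?X) ?X (\<lambda>(x, y). x \<otimes>\<^bsub>G\<^esub> y)"
    and inv: "continuous_map ?X ?X (\<lambda>x. inv\<^bsub>G\<^esub> x)"
    and man: "smooth_manifold ?X A"
    using assms(1) by (simp_all add: lie_group_def smooth_map_def Let_def)
  have f: "continuous_map (prod_topology ?X ?X) ?X (\<lambda>z. fst z \<otimes>\<^bsub>G\<^esub> inv\<^bsub>G\<^esub> (snd z))"
  proof -
    have "continuous_map (prod_topology ?X ?X) (prod_topology ?X ?X) (\<lambda>z. (fst z, inv\<^bsub>G\<^esub> (snd z)))"
      by (intro continuous_map_pairedI continuous_map_fst
          continuous_map_compose[OF continuous_map_snd inv, unfolded comp_def])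
    from continuous_map_compose[OF this mult] show ?thesis by (simp add: comp_def)
  qed
  obtain T where T: "open T" "\<one>\<^bsub>G\<^esub> \<in> T" "T \<inter> \<Gamma> = {\<one>\<^bsub>G\<^esub>}"
    using assms(3) subgroup.one_closed[OF sub]
    unfolding discrete_def isolated_in_def by (metis insert_iff Int_iff)
  have cover: "\<exists>V \<psi>. (V, \<psi>) \<in> coset_atlas G \<Gamma> A \<and> coset_proj G \<Gamma> g \<in> V" if g: "g \<in> carrier G" for g
  proof -
    obtain U \<phi> where U: "(U, \<phi>) \<in> A" "g \<in> U"
    proof -
      have "g \<in> (\<Union>(U, \<phi>)\<in>A. U)" using man g by (simp add: smooth_manifold_def)
      then show thesis using that by blast
    qed
    have Uo: "openin ?X U" using man U(1) by (auto simp: smooth_manifold_def is_chart_def)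
    define P where
      "P = {z \<in> topspace (prod_topology ?X ?X). fst z \<otimes>\<^bsub>G\<^esub> inv\<^bsub>G\<^esub> (snd z) \<in> carrier G \<inter> T}"
    have "openin (prod_topology ?X ?X) P"
      unfolding P_def by (rule openin_continuous_map_preimage[OF f openin_open_Int[OF T(1)]])
    moreover have "(g, g) \<in> P" using g T(2) by (simp add: P_def)
    ultimately have "\<exists>W1 W2. openin ?X W1 \<and> openin ?X W2 \<and> g \<in> W1 \<and> g \<in> W2 \<and> W1 \<times> W2 \<subseteq> P"
      unfolding openin_prod_topology_alt by (elim allE impE)
    then obtain W1 W2 where W: "openin ?X W1" "openin ?X W2" "g \<in> W1" "g \<in> W2" "W1 \<times> W2 \<subseteq> P"
      by (elim exE conjE)
    define W where "W = U \<inter> W1 \<inter> W2"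
    have "openin ?X W" using Uo W by (simp add: W_def openin_Int)
    moreover have "inj_on (coset_proj G \<Gamma>) W"
    proof (rule inj_onI)
      fix x y assume xy: "x \<in> W" "y \<in> W" "coset_proj G \<Gamma> x = coset_proj G \<Gamma> y"
      have "(x, y) \<in> P" using xy(1,2) W(5) unfolding W_def by blast
      then have c: "x \<in> carrier G" "y \<in> carrier G" "x \<otimes>\<^bsub>G\<^esub> inv\<^bsub>G\<^esub> y \<in> T" by (auto simp: P_def)
      have "x \<in> \<Gamma> #>\<^bsub>G\<^esub> y"
        using xy(3) rcos_self[OF c(1) sub] by (simp add: coset_proj_def)
      then obtain h where h: "h \<in> \<Gamma>" "x = h \<otimes>\<^bsub>G\<^esub> y"
        unfolding r_coset_def by blast
      then have "h \<in> carrier G" using subgroup.mem_carrier[OF sub] by blast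
      then have "x \<otimes>\<^bsub>G\<^esub> inv\<^bsub>G\<^esub> y = h" using h c by (simp add: m_assoc)
      then have "h \<in> T \<inter> \<Gamma>" using h(1) c(3) by simp
      then have "h = \<one>\<^bsub>G\<^esub>" unfolding T(3) by simp
      then show "x = y" using h c by simp
    qed
    moreover have "W \<subseteq> U" by (auto simp: W_def)
    ultimately have "(coset_proj G \<Gamma> ` W, \<phi> \<circ> inv_into W (coset_proj G \<Gamma>)) \<in> coset_atlas G \<Gamma> A"
      unfolding coset_atlas_def mem_Collect_eq
      by (intro exI[of _ W] exI[of _ U] exI[of _ \<phi>] conjI refl U(1))
    moreover have "coset_proj G \<Gamma> g \<in> coset_proj G \<Gamma> ` W"
      using U(2) W(3,4) by (simp add: W_def)
    ultimately show ?thesis by (intro exI conjI)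
  qed
  have sub_cosets: "V \<subseteq> rcosets\<^bsub>G\<^esub> \<Gamma>" if V: "(V, \<psi>) \<in> coset_atlas G \<Gamma> A" for V \<psi>
  proof -
    obtain W where W: "V = coset_proj G \<Gamma> ` W" "openin ?X W"
      using V unfolding coset_atlas_def by blast
    have "W \<subseteq> carrier G" using openin_subset[OF W(2)] by simp
    then show ?thesis using W(1) by (auto simp: RCOSETS_def coset_proj_def)
  qed
  have cosets: "rcosets\<^bsub>G\<^esub> \<Gamma> = coset_proj G \<Gamma> ` carrier G"
    by (simp only: RCOSETS_def coset_proj_def [abs_def] UNION_singleton_eq_range)
  show ?thesis
  proof (intro subset_antisym subsetI)
    fix C assume "C \<in> (\<Union>(V, \<psi>)\<in>coset_atlas G \<Gamma> A. V)"
    then obtain c where c: "c \<in> coset_atlas G \<Gamma> A" "C \<in> fst c"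
      unfolding case_prod_beta by (elim UN_E)
    then show "C \<in> rcosets\<^bsub>G\<^esub> \<Gamma>"
      using sub_cosets[of "fst c" "snd c"] by (simp add: subset_iff)
  next
    fix C assume "C \<in> rcosets\<^bsub>G\<^esub> \<Gamma>"
    then obtain g where g: "C = coset_proj G \<Gamma> g" "g \<in> carrier G"
      unfolding cosets by (elim imageE)
    obtain V \<psi> where V: "(V, \<psi>) \<in> coset_atlas G \<Gamma> A" "C \<in> V"
      using cover[OF g(2)] unfolding g(1) by (elim exE conjE)
    show "C \<in> (\<Union>(V, \<psi>)\<in>coset_atlas G \<Gamma> A. V)"
      using V by (intro UN_I[OF V(1)]) simp
  qed
qed


section \<open>Exterior algebra of a vector space\<close>

text \<open>A \<open>k\<close>-form on \<open>'e\<close> is a function on lists of vectors of which only the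
  values on lists of length \<open>k\<close> matter.\<close>

definition alternating :: "nat \<Rightarrow> ('e::real_vector list \<Rightarrow> real) \<Rightarrow> bool" where
  "alternating k a \<longleftrightarrow>
     (\<forall>vs i. length vs = k \<and> i < k \<longrightarrow> linear (\<lambda>v. a (vs[i := v]))) \<and>
     (\<forall>vs. length vs = k \<and> \<not> distinct vs \<longrightarrow> a vs = 0)"

text \<open>Normalised so that \<open>(e\<^sup>1 \<and> \<dots> \<and> e\<^sup>k)(e\<^sub>1, \<dots>, e\<^sub>k) = 1\<close>.\<close>

definition wedge ::
  "nat \<Rightarrow> nat \<Rightarrow> ('e list \<Rightarrow> real) \<Rightarrow> ('e list \<Rightarrow> real) \<Rightarrow> 'e list \<Rightarrow> real" where
  "wedge k l a b vs =
     (\<Sum>p | p permutes {..<k + l}. of_int (sign p) *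
        a (map (\<lambda>i. vs ! p i) [0..<k]) * b (map (\<lambda>i. vs ! p i) [k..<k + l])) / (fact k * fact l)"

definition contract :: "'e \<Rightarrow> ('e list \<Rightarrow> real) \<Rightarrow> 'e list \<Rightarrow> real" where
  "contract v a vs = a (v # vs)"


section \<open>Differential forms on manifolds\<close>

text \<open>A differential form is given by its local expressions: \<open>\<alpha> (U, \<phi>) x\<close> is the value at
  \<open>x \<in> \<phi> ` U\<close> of the expression of \<open>\<alpha>\<close> in the chart \<open>(U, \<phi>)\<close>. Only charts \<open>(U, \<phi>)\<close> of the
  atlas at hand and points \<open>x \<in> \<phi> ` U\<close> matter.\<close>

type_synonym ('a, 'e) form = "('a, 'e) chart \<Rightarrow> 'e \<Rightarrow> 'e list \<Rightarrow> real"

text \<open>\<open>is_pullback A B f k \<beta> \<alpha>\<close> says \<open>f\<^sup>*\<beta> = \<alpha>\<close> for \<open>k\<close>-forms \<open>\<alpha>\<close>, \<open>\<beta>\<close> in the atlases \<open>A\<close>, \<open>B\<close>.\<close>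

definition is_pullback ::
  "('a, 'e::euclidean_space) atlas \<Rightarrow> ('b, 'f::euclidean_space) atlas \<Rightarrow> ('a \<Rightarrow> 'b) \<Rightarrow> nat \<Rightarrow>
   ('b, 'f) form \<Rightarrow> ('a, 'e) form \<Rightarrow> bool" where
  "is_pullback A B f k \<beta> \<alpha> \<longleftrightarrow>
     (\<forall>(U, \<phi>)\<in>A. \<forall>(V, \<psi>)\<in>B. \<forall>p\<in>U. f p \<in> V \<longrightarrow>
        (\<forall>vs. length vs = k \<longrightarrow>
           \<alpha> (U, \<phi>) (\<phi> p) vs =
           \<beta> (V, \<psi>) (\<psi> (f p)) (map (frechet_derivative (\<psi> \<circ> f \<circ> inv_into U \<phi>) (at (\<phi> p))) vs)))"

text \<open>The pullback condition along the identity is the transformation rule under a change of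
  charts.\<close>

definition diff_form :: "('a, 'e::euclidean_space) atlas \<Rightarrow> nat \<Rightarrow> ('a, 'e) form \<Rightarrow> bool" where
  "diff_form A k \<alpha> \<longleftrightarrow>
     (\<forall>(U, \<phi>)\<in>A.
        (\<forall>x\<in>\<phi> ` U. alternating k (\<alpha> (U, \<phi>) x)) \<and>
        (\<forall>vs. length vs = k \<longrightarrow> smooth_on (\<phi> ` U) (\<lambda>x. \<alpha> (U, \<phi>) x vs))) \<and>
     is_pullback A A (\<lambda>p. p) k \<alpha> \<alpha>"

definition form_eq ::
  "('a, 'e::euclidean_space) atlas \<Rightarrow> nat \<Rightarrow> ('a, 'e) form \<Rightarrow> ('a, 'e) form \<Rightarrow> bool" where
  "form_eq A k \<alpha> \<beta> \<longleftrightarrow>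
     (\<forall>(U, \<phi>)\<in>A. \<forall>x\<in>\<phi> ` U. \<forall>vs. length vs = k \<longrightarrow> \<alpha> (U, \<phi>) x vs = \<beta> (U, \<phi>) x vs)"

definition zero_form :: "('a, 'e) form" where
  "zero_form = (\<lambda>c x vs. 0)"

definition nowhere_zero :: "('a, 'e::euclidean_space) atlas \<Rightarrow> nat \<Rightarrow> ('a, 'e) form \<Rightarrow> bool" where
  "nowhere_zero A k \<alpha> \<longleftrightarrow>
     (\<forall>(U, \<phi>)\<in>A. \<forall>x\<in>\<phi> ` U. \<exists>vs. length vs = k \<and> \<alpha> (U, \<phi>) x vs \<noteq> 0)"

definition form_wedge ::
  "nat \<Rightarrow> nat \<Rightarrow> ('a, 'e) form \<Rightarrow> ('a, 'e) form \<Rightarrow> ('a, 'e) form" where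
  "form_wedge k l \<alpha> \<beta> = (\<lambda>c x. wedge k l (\<alpha> c x) (\<beta> c x))"

text \<open>The exterior derivative of a \<open>k\<close>-form:
  \<open>d\<alpha>(v\<^sub>0, \<dots>, v\<^sub>k) = \<Sum>\<^sub>i (-1)\<^sup>i D(\<alpha>(v\<^sub>0, \<dots>, v\<^sub>i omitted, \<dots>, v\<^sub>k))(v\<^sub>i)\<close> in every chart.\<close>

definition ext_deriv :: "nat \<Rightarrow> ('a, 'e::euclidean_space) form \<Rightarrow> ('a, 'e) form" where
  "ext_deriv k \<alpha> = (\<lambda>c x vs. \<Sum>i\<le>k. (-1) ^ i *
     frechet_derivative (\<lambda>y. \<alpha> c y (take i vs @ drop (Suc i) vs)) (at x) (vs ! i))"

definition left_invariant ::
  "('g, 'm) monoid_scheme \<Rightarrow> ('g, 'e::euclidean_space) atlas \<Rightarrow> nat \<Rightarrow> ('g, 'e) form \<Rightarrow> bool" where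
  "left_invariant G A k \<alpha> \<longleftrightarrow> (\<forall>g\<in>carrier G. is_pullback A A (\<lambda>x. g \<otimes>\<^bsub>G\<^esub> x) k \<alpha> \<alpha>)"

text \<open>A form on \<open>\<Gamma>\<setminus>G\<close> is invariant if its pullback to \<open>G\<close> is left-invariant.\<close>

definition invariant_form ::
  "('g::topological_space, 'm) monoid_scheme \<Rightarrow> 'g set \<Rightarrow> ('g, 'e::euclidean_space) atlas \<Rightarrow> nat \<Rightarrow>
   ('g set, 'e) form \<Rightarrow> bool" where
  "invariant_form G \<Gamma> A k \<beta> \<longleftrightarrow>
     (\<exists>\<alpha>. diff_form A k \<alpha> \<and> left_invariant G A k \<alpha> \<and>
        is_pullback A (coset_atlas G \<Gamma> A) (coset_proj G \<Gamma>) k \<beta> \<alpha>)"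


section \<open>SU(2)-structures on 5-manifolds\<close>

text \<open>The triple \<open>\<omega>\<^sub>1, \<omega>\<^sub>2, \<omega>\<^sub>3\<close> is \<open>\<omega> 1, \<omega> 2, \<omega> 3\<close>; other values of \<open>\<omega>\<close> are irrelevant. In the
  last condition \<open>X\<close> and \<open>Y\<close> are tangent vectors at a point, expressed in a chart.\<close>

definition SU2_structure ::
  "('a, real^5) atlas \<Rightarrow> ('a, real^5) form \<Rightarrow> (nat \<Rightarrow> ('a, real^5) form) \<Rightarrow> bool" where
  "SU2_structure A \<eta> \<omega> \<longleftrightarrow>
     diff_form A 1 \<eta> \<and> (\<forall>i\<in>{1, 2, 3}. diff_form A 2 (\<omega> i)) \<and>
     (\<exists>v. diff_form A 4 v \<and>
        (\<forall>i\<in>{1, 2, 3}. \<forall>j\<in>{1, 2, 3}.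
           form_eq A 4 (form_wedge 2 2 (\<omega> i) (\<omega> j)) (if i = j then v else zero_form)) \<and>
        nowhere_zero A 5 (form_wedge 4 1 v \<eta>)) \<and>
     (\<forall>(U, \<phi>)\<in>A. \<forall>x\<in>\<phi> ` U. \<forall>X Y.
        (\<forall>Z. contract X (\<omega> 3 (U, \<phi>) x) [Z] = contract Y (\<omega> 1 (U, \<phi>) x) [Z]) \<longrightarrow>
        \<omega> 2 (U, \<phi>) x [X, Y] \<ge> 0)"

definition balanced ::
  "('a, real^5) atlas \<Rightarrow> ('a, real^5) form \<Rightarrow> (nat \<Rightarrow> ('a, real^5) form) \<Rightarrow> bool" where
  "balanced A \<eta> \<omega> \<longleftrightarrow>
     form_eq A 4 (ext_deriv 3 (form_wedge 2 1 (\<omega> 1) \<eta>)) zero_form \<and>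
     form_eq A 4 (ext_deriv 3 (form_wedge 2 1 (\<omega> 2) \<eta>)) zero_form \<and>
     form_eq A 5 (ext_deriv 4 (form_wedge 2 2 (\<omega> 3) (\<omega> 3))) zero_form"

end

theory Submission
  imports Defs
begin

text \<open>A nilpotent Lie algebra of dimension 5 has a basis \<open>e\<^sub>1, \<dots>, e\<^sub>5\<close> with \<open>e\<^sub>4\<close> central,
  \<open>[e\<^sub>1, e\<^sub>5] \<in> \<langle>e\<^sub>4\<rangle>\<close> and \<open>[e\<^sub>2, e\<^sub>5] = [e\<^sub>3, e\<^sub>5] = 0\<close>: take \<open>e\<^sub>4\<close> central, \<open>e\<^sub>5\<close> central modulo \<open>e\<^sub>4\<close>, and
  \<open>e\<^sub>2, e\<^sub>3\<close> in the centralizer of \<open>e\<^sub>5\<close>. Since the algebra is unimodular, a 3-form is closed as soon as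
  the bracket kills the dual bivector. The bivectors dual to \<open>e\<^sup>1\<^sup>2\<^sup>4, e\<^sup>1\<^sup>3\<^sup>5, e\<^sup>1\<^sup>2\<^sup>5, e\<^sup>1\<^sup>3\<^sup>4\<close> are
  \<open>e\<^sub>3 \<and> e\<^sub>5, e\<^sub>2 \<and> e\<^sub>4, e\<^sub>3 \<and> e\<^sub>4, e\<^sub>2 \<and> e\<^sub>5\<close>, so these four forms are closed, and all 4-forms are closed. Hence the
  standard \<open>SU(2)\<close>-structure of this basis is balanced; no classification is needed.

  The nilpotency of the bracket comes from that of the group: the differentials at \<open>1\<close> of the maps
  \<open>y \<mapsto> [x, y]\<close> have vanishing \<open>N\<close>-fold products, and differentiating these products in the base points gives
  the \<open>N\<close>-fold brackets. Left-invariant forms on \<open>G\<close> descend to \<open>\<Gamma>\<setminus>G\<close> because transition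
  maps between coset charts are left translations.\<close>

subsection \<open>Calculus of smooth maps\<close>

text \<open>Contracting with a volume form turns d on the 3-forms of a unimodular 5-dimensional
  algebra, up to sign, into the boundary map u \<and> v -> [u, v] on bivectors; this is the source
  of the criterion for 3-forms. Under it \<omega>_3 \<and> \<eta> corresponds to e_4 \<and> e_5 and
  e_2 \<and> e_3, and [e_2, e_3] is not controlled. The basis is numbered so that this free bracket
  meets only \<omega>_3, of which just the square has to be closed. In coordinates the criterion
  appears as a repeated index in every term of the differential. The hypotheses speak of a group
  with an atlas and of abstract commutators; neither an exponential map nor a Lie algebra of vector
  fields is constructed. The tangent space at 1 is the model space of one chart around 1. What
  passes from the group to linear algebra is a bracket that is linear in its second argument,
  antisymmetric, and zero when iterated often enough; what passes back is the structure equation of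
  the Maurer-Cartan form.\<close>

lemma Ck_on_subset: "Ck_on k S f \<Longrightarrow> T \<subseteq> S \<Longrightarrow> Ck_on k T f"
  by (induction k arbitrary: f) (auto intro: continuous_on_subset)

lemma has_derivative_transform_open:
  assumes "open S" "x \<in> S" "\<And>y. y \<in> S \<Longrightarrow> f y = g y" "(f has_derivative D) (at x)"
  shows "(g has_derivative D) (at x)"
  using has_derivative_transform_within_open[OF assms(4,1,2)] assms(3) by blast

lemma frechet_derivativeI: "(f has_derivative D) (at x) \<Longrightarrow> frechet_derivative f (at x) = D"
  using frechet_derivative_at by fastforce

lemma differentiable_has_frechet_derivative: "f differentiable at x \<Longrightarrow> (f has_derivative (\<lambda>v. frechet_derivative f (at x) v)) (at x)"
  using frechet_derivative_works by blast

text \<open>\<open>S\<close> is open because \<open>frechet_derivative\<close> at x depends on a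
  whole neighbourhood of x, on which f and g have to agree.\<close>

lemma Ck_on_cong:
  assumes "open S" "\<And>x. x \<in> S \<Longrightarrow> f x = g x" "Ck_on k S f"
  shows "Ck_on k S g"
  using assms(2,3)
proof (induction k arbitrary: f g)
  case 0
  then show ?case using continuous_on_cong[of S S f g] by simp
next
  case (Suc k)
  have D: "(g has_derivative frechet_derivative f (at x)) (at x)" if "x \<in> S" for x
    using has_derivative_transform_open[OF assms(1) that Suc.prems(1)] Suc.prems(2) that
    by (simp add: frechet_derivative_works)
  have "Ck_on k S (\<lambda>x. frechet_derivative g (at x) v)" for v
    by (rule Suc.IH[of "\<lambda>x. frechet_derivative f (at x) v"])
      (use Suc.prems(2) in \<open>auto simp: frechet_derivativeI[OF D]\<close>)
  then show ?case using D by (auto simp: differentiable_def)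
qed

lemma Ck_on_SucD: "Ck_on (Suc k) S f \<Longrightarrow> Ck_on k S f"
proof (induction k arbitrary: f)
  case 0
  then show ?case
    by (auto intro!: continuous_at_imp_continuous_on differentiable_imp_continuous_within)
next
  case (Suc k)
  have "Ck_on (Suc k) S (\<lambda>x. frechet_derivative f (at x) v)" for v
    using Suc.prems by (subst (asm) Ck_on.simps(2)) blast
  from Suc.IH[OF this] show ?case using Suc.prems by simp
qed

lemma Ck_on_const: "Ck_on k S (\<lambda>x. c)"
proof (induction k arbitrary: c)
  case (Suc k)
  have "Ck_on k S (\<lambda>x. 0 :: 'b)" by (rule Suc)
  then show ?case by simp
qed simp

lemma Ck_on_bounded_linear:
  assumes "open S" "bounded_linear L" "Ck_on k S f"
  shows "Ck_on k S (\<lambda>x. L (f x))"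
  using assms(3)
proof (induction k arbitrary: f)
  case 0
  then show ?case using bounded_linear.continuous_on[OF assms(2)] by simp
next
  case (Suc k)
  have D: "((\<lambda>x. L (f x)) has_derivative (\<lambda>v. L (frechet_derivative f (at x) v))) (at x)" if "x \<in> S" for x
    using Suc.prems that by (intro bounded_linear.has_derivative[OF assms(2)] differentiable_has_frechet_derivative) auto
  have "Ck_on k S (\<lambda>x. frechet_derivative (\<lambda>x. L (f x)) (at x) v)" for v
    by (rule Ck_on_cong[OF assms(1) _ Suc.IH[of "\<lambda>x. frechet_derivative f (at x) v"]])
      (use Suc.prems in \<open>simp_all add: frechet_derivativeI[OF D]\<close>)
  then show ?case using D by (auto simp: differentiable_def)
qed

lemma Ck_on_add:
  assumes "open S" "Ck_on k S f" "Ck_on k S g"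
  shows "Ck_on k S (\<lambda>x. f x + g x)"
  using assms(2,3)
proof (induction k arbitrary: f g)
  case 0
  then show ?case by (simp add: continuous_on_add)
next
  case (Suc k)
  have D: "((\<lambda>x. f x + g x) has_derivative
      (\<lambda>v. frechet_derivative f (at x) v + frechet_derivative g (at x) v)) (at x)" if "x \<in> S" for x
    using Suc.prems that by (intro has_derivative_add) (auto simp: frechet_derivative_works)
  have "Ck_on k S (\<lambda>x. frechet_derivative (\<lambda>x. f x + g x) (at x) v)" for v
    by (rule Ck_on_cong[OF assms(1) _ Suc.IH[of "\<lambda>x. frechet_derivative f (at x) v" "\<lambda>x. frechet_derivative g (at x) v"]])
      (use Suc.prems in \<open>simp_all add: frechet_derivativeI[OF D]\<close>)
  then show ?case using D by (auto simp: differentiable_def)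
qed

lemma Ck_on_sum:
  assumes "open S" "\<And>i. i \<in> I \<Longrightarrow> Ck_on k S (f i)"
  shows "Ck_on k S (\<lambda>x. \<Sum>i\<in>I. f i x)"
  using assms(2)
  by (induction I rule: infinite_finite_induct) (auto intro: Ck_on_const Ck_on_add[OF assms(1)])

lemma Ck_on_scaleR:
  assumes "open S" "Ck_on k S f" "Ck_on k S g"
  shows "Ck_on k S (\<lambda>x. f x *\<^sub>R g x)"
  using assms(2,3)
proof (induction k arbitrary: f g)
  case 0
  then show ?case by (simp add: continuous_on_scaleR)
next
  case (Suc k)
  have D: "((\<lambda>x. f x *\<^sub>R g x) has_derivative
      (\<lambda>v. f x *\<^sub>R frechet_derivative g (at x) v + frechet_derivative f (at x) v *\<^sub>R g x)) (at x)" if "x \<in> S" for x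
    using Suc.prems that by (intro has_derivative_scaleR) (auto simp: frechet_derivative_works)
  have 1: "Ck_on k S f" "Ck_on k S g" using Suc.prems Ck_on_SucD by blast+
  have "Ck_on k S (\<lambda>x. f x *\<^sub>R frechet_derivative g (at x) v + frechet_derivative f (at x) v *\<^sub>R g x)" for v
    using Suc.prems 1 by (intro Ck_on_add[OF assms(1)] Suc.IH) auto
  then have "Ck_on k S (\<lambda>x. frechet_derivative (\<lambda>x. f x *\<^sub>R g x) (at x) v)" for v
    by (rule Ck_on_cong[OF assms(1), rotated]) (simp add: frechet_derivativeI[OF D])
  then show ?case using D by (auto simp: differentiable_def)
qed

lemma linear_euclidean_expansion:
  fixes v :: "'a::euclidean_space"
  assumes "linear L"
  shows "L v = (\<Sum>b\<in>Basis. (v \<bullet> b) *\<^sub>R L b)"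
  by (subst euclidean_representation[of v, symmetric])
    (simp add: linear_sum[OF assms] linear_scale[OF assms] del: euclidean_representation)

text \<open>By the chain rule the derivative of f is applied to a direction that varies with x,
  whereas \<open>Ck_on\<close> speaks of fixed directions. Expanding the direction in the
  \<open>Basis\<close> of the intermediate space reduces it to products of scalar functions with
  derivatives of f in fixed directions.\<close>

lemma Ck_on_compose:
  fixes g :: "'a::real_normed_vector \<Rightarrow> 'b::euclidean_space" and f :: "'b \<Rightarrow> 'c::real_normed_vector"
  assumes "open S" "open T" "g ` S \<subseteq> T" "Ck_on k T f" "Ck_on k S g"
  shows "Ck_on k S (\<lambda>x. f (g x))"
  using assms(4,5)
proof (induction k arbitrary: f)
  case 0
  then show ?case using continuous_on_compose2[of T f S g] assms(3) by simp
next
  case (Suc k)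
  let ?F = "\<lambda>y. frechet_derivative f (at y)" and ?G = "\<lambda>x. frechet_derivative g (at x)"
  have D: "((\<lambda>x. f (g x)) has_derivative (\<lambda>v. ?F (g x) (?G x v))) (at x)" if "x \<in> S" for x
    using Suc.prems that assms(3)
    by (intro has_derivative_compose[of g "?G x" x UNIV f "?F (g x)"] differentiable_has_frechet_derivative) auto
  have e: "?F (g x) (?G x v) = (\<Sum>b\<in>Basis. (?G x v \<bullet> b) *\<^sub>R ?F (g x) b)" if "x \<in> S" for x v
    using that assms(3) Suc.prems by (intro linear_euclidean_expansion linear_frechet_derivative) auto
  have "Ck_on k S (\<lambda>x. \<Sum>b\<in>Basis. (?G x v \<bullet> b) *\<^sub>R ?F (g x) b)" for v
  proof (intro Ck_on_sum Ck_on_scaleR assms(1))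
    fix b :: 'b
    show "Ck_on k S (\<lambda>x. ?G x v \<bullet> b)"
      using Suc.prems(2) by (intro Ck_on_bounded_linear[OF assms(1) bounded_linear_inner_left]) simp
    show "Ck_on k S (\<lambda>x. ?F (g x) b)"
      by (rule Suc.IH[of "\<lambda>y. ?F y b"]) (use Suc.prems Ck_on_SucD in auto)
  qed
  then have "Ck_on k S (\<lambda>x. frechet_derivative (\<lambda>x. f (g x)) (at x) v)" for v
    by (rule Ck_on_cong[OF assms(1), rotated]) (simp add: frechet_derivativeI[OF D] e)
  then show ?case using D by (auto simp: differentiable_def)
qed

text \<open>Derivatives in \<open>Ck_on\<close> are taken at a point, not within \<open>S\<close>,
  so neighbourhoods of the points of \<open>S\<close> decide.\<close>

lemma Ck_on_local:
  assumes "\<And>p. p \<in> S \<Longrightarrow> \<exists>T. open T \<and> p \<in> T \<and> Ck_on k T f"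
  shows "Ck_on k S f"
  using assms
proof (induction k arbitrary: f)
  case 0
  have "isCont f p" if "p \<in> S" for p
    using 0[OF that] by (auto simp: continuous_on_eq_continuous_at)
  then show ?case by (simp add: continuous_at_imp_continuous_on)
next
  case (Suc k)
  have "Ck_on k S (\<lambda>x. frechet_derivative f (at x) v)" for v
    proof (rule Suc.IH)
    fix p assume "p \<in> S"
    then obtain T where "open T" "p \<in> T" "Ck_on (Suc k) T f" using Suc.prems by blast
    then show "\<exists>T. open T \<and> p \<in> T \<and> Ck_on k T (\<lambda>x. frechet_derivative f (at x) v)" by auto
  qed
  moreover have "f differentiable at p" if "p \<in> S" for p
    using Suc.prems[OF that] by auto
  ultimately show ?case by simp
qed

section \<open>Smoothness at a point\<close>

text \<open>Charts and their inverses are meaningful only near a point. Pointwise smoothness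
  together with \<open>eventually\<close> statements replaces the bookkeeping of open
  domains.\<close>

definition smooth_at :: "'a::real_normed_vector \<Rightarrow> ('a \<Rightarrow> 'b::real_normed_vector) \<Rightarrow> bool" where
  "smooth_at p f \<longleftrightarrow> (\<exists>S. open S \<and> p \<in> S \<and> smooth_on S f)"

lemma smooth_on_imp_smooth_at: "smooth_on S f \<Longrightarrow> open S \<Longrightarrow> p \<in> S \<Longrightarrow> smooth_at p f"
  by (auto simp: smooth_at_def)

lemma smooth_at_imp_smooth_on: "(\<And>p. p \<in> S \<Longrightarrow> smooth_at p f) \<Longrightarrow> smooth_on S f"
  unfolding smooth_on_def smooth_at_def by (intro allI Ck_on_local) meson

lemma smooth_at_differentiable: "smooth_at p f \<Longrightarrow> f differentiable at p"
  unfolding smooth_at_def smooth_on_def by (metis Ck_on.simps(2))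

lemma smooth_at_isCont: "smooth_at p f \<Longrightarrow> isCont f p"
  using differentiable_imp_continuous_within smooth_at_differentiable by blast

lemma smooth_at_has_derivative:
  "smooth_at p f \<Longrightarrow> (f has_derivative (\<lambda>v. frechet_derivative f (at p) v)) (at p)"
  by (intro differentiable_has_frechet_derivative smooth_at_differentiable)

lemma smooth_at_linear: "smooth_at p f \<Longrightarrow> linear (frechet_derivative f (at p))"
  by (intro linear_frechet_derivative smooth_at_differentiable)

lemma smooth_at_eventually: "smooth_at p f \<Longrightarrow> \<forall>\<^sub>F x in nhds p. smooth_at x f"
  unfolding smooth_at_def eventually_nhds by blast

lemma smooth_on_subset: "smooth_on S f \<Longrightarrow> T \<subseteq> S \<Longrightarrow> smooth_on T f"
  unfolding smooth_on_def using Ck_on_subset by blast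

lemma smooth_at_cong:
  assumes "smooth_at p f" "\<forall>\<^sub>F x in nhds p. f x = g x"
  shows "smooth_at p g"
proof -
  obtain S where S: "open S" "p \<in> S" "smooth_on S f" using assms(1) by (auto simp: smooth_at_def)
  obtain T where T: "open T" "p \<in> T" "\<And>x. x \<in> T \<Longrightarrow> f x = g x"
    using assms(2) by (auto simp: eventually_nhds)
  have "smooth_on (S \<inter> T) g"
    unfolding smooth_on_def
  proof
    fix k
    have "Ck_on k (S \<inter> T) f" using S(3) Ck_on_subset unfolding smooth_on_def by blast
    then show "Ck_on k (S \<inter> T) g"
      by (rule Ck_on_cong[rotated 2]) (use S T in auto)
  qed
  then show ?thesis unfolding smooth_at_def using S T by (metis open_Int IntI)
qed

lemma frechet_derivative_eventually_cong:
  assumes "\<forall>\<^sub>F x in nhds p. f x = g x"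
  shows "frechet_derivative f (at p) = frechet_derivative g (at p)"
proof -
  obtain T where T: "open T" "p \<in> T" "\<And>x. x \<in> T \<Longrightarrow> f x = g x"
    using assms by (auto simp: eventually_nhds)
  have "(f has_derivative D) (at p) \<longleftrightarrow> (g has_derivative D) (at p)" for D
    using has_derivative_transform_open[OF T(1,2)] T(3) by metis
  then show ?thesis by (simp add: frechet_derivative_def)
qed

lemma smooth_at_frechet: "smooth_at p f \<Longrightarrow> smooth_at p (\<lambda>x. frechet_derivative f (at x) v)"
  unfolding smooth_at_def smooth_on_def by (metis Ck_on.simps(2))

lemma smooth_at_const: "smooth_at p (\<lambda>x. c)"
  unfolding smooth_at_def smooth_on_def by (intro exI[of _ UNIV]) (auto intro: Ck_on_const)

lemma smooth_on_bounded_linear_self: "bounded_linear L \<Longrightarrow> smooth_on UNIV L"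
  unfolding smooth_on_def
proof
  fix k assume L: "bounded_linear L"
  show "Ck_on k UNIV L"
    by (cases k) (use L bounded_linear_imp_has_derivative[OF L] frechet_derivativeI[OF bounded_linear_imp_has_derivative[OF L]]
      in \<open>auto simp: linear_continuous_on differentiable_def Ck_on_const\<close>)
qed

lemma smooth_at_bounded_linear_self: "bounded_linear L \<Longrightarrow> smooth_at p L"
  using smooth_on_bounded_linear_self smooth_on_imp_smooth_at by blast

lemma smooth_at_ident: "smooth_at p (\<lambda>x. x)"
  by (intro smooth_at_bounded_linear_self bounded_linear_ident)

lemma smooth_at_compose:
  fixes g :: "'a::real_normed_vector \<Rightarrow> 'b::euclidean_space" and f :: "'b \<Rightarrow> 'c::real_normed_vector"
  assumes "smooth_at (g p) f" "smooth_at p g"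
  shows "smooth_at p (\<lambda>x. f (g x))"
proof -
  obtain T where T: "open T" "g p \<in> T" "smooth_on T f" using assms(1) by (auto simp: smooth_at_def)
  obtain S where S: "open S" "p \<in> S" "smooth_on S g" using assms(2) by (auto simp: smooth_at_def)
  have "continuous_on S g" using S(3) unfolding smooth_on_def by (metis Ck_on.simps(1))
  then have o: "open (S \<inter> g -` T)" using S(1) T(1) continuous_open_preimage by blast
  have "Ck_on k (S \<inter> g -` T) g" for k
    using S(3) Ck_on_subset unfolding smooth_on_def by blast
  then have "Ck_on k (S \<inter> g -` T) (\<lambda>x. f (g x))" for k
    using T(3) by (intro Ck_on_compose[OF o T(1), of g k f]) (auto simp: smooth_on_def)
  then show ?thesis unfolding smooth_at_def smooth_on_def using o S(2) T(2) by blast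
qed

lemma smooth_at_linear_compose:
  fixes L :: "'b::euclidean_space \<Rightarrow> 'c::euclidean_space"
  shows "linear L \<Longrightarrow> smooth_at p g \<Longrightarrow> smooth_at p (\<lambda>x. L (g x))"
  by (rule smooth_at_compose[of g p L]) (auto simp: linear_conv_bounded_linear intro: smooth_at_bounded_linear_self)

lemma smooth_at_binop:
  assumes "smooth_at p f" "smooth_at p g"
    and "\<And>S k. open S \<Longrightarrow> Ck_on k S f \<Longrightarrow> Ck_on k S g \<Longrightarrow> Ck_on k S h"
  shows "smooth_at p h"
proof -
  obtain T where T: "open T" "p \<in> T" "smooth_on T f" using assms(1) by (auto simp: smooth_at_def)
  obtain S where S: "open S" "p \<in> S" "smooth_on S g" using assms(2) by (auto simp: smooth_at_def)
  have "Ck_on k (S \<inter> T) h" for k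
  proof (rule assms(3))
    show "open (S \<inter> T)" using S T by blast
    show "Ck_on k (S \<inter> T) f" "Ck_on k (S \<inter> T) g"
      using S(3) T(3) by (auto simp: smooth_on_def intro: Ck_on_subset)
  qed
  then show ?thesis unfolding smooth_at_def smooth_on_def using S T by (metis open_Int IntI)
qed

lemma smooth_at_add: "smooth_at p f \<Longrightarrow> smooth_at p g \<Longrightarrow> smooth_at p (\<lambda>x. f x + g x)"
  by (erule (1) smooth_at_binop) (intro Ck_on_add)

lemma smooth_at_scaleR: "smooth_at p f \<Longrightarrow> smooth_at p g \<Longrightarrow> smooth_at p (\<lambda>x. f x *\<^sub>R g x)"
  by (erule (1) smooth_at_binop) (intro Ck_on_scaleR)

lemma smooth_at_sum: "(\<And>i. i \<in> I \<Longrightarrow> smooth_at p (f i)) \<Longrightarrow> smooth_at p (\<lambda>x. \<Sum>i\<in>I. f i x)"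
  by (induction I rule: infinite_finite_induct) (auto intro: smooth_at_const smooth_at_add)

lemma smooth_at_Pair:
  fixes f :: "'a::real_normed_vector \<Rightarrow> 'b::euclidean_space" and g :: "'a \<Rightarrow> 'c::euclidean_space"
  assumes "smooth_at p f" "smooth_at p g"
  shows "smooth_at p (\<lambda>x. (f x, g x))"
proof -
  have l: "linear (\<lambda>u::'b. (u, 0::'c))" "linear (\<lambda>u::'c. (0::'b, u))"
    by (auto intro!: linearI)
  have "smooth_at p (\<lambda>x. (f x, 0::'c) + (0::'b, g x))"
    by (rule smooth_at_add[OF smooth_at_linear_compose[OF l(1) assms(1)] smooth_at_linear_compose[OF l(2) assms(2)]])
  then show ?thesis by simp
qed

text \<open>\<open>T\<close> is not treated as a map into a space of operators; its smoothness is
  that of each \<open>T x b\<close>. Expanding \<open>w x\<close> in \<open>Basis\<close> leaves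
  finitely many products.\<close>

lemma smooth_at_linear_apply:
  fixes w :: "'a::real_normed_vector \<Rightarrow> 'b::euclidean_space" and T :: "'a \<Rightarrow> 'b \<Rightarrow> 'c::real_normed_vector"
  assumes "\<forall>\<^sub>F x in nhds p. linear (T x)" "\<And>b. smooth_at p (\<lambda>x. T x b)" "smooth_at p w"
  shows "smooth_at p (\<lambda>x. T x (w x))"
proof (rule smooth_at_cong)
  show "smooth_at p (\<lambda>x. \<Sum>b\<in>Basis. (w x \<bullet> b) *\<^sub>R T x b)"
    using assms(2,3) by (intro smooth_at_sum smooth_at_scaleR smooth_at_linear_compose[of "\<lambda>u. u \<bullet> b" p w for b])
      (auto intro!: linearI simp: inner_left_distrib)
  show "\<forall>\<^sub>F x in nhds p. (\<Sum>b\<in>Basis. (w x \<bullet> b) *\<^sub>R T x b) = T x (w x)"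
    using assms(1) by eventually_elim (metis linear_euclidean_expansion)
qed

section \<open>Symmetry of second derivatives\<close>

text \<open>The mean value theorem is applied along u to the difference of F across h v, and then
  along v to the derivative of F in direction u.\<close>

lemma second_difference_mean_value:
  fixes F :: "'a::real_normed_vector \<Rightarrow> real"
  assumes S: "\<And>s t. 0 \<le> s \<Longrightarrow> s \<le> h \<Longrightarrow> 0 \<le> t \<Longrightarrow> t \<le> h \<Longrightarrow> p + s *\<^sub>R u + t *\<^sub>R v \<in> S"
    and F: "\<And>x. x \<in> S \<Longrightarrow> F differentiable at x"
    and DF: "\<And>x. x \<in> S \<Longrightarrow> (\<lambda>x. frechet_derivative F (at x) u) differentiable at x"
    and h: "0 < h"
  shows "\<exists>s t. 0 \<le> s \<and> s \<le> h \<and> 0 \<le> t \<and> t \<le> h \<and>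
    F (p + h *\<^sub>R u + h *\<^sub>R v) - F (p + h *\<^sub>R u) - F (p + h *\<^sub>R v) + F p =
    h * h * frechet_derivative (\<lambda>x. frechet_derivative F (at x) u) (at (p + s *\<^sub>R u + t *\<^sub>R v)) v"
proof -
  let ?D = "\<lambda>x. frechet_derivative F (at x) u"
  define g where "g s = F (p + s *\<^sub>R u + h *\<^sub>R v) - F (p + s *\<^sub>R u)" for s
  have lin: "linear (frechet_derivative F (at x))" if "x \<in> S" for x
    using F that by (intro linear_frechet_derivative)
  have dF: "((\<lambda>s. F (p + s *\<^sub>R u + t *\<^sub>R v)) has_real_derivative ?D (p + s *\<^sub>R u + t *\<^sub>R v)) (at s)"
    if "0 \<le> s" "s \<le> h" "0 \<le> t" "t \<le> h" for s t
  proof -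
    have "((\<lambda>s. F (p + s *\<^sub>R u + t *\<^sub>R v)) has_derivative
      (\<lambda>r. frechet_derivative F (at (p + s *\<^sub>R u + t *\<^sub>R v)) (r *\<^sub>R u))) (at s)"
      by (rule has_derivative_compose[of "\<lambda>s. p + s *\<^sub>R u + t *\<^sub>R v"])
        (auto intro!: derivative_eq_intros differentiable_has_frechet_derivative F S that)
    then show ?thesis
      using lin[OF S[OF that]] by (auto simp: has_field_derivative_def linear_scale mult.commute fun_eq_iff
          elim!: has_derivative_eq_rhs)
  qed
  have dD: "((\<lambda>t. ?D (p + s *\<^sub>R u + t *\<^sub>R v)) has_real_derivative
      frechet_derivative ?D (at (p + s *\<^sub>R u + t *\<^sub>R v)) v) (at t)"
    if "0 \<le> s" "s \<le> h" "0 \<le> t" "t \<le> h" for s t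
  proof -
    have "((\<lambda>t. ?D (p + s *\<^sub>R u + t *\<^sub>R v)) has_derivative
      (\<lambda>r. frechet_derivative ?D (at (p + s *\<^sub>R u + t *\<^sub>R v)) (r *\<^sub>R v))) (at t)"
      by (rule has_derivative_compose[of "\<lambda>t. p + s *\<^sub>R u + t *\<^sub>R v"])
        (auto intro!: derivative_eq_intros differentiable_has_frechet_derivative DF S that)
    then show ?thesis
      using linear_frechet_derivative[OF DF[OF S[OF that]]]
      by (auto simp: has_field_derivative_def linear_scale mult.commute fun_eq_iff
          elim!: has_derivative_eq_rhs)
  qed
  have "\<exists>s>0. s < h \<and> g h - g 0 = (h - 0) * (?D (p + s *\<^sub>R u + h *\<^sub>R v) - ?D (p + s *\<^sub>R u))"
    unfolding g_def
    by (rule MVT2[OF h]) (use dF[of _ h] dF[of _ 0] h in \<open>auto intro!: DERIV_diff\<close>)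
  then obtain s where s: "0 < s" "s < h" "g h - g 0 = h * (?D (p + s *\<^sub>R u + h *\<^sub>R v) - ?D (p + s *\<^sub>R u))"
    by auto
  have "\<exists>t>0. t < h \<and> ?D (p + s *\<^sub>R u + h *\<^sub>R v) - ?D (p + s *\<^sub>R u + 0 *\<^sub>R v) =
      (h - 0) * frechet_derivative ?D (at (p + s *\<^sub>R u + t *\<^sub>R v)) v"
    by (rule MVT2[OF h]) (use dD[of s] s in auto)
  then obtain t where t: "0 < t" "t < h"
    "?D (p + s *\<^sub>R u + h *\<^sub>R v) - ?D (p + s *\<^sub>R u) = h * frechet_derivative ?D (at (p + s *\<^sub>R u + t *\<^sub>R v)) v"
    by auto
  have "F (p + h *\<^sub>R u + h *\<^sub>R v) - F (p + h *\<^sub>R u) - F (p + h *\<^sub>R v) + F p = g h - g 0"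
    by (simp add: g_def)
  then show ?thesis using s t by (intro exI[of _ s] exI[of _ t]) auto
qed

text \<open>The second difference does not change when u and v are exchanged, so the two mixed
  derivatives take equal values at two points of a small parallelogram. Continuity at p closes the
  gap.\<close>

lemma frechet_derivative_symmetric_real:
  fixes F :: "'a::real_normed_vector \<Rightarrow> real"
  assumes "smooth_at p F"
  shows "frechet_derivative (\<lambda>x. frechet_derivative F (at x) u) (at p) v =
    frechet_derivative (\<lambda>x. frechet_derivative F (at x) v) (at p) u"
proof -
  obtain S where S: "open S" "p \<in> S" "smooth_on S F" using assms by (auto simp: smooth_at_def)
  have F: "F differentiable at x" "\<And>w. (\<lambda>x. frechet_derivative F (at x) w) differentiable at x"
    if "x \<in> S" for x
  proof -
    have "smooth_at x F" using S smooth_on_imp_smooth_at that by blast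
    then show "F differentiable at x" "\<And>w. (\<lambda>x. frechet_derivative F (at x) w) differentiable at x"
      using smooth_at_differentiable smooth_at_frechet by blast+
  qed
  let ?A = "\<lambda>u v x. frechet_derivative (\<lambda>x. frechet_derivative F (at x) u) (at x) v"
  have cont: "isCont (?A u v) p" for u v
    by (intro smooth_at_isCont smooth_at_frechet assms)
  obtain r where r: "r > 0" "ball p r \<subseteq> S" using S openE by blast
  have "\<bar>?A u v p - ?A v u p\<bar> < e" if e: "e > 0" for e
  proof -
    obtain d1 where d1: "d1 > 0" "\<And>x. dist x p < d1 \<Longrightarrow> \<bar>?A u v x - ?A u v p\<bar> < e / 2"
      using cont[of u v] e unfolding continuous_at_eps_delta dist_real_def by (metis half_gt_zero)
    obtain d2 where d2: "d2 > 0" "\<And>x. dist x p < d2 \<Longrightarrow> \<bar>?A v u x - ?A v u p\<bar> < e / 2"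
      using cont[of v u] e unfolding continuous_at_eps_delta dist_real_def by (metis half_gt_zero)
    define d where "d = min r (min d1 d2)"
    have d: "d > 0" "d \<le> r" "d \<le> d1" "d \<le> d2" using r d1 d2 by (auto simp: d_def)
    \<comment> \<open>This side length keeps the parallelogram within distance d of p; the summand 1
      covers u = v = 0.\<close>
    define h where "h = d / (norm u + norm v + 1)"
    have n: "norm u + norm v + 1 > 0" by (smt (verit) norm_ge_zero)
    have h: "h > 0" using d n by (simp add: h_def)
    have near: "dist (p + s *\<^sub>R a + t *\<^sub>R b) p < d"
      if "0 \<le> s" "s \<le> h" "0 \<le> t" "t \<le> h" "{a, b} = {u, v}" for s t a b
    proof -
      have "dist (p + s *\<^sub>R a + t *\<^sub>R b) p = norm (s *\<^sub>R a + t *\<^sub>R b)" by (simp add: dist_norm)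
      also have "\<dots> \<le> s * norm a + t * norm b" using norm_triangle_ineq[of "s *\<^sub>R a" "t *\<^sub>R b"] that by simp
      also have "\<dots> \<le> h * norm a + h * norm b" using that by (intro add_mono mult_right_mono) auto
      also have "\<dots> \<le> h * (norm u + norm v)" using that(5) by (auto simp: doubleton_eq_iff algebra_simps)
      also have "\<dots> < h * (norm u + norm v + 1)" using h by simp
      also have "\<dots> = d" using n by (simp add: h_def)
      finally show ?thesis .
    qed
    have inS: "x \<in> S" if "dist x p < d" for x using that r(2) d(2) by (auto simp: dist_commute subset_iff)
    obtain s t where 1: "0 \<le> s" "s \<le> h" "0 \<le> t" "t \<le> h"
      "F (p + h *\<^sub>R u + h *\<^sub>R v) - F (p + h *\<^sub>R u) - F (p + h *\<^sub>R v) + F p = h * h * ?A u v (p + s *\<^sub>R u + t *\<^sub>R v)"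
      using second_difference_mean_value[of h p u v S F, OF inS[OF near] F(1) F(2) h] by blast
    obtain s' t' where 2: "0 \<le> s'" "s' \<le> h" "0 \<le> t'" "t' \<le> h"
      "F (p + h *\<^sub>R v + h *\<^sub>R u) - F (p + h *\<^sub>R v) - F (p + h *\<^sub>R u) + F p = h * h * ?A v u (p + s' *\<^sub>R v + t' *\<^sub>R u)"
      using second_difference_mean_value[of h p v u S F, OF inS[OF near] F(1) F(2) h] by blast
    have "p + h *\<^sub>R v + h *\<^sub>R u = p + h *\<^sub>R u + h *\<^sub>R v" by simp
    then have "h * h * ?A u v (p + s *\<^sub>R u + t *\<^sub>R v) = h * h * ?A v u (p + s' *\<^sub>R v + t' *\<^sub>R u)"
      using 1(5) 2(5) by (simp only:)
    then have "?A u v (p + s *\<^sub>R u + t *\<^sub>R v) = ?A v u (p + s' *\<^sub>R v + t' *\<^sub>R u)" using h by simp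
    moreover have "dist (p + s *\<^sub>R u + t *\<^sub>R v) p < d1" "dist (p + s' *\<^sub>R v + t' *\<^sub>R u) p < d2"
      using near[of s t u v] near[of s' t' v u] 1 2 d by (auto simp: insert_commute)
    ultimately show ?thesis using d1(2)[of "p + s *\<^sub>R u + t *\<^sub>R v"] d2(2)[of "p + s' *\<^sub>R v + t' *\<^sub>R u"] by linarith
  qed
  \<comment> \<open>If the difference were nonzero, its absolute value could serve as e and would be
    smaller than itself.\<close>
  from this[of "\<bar>?A u v p - ?A v u p\<bar>"] show ?thesis by fastforce
qed

lemma frechet_derivative_symmetric:
  fixes F :: "'a::real_normed_vector \<Rightarrow> 'b::euclidean_space"
  assumes "smooth_at p F"
  shows "frechet_derivative (\<lambda>x. frechet_derivative F (at x) u) (at p) v =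
    frechet_derivative (\<lambda>x. frechet_derivative F (at x) v) (at p) u"
proof (rule euclidean_eqI)
  fix b :: 'b assume "b \<in> Basis"
  have bl: "linear (\<lambda>x. x \<bullet> b)" by (simp add: bounded_linear.linear bounded_linear_inner_left)
  have c: "frechet_derivative (\<lambda>x. f x \<bullet> b) (at x) w = frechet_derivative f (at x) w \<bullet> b"
    if "smooth_at x f" for f :: "'a \<Rightarrow> 'b" and x w
    using frechet_derivativeI[OF bounded_linear.has_derivative[OF bounded_linear_inner_left smooth_at_has_derivative[OF that]]]
    by (rule fun_cong)
  have e: "\<forall>\<^sub>F x in nhds p. frechet_derivative (\<lambda>x. F x \<bullet> b) (at x) u = frechet_derivative F (at x) u \<bullet> b" for u
    using smooth_at_eventually[OF assms] by eventually_elim (simp add: c)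
  have s: "frechet_derivative (\<lambda>x. frechet_derivative (\<lambda>x. F x \<bullet> b) (at x) u) (at p) v =
     frechet_derivative (\<lambda>x. frechet_derivative F (at x) u) (at p) v \<bullet> b" for u v
    using frechet_derivative_eventually_cong[OF e] c[OF smooth_at_frechet[OF assms]] by simp
  have "smooth_at p (\<lambda>x. F x \<bullet> b)" by (rule smooth_at_linear_compose[OF bl assms])
  from frechet_derivative_symmetric_real[OF this] show
    "frechet_derivative (\<lambda>x. frechet_derivative F (at x) u) (at p) v \<bullet> b =
     frechet_derivative (\<lambda>x. frechet_derivative F (at x) v) (at p) u \<bullet> b"
    by (simp add: s)
qed

subsection \<open>Charts of a Lie group\<close>

lemma lie_group_group: "lie_group G A \<Longrightarrow> group G"
  by (simp add: lie_group_def)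

lemma lie_group_manifold: "lie_group G A \<Longrightarrow> smooth_manifold (top_of_set (carrier G)) A"
  by (simp add: lie_group_def Let_def)

lemma lie_group_chart_exists:
  assumes "lie_group G A" "p \<in> carrier G"
  obtains U \<phi> where "(U, \<phi>) \<in> A" "p \<in> U"
proof -
  have "p \<in> (\<Union>(U, \<phi>)\<in>A. U)"
    using lie_group_manifold[OF assms(1)] assms(2) by (simp add: smooth_manifold_def)
  then show thesis using that by blast
qed

context
  fixes G :: "('g::topological_space, 'm) monoid_scheme" and A :: "('g, 'e::euclidean_space) atlas"
    and U \<phi>
  assumes G: "lie_group G A" and U: "(U, \<phi>) \<in> A"
begin

lemma chart_is_chart: "is_chart (top_of_set (carrier G)) (U, \<phi>)"
  using lie_group_manifold[OF G] U by (auto simp: smooth_manifold_def)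

lemma chart_openin: "openin (top_of_set (carrier G)) U"
  using chart_is_chart by (simp add: is_chart_def)

lemma chart_subset: "p \<in> U \<Longrightarrow> p \<in> carrier G"
  using openin_subset[OF chart_openin] by auto

lemma chart_inj: "inj_on \<phi> U"
proof -
  have "U \<subseteq> carrier G" using chart_subset by blast
  then show ?thesis
    using chart_is_chart homeomorphic_imp_injective_map
    by (fastforce simp: is_chart_def Int_absorb1)
qed

lemma chart_inv: "p \<in> U \<Longrightarrow> inv_into U \<phi> (\<phi> p) = p"
  using chart_inj by simp

lemma chart_open_image:
  assumes "openin (top_of_set (carrier G)) W"
  shows "open (\<phi> ` (U \<inter> W))"
proof -
  have "open_map (subtopology (top_of_set (carrier G)) U) (top_of_set (\<phi> ` U)) \<phi>"
    using chart_is_chart by (auto simp: is_chart_def intro: homeomorphic_imp_open_map)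
  moreover have "openin (subtopology (top_of_set (carrier G)) U) (U \<inter> W)"
    using assms by (simp add: openin_subtopology_Int2)
  ultimately have "openin (top_of_set (\<phi> ` U)) (\<phi> ` (U \<inter> W))"
    unfolding open_map_def by blast
  moreover have "open (\<phi> ` U)" using chart_is_chart by (simp add: is_chart_def)
  ultimately show ?thesis using openin_open_trans by blast
qed

lemma chart_open_image_self: "open (\<phi> ` U)"
  using chart_is_chart by (simp add: is_chart_def)

lemma chart_eventually_in:
  assumes "openin (top_of_set (carrier G)) W" "p \<in> U" "p \<in> W"
  shows "\<forall>\<^sub>F y in nhds (\<phi> p). y \<in> \<phi> ` U \<and> inv_into U \<phi> y \<in> U \<and> inv_into U \<phi> y \<in> W \<and> \<phi> (inv_into U \<phi> y) = y"
proof -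
  have "\<forall>\<^sub>F y in nhds (\<phi> p). y \<in> \<phi> ` (U \<inter> W)"
    using chart_open_image[OF assms(1)] assms(2,3) by (intro eventually_nhds_in_open) auto
  then show ?thesis
    by eventually_elim (auto simp: chart_inv)
qed

text \<open>\<open>inv_into\<close> has arbitrary values outside the chart image, so formulas in
  charts are asserted only near the point. This is the form in which continuity of a map of the
  group supplies such neighbourhoods.\<close>

lemma chart_eventually:
  assumes "continuous_map (top_of_set (carrier G)) (top_of_set (carrier G)) f"
    and "openin (top_of_set (carrier G)) W" "p \<in> U" "f p \<in> W"
  shows "\<forall>\<^sub>F y in nhds (\<phi> p). inv_into U \<phi> y \<in> U \<and> f (inv_into U \<phi> y) \<in> W \<and> \<phi> (inv_into U \<phi> y) = y"
proof -
  have "openin (top_of_set (carrier G)) {x \<in> carrier G. f x \<in> W}"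
    using openin_continuous_map_preimage[OF assms(1,2)] by simp
  then have "\<forall>\<^sub>F y in nhds (\<phi> p). y \<in> \<phi> ` U \<and> inv_into U \<phi> y \<in> U \<and>
      inv_into U \<phi> y \<in> {x \<in> carrier G. f x \<in> W} \<and> \<phi> (inv_into U \<phi> y) = y"
    using assms chart_subset by (intro chart_eventually_in) auto
  then show ?thesis by eventually_elim auto
qed

end

lemma continuous_map_translation:
  assumes "lie_group G A" "g \<in> carrier G"
  shows "continuous_map (top_of_set (carrier G)) (top_of_set (carrier G)) (\<lambda>x. g \<otimes>\<^bsub>G\<^esub> x)"
proof -
  let ?X = "top_of_set (carrier G)"
  have m: "continuous_map (prod_topology ?X ?X) ?X (\<lambda>(x, y). x \<otimes>\<^bsub>G\<^esub> y)"
    using assms(1) by (simp add: lie_group_def smooth_map_def Let_def)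
  have "continuous_map ?X (prod_topology ?X ?X) (\<lambda>x. (g, x))"
    using assms(2) by (intro continuous_map_pairedI) auto
  from continuous_map_compose[OF this m] show ?thesis by (simp add: comp_def)
qed

subsection \<open>Forms on a quotient\<close>

text \<open>A coset chart is a bare pair of a set and a map, and several triples may produce the
  same pair. One choice is fixed for each chart, so that \<open>descend\<close> becomes a function
  of the chart.\<close>

definition source_chart ::
  "('g::topological_space, 'm) monoid_scheme \<Rightarrow> 'g set \<Rightarrow> ('g, 'e) atlas \<Rightarrow>
   ('g set, 'e) chart \<Rightarrow> 'g set \<times> ('g, 'e) chart" where
  "source_chart G \<Gamma> A c = (SOME (W, U, \<phi>). c = (coset_proj G \<Gamma> ` W, \<phi> \<circ> inv_into W (coset_proj G \<Gamma>)) \<and>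
     (U, \<phi>) \<in> A \<and> W \<subseteq> U \<and> openin (top_of_set (carrier G)) W \<and> inj_on (coset_proj G \<Gamma>) W)"

text \<open>A coset chart reads the coordinates of the chosen chart of G, so the local expression is
  copied unchanged. Wedge product and exterior derivative therefore commute with
  \<open>descend\<close> by definition; left invariance is needed for the compatibility between
  charts and with the projection.\<close>

definition descend ::
  "('g::topological_space, 'm) monoid_scheme \<Rightarrow> 'g set \<Rightarrow> ('g, 'e) atlas \<Rightarrow>
   ('g, 'e) form \<Rightarrow> ('g set, 'e) form" where
  "descend G \<Gamma> A \<alpha> c = \<alpha> (snd (source_chart G \<Gamma> A c))"

lemma coset_chartE:
  assumes "(V, \<psi>) \<in> coset_atlas G \<Gamma> A"
  obtains W U \<phi> where "V = coset_proj G \<Gamma> ` W" "\<psi> = \<phi> \<circ> inv_into W (coset_proj G \<Gamma>)"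
    "(U, \<phi>) \<in> A" "W \<subseteq> U" "openin (top_of_set (carrier G)) W" "inj_on (coset_proj G \<Gamma>) W"
    "\<And>\<alpha>. descend G \<Gamma> A \<alpha> (V, \<psi>) = \<alpha> (U, \<phi>)"
proof -
  let ?P = "\<lambda>(W, U, \<phi>). (V, \<psi>) = (coset_proj G \<Gamma> ` W, \<phi> \<circ> inv_into W (coset_proj G \<Gamma>)) \<and>
     (U, \<phi>) \<in> A \<and> W \<subseteq> U \<and> openin (top_of_set (carrier G)) W \<and> inj_on (coset_proj G \<Gamma>) W"
  obtain W U \<phi> where s: "source_chart G \<Gamma> A (V, \<psi>) = (W, U, \<phi>)" by (metis prod_cases3)
  have "\<exists>z. ?P z" using assms by (fastforce simp: coset_atlas_def)
  then have "?P (source_chart G \<Gamma> A (V, \<psi>))"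
    unfolding source_chart_def by (rule someI_ex)
  then have P: "?P (W, U, \<phi>)" by (simp only: s)
  have d: "descend G \<Gamma> A \<alpha> (V, \<psi>) = \<alpha> (U, \<phi>)" for \<alpha> by (simp add: descend_def s)
  show thesis
    by (intro that[of W \<phi> U] d) (use P in auto)
qed

lemma coset_chart_image:
  assumes "inj_on \<pi> W"
  shows "(\<phi> \<circ> inv_into W \<pi>) ` \<pi> ` W = \<phi> ` W"
  using assms by (auto simp: image_image)

text \<open>The coset chart at the class of p may have been built near another representative g = h
  p with h in \<Gamma>. Near p, the projection followed by this chart is translation by h followed
  by the chart of G, so the claim becomes invariance of \<alpha> under h.\<close>

lemma descend_pullback:
  fixes A :: "('g::topological_space, 'e::euclidean_space) atlas"
  assumes G: "lie_group G A" and \<Gamma>: "subgroup \<Gamma> G" and inv: "left_invariant G A k \<alpha>"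
  shows "is_pullback A (coset_atlas G \<Gamma> A) (coset_proj G \<Gamma>) k (descend G \<Gamma> A \<alpha>) \<alpha>"
  unfolding is_pullback_def
proof (clarify)
  fix U' \<phi>' V \<psi> p and vs :: "'e list"
  assume U': "(U', \<phi>') \<in> A" and V: "(V, \<psi>) \<in> coset_atlas G \<Gamma> A" and p: "p \<in> U'" "coset_proj G \<Gamma> p \<in> V"
    and vs: "k = length vs"
  interpret group G using lie_group_group[OF G] .
  let ?\<pi> = "coset_proj G \<Gamma>"
  obtain W U \<phi> where W: "V = ?\<pi> ` W" "\<psi> = \<phi> \<circ> inv_into W ?\<pi>" "(U, \<phi>) \<in> A" "W \<subseteq> U"
      "openin (top_of_set (carrier G)) W" "inj_on ?\<pi> W" "descend G \<Gamma> A \<alpha> (V, \<psi>) = \<alpha> (U, \<phi>)"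
    using coset_chartE[OF V] by metis
  obtain g where g: "g \<in> W" "?\<pi> p = ?\<pi> g" using p(2) W(1) by blast
  have pc: "p \<in> carrier G" using chart_subset[OF G U' p(1)] .
  have gc: "g \<in> carrier G" using g(1) W(4) chart_subset[OF G W(3)] by blast
  have "g \<in> \<Gamma> #>\<^bsub>G\<^esub> p"
    using g(2) rcos_self[OF gc \<Gamma>] by (simp add: coset_proj_def)
  then obtain h where h: "h \<in> \<Gamma>" "g = h \<otimes>\<^bsub>G\<^esub> p" unfolding r_coset_def by blast
  have hc: "h \<in> carrier G" using h(1) subgroup.mem_carrier[OF \<Gamma>] by blast
  have \<pi>h: "?\<pi> (h \<otimes>\<^bsub>G\<^esub> x) = ?\<pi> x" if "x \<in> carrier G" for x
    using coset_mult_assoc[OF subgroup.subset[OF \<Gamma>] hc that] coset_join2[OF hc \<Gamma> h(1)]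
    by (simp add: coset_proj_def)
  have \<psi>: "\<psi> (?\<pi> x) = \<phi> x" if "x \<in> W" for x using that W(2,6) by simp
  have "\<forall>\<^sub>F y in nhds (\<phi>' p). inv_into U' \<phi>' y \<in> U' \<and> h \<otimes>\<^bsub>G\<^esub> inv_into U' \<phi>' y \<in> W \<and> \<phi>' (inv_into U' \<phi>' y) = y"
    by (rule chart_eventually[OF G U' continuous_map_translation[OF G hc] W(5) p(1)]) (use g h in simp)
  then have "\<forall>\<^sub>F y in nhds (\<phi>' p). (\<psi> \<circ> ?\<pi> \<circ> inv_into U' \<phi>') y = (\<phi> \<circ> (\<lambda>x. h \<otimes>\<^bsub>G\<^esub> x) \<circ> inv_into U' \<phi>') y"
  proof eventually_elim
    case (elim y)
    then have "?\<pi> (inv_into U' \<phi>' y) = ?\<pi> (h \<otimes>\<^bsub>G\<^esub> inv_into U' \<phi>' y)"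
      using \<pi>h chart_subset[OF G U'] by metis
    then show ?case using elim \<psi> by simp
  qed
  then have D: "frechet_derivative (\<psi> \<circ> ?\<pi> \<circ> inv_into U' \<phi>') (at (\<phi>' p)) =
      frechet_derivative (\<phi> \<circ> (\<lambda>x. h \<otimes>\<^bsub>G\<^esub> x) \<circ> inv_into U' \<phi>') (at (\<phi>' p))"
    by (rule frechet_derivative_eventually_cong)
  have "is_pullback A A (\<lambda>x. h \<otimes>\<^bsub>G\<^esub> x) k \<alpha> \<alpha>" using inv hc by (simp add: left_invariant_def)
  then have "\<alpha> (U', \<phi>') (\<phi>' p) vs = \<alpha> (U, \<phi>) (\<phi> (h \<otimes>\<^bsub>G\<^esub> p))
      (map (frechet_derivative (\<phi> \<circ> (\<lambda>x. h \<otimes>\<^bsub>G\<^esub> x) \<circ> inv_into U' \<phi>') (at (\<phi>' p))) vs)"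
    using U' W(3,4) p(1) g h(2) vs unfolding is_pullback_def by fastforce
  then show "\<alpha> (U', \<phi>') (\<phi>' p) vs = descend G \<Gamma> A \<alpha> (V, \<psi>) (\<psi> (?\<pi> p))
      (map (frechet_derivative (\<psi> \<circ> ?\<pi> \<circ> inv_into U' \<phi>') (at (\<phi>' p))) vs)"
    unfolding D W(7) g(2) \<psi>[OF g(1)] h(2)[symmetric] by simp
qed

text \<open>Near the point in question, the inverse of the first coset chart is the projection after
  the inverse of a chart of G. The transition rule is therefore \<open>descend_pullback\<close> read
  in that chart.\<close>

lemma descend_diff_form:
  fixes A :: "('g::topological_space, 'e::euclidean_space) atlas"
  assumes G: "lie_group G A" and \<Gamma>: "subgroup \<Gamma> G" and inv: "left_invariant G A k \<alpha>"
    and \<alpha>: "diff_form A k \<alpha>"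
  shows "diff_form (coset_atlas G \<Gamma> A) k (descend G \<Gamma> A \<alpha>)"
  unfolding diff_form_def
proof (intro conjI ballI)
  let ?\<pi> = "coset_proj G \<Gamma>"
  fix c assume c: "c \<in> coset_atlas G \<Gamma> A"
  obtain V \<psi> where V: "c = (V, \<psi>)" by fastforce
  obtain W U \<phi> where W: "V = ?\<pi> ` W" "\<psi> = \<phi> \<circ> inv_into W ?\<pi>" "(U, \<phi>) \<in> A" "W \<subseteq> U"
      "openin (top_of_set (carrier G)) W" "inj_on ?\<pi> W" "descend G \<Gamma> A \<alpha> (V, \<psi>) = \<alpha> (U, \<phi>)"
    using coset_chartE[OF c[unfolded V]] by metis
  have im: "\<psi> ` V = \<phi> ` W" using coset_chart_image[OF W(6)] W(1,2) by simp
  have sub: "\<phi> ` W \<subseteq> \<phi> ` U" using W(4) by blast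
  have "(\<forall>x\<in>\<phi> ` U. alternating k (\<alpha> (U, \<phi>) x)) \<and>
        (\<forall>vs. length vs = k \<longrightarrow> smooth_on (\<phi> ` U) (\<lambda>x. \<alpha> (U, \<phi>) x vs))"
    using \<alpha> W(3) unfolding diff_form_def by blast
  then show "case c of (V, \<psi>) \<Rightarrow> (\<forall>x\<in>\<psi> ` V. alternating k (descend G \<Gamma> A \<alpha> (V, \<psi>) x)) \<and>
        (\<forall>vs. length vs = k \<longrightarrow> smooth_on (\<psi> ` V) (\<lambda>x. descend G \<Gamma> A \<alpha> (V, \<psi>) x vs))"
    using sub smooth_on_subset[OF _ sub] unfolding V prod.case W(7) im by blast
next
  let ?\<pi> = "coset_proj G \<Gamma>"
  show "is_pullback (coset_atlas G \<Gamma> A) (coset_atlas G \<Gamma> A) (\<lambda>p. p) k (descend G \<Gamma> A \<alpha>) (descend G \<Gamma> A \<alpha>)"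
    unfolding is_pullback_def
  proof (clarify)
    fix V1 \<psi>1 V2 \<psi>2 p and vs :: "'e list"
    assume V1: "(V1, \<psi>1) \<in> coset_atlas G \<Gamma> A" and V2: "(V2, \<psi>2) \<in> coset_atlas G \<Gamma> A"
      and p: "p \<in> V1" "p \<in> V2" and vs: "k = length vs"
    obtain W U \<phi> where W: "V1 = ?\<pi> ` W" "\<psi>1 = \<phi> \<circ> inv_into W ?\<pi>" "(U, \<phi>) \<in> A" "W \<subseteq> U"
        "openin (top_of_set (carrier G)) W" "inj_on ?\<pi> W" "descend G \<Gamma> A \<alpha> (V1, \<psi>1) = \<alpha> (U, \<phi>)"
      using coset_chartE[OF V1] by metis
    obtain g where g: "g \<in> W" "p = ?\<pi> g" using p(1) W(1) by blast
    have gU: "g \<in> U" using g(1) W(4) by blast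
    have \<psi>1: "\<psi>1 (?\<pi> x) = \<phi> x" if "x \<in> W" for x using that W(2,6) by simp
    have inj: "inj_on \<psi>1 V1"
      using \<psi>1 W(1) chart_inj[OF G W(3)] W(4) by (auto simp: inj_on_def)
    have "\<forall>\<^sub>F y in nhds (\<phi> g). y \<in> \<phi> ` U \<and> inv_into U \<phi> y \<in> U \<and> inv_into U \<phi> y \<in> W \<and> \<phi> (inv_into U \<phi> y) = y"
      by (rule chart_eventually_in[OF G W(3) W(5) gU g(1)])
    then have "\<forall>\<^sub>F y in nhds (\<phi> g). (\<psi>2 \<circ> (\<lambda>p. p) \<circ> inv_into V1 \<psi>1) y = (\<psi>2 \<circ> ?\<pi> \<circ> inv_into U \<phi>) y"
    proof eventually_elim
      case (elim y)
      then have "\<psi>1 (?\<pi> (inv_into U \<phi> y)) = y" "?\<pi> (inv_into U \<phi> y) \<in> V1" using \<psi>1 W(1) by auto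
      then have "inv_into V1 \<psi>1 y = ?\<pi> (inv_into U \<phi> y)" using inj by (metis inv_into_f_f)
      then show ?case by simp
    qed
    then have D: "frechet_derivative (\<psi>2 \<circ> (\<lambda>p. p) \<circ> inv_into V1 \<psi>1) (at (\<phi> g)) =
        frechet_derivative (\<psi>2 \<circ> ?\<pi> \<circ> inv_into U \<phi>) (at (\<phi> g))"
      by (rule frechet_derivative_eventually_cong)
    have "\<alpha> (U, \<phi>) (\<phi> g) vs = descend G \<Gamma> A \<alpha> (V2, \<psi>2) (\<psi>2 (?\<pi> g))
      (map (frechet_derivative (\<psi>2 \<circ> ?\<pi> \<circ> inv_into U \<phi>) (at (\<phi> g))) vs)"
      using descend_pullback[OF G \<Gamma> inv] W(3) V2 gU p(2) vs g(2) unfolding is_pullback_def by fastforce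
    then show "descend G \<Gamma> A \<alpha> (V1, \<psi>1) (\<psi>1 p) vs = descend G \<Gamma> A \<alpha> (V2, \<psi>2) (\<psi>2 p)
      (map (frechet_derivative (\<psi>2 \<circ> (\<lambda>p. p) \<circ> inv_into V1 \<psi>1) (at (\<psi>1 p))) vs)"
      unfolding W(7) g(2) \<psi>1[OF g(1)] D by simp
  qed
qed

lemma descend_invariant_form:
  assumes "lie_group G A" "subgroup \<Gamma> G" "left_invariant G A k \<alpha>" "diff_form A k \<alpha>"
  shows "invariant_form G \<Gamma> A k (descend G \<Gamma> A \<alpha>)"
  unfolding invariant_form_def using assms descend_pullback by blast

lemma descend_zero_form: "descend G \<Gamma> A zero_form = zero_form"
  by (simp add: descend_def zero_form_def fun_eq_iff)

lemma descend_form_wedge: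
  "descend G \<Gamma> A (form_wedge k l \<alpha> \<beta>) = form_wedge k l (descend G \<Gamma> A \<alpha>) (descend G \<Gamma> A \<beta>)"
  by (simp add: descend_def form_wedge_def fun_eq_iff)

lemma descend_ext_deriv: "descend G \<Gamma> A (ext_deriv k \<alpha>) = ext_deriv k (descend G \<Gamma> A \<alpha>)"
  by (simp add: descend_def ext_deriv_def fun_eq_iff)

text \<open>One chart of G serves all forms at once, so relations between several forms at a point
  carry over to the quotient.\<close>

lemma coset_chart_pointE:
  assumes "(V, \<psi>) \<in> coset_atlas G \<Gamma> A" "x \<in> \<psi> ` V"
  obtains U \<phi> where "(U, \<phi>) \<in> A" "x \<in> \<phi> ` U" "\<And>\<alpha>. descend G \<Gamma> A \<alpha> (V, \<psi>) = \<alpha> (U, \<phi>)"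
proof -
  obtain W U \<phi> where W: "V = coset_proj G \<Gamma> ` W" "\<psi> = \<phi> \<circ> inv_into W (coset_proj G \<Gamma>)"
    "(U, \<phi>) \<in> A" "W \<subseteq> U" "inj_on (coset_proj G \<Gamma>) W" "\<And>\<alpha>. descend G \<Gamma> A \<alpha> (V, \<psi>) = \<alpha> (U, \<phi>)"
    using coset_chartE[OF assms(1)] by metis
  have "x \<in> \<phi> ` W" using assms(2) unfolding W(1,2) coset_chart_image[OF W(5)] .
  then show thesis using that W by blast
qed

lemma descend_form_eq:
  assumes "form_eq A k \<alpha> \<beta>"
  shows "form_eq (coset_atlas G \<Gamma> A) k (descend G \<Gamma> A \<alpha>) (descend G \<Gamma> A \<beta>)"
  unfolding form_eq_def
proof (clarify)
  fix V \<psi> y and vs :: "'b list"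
  assume V: "(V, \<psi>) \<in> coset_atlas G \<Gamma> A" "y \<in> V" "k = length vs"
  then obtain U \<phi> where "(U, \<phi>) \<in> A" "\<psi> y \<in> \<phi> ` U" "\<And>\<alpha>. descend G \<Gamma> A \<alpha> (V, \<psi>) = \<alpha> (U, \<phi>)"
    using coset_chart_pointE[of V \<psi> G \<Gamma> A "\<psi> y"] by blast
  then show "descend G \<Gamma> A \<alpha> (V, \<psi>) (\<psi> y) vs = descend G \<Gamma> A \<beta> (V, \<psi>) (\<psi> y) vs"
    using assms V(3) unfolding form_eq_def by fastforce
qed

lemma descend_nowhere_zero:
  assumes "nowhere_zero A k \<alpha>"
  shows "nowhere_zero (coset_atlas G \<Gamma> A) k (descend G \<Gamma> A \<alpha>)"
  unfolding nowhere_zero_def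
proof (clarify)
  fix V \<psi> y
  assume V: "(V, \<psi>) \<in> coset_atlas G \<Gamma> A" "y \<in> V"
  then obtain U \<phi> where "(U, \<phi>) \<in> A" "\<psi> y \<in> \<phi> ` U" "\<And>\<alpha>. descend G \<Gamma> A \<alpha> (V, \<psi>) = \<alpha> (U, \<phi>)"
    using coset_chart_pointE[of V \<psi> G \<Gamma> A "\<psi> y"] by blast
  then show "\<exists>vs. length vs = k \<and> descend G \<Gamma> A \<alpha> (V, \<psi>) (\<psi> y) vs \<noteq> 0"
    using assms unfolding nowhere_zero_def by fastforce
qed

lemma descend_SU2_structure:
  fixes A :: "('g::topological_space, real^5) atlas"
  assumes G: "lie_group G A" "subgroup \<Gamma> G"
    and SU2: "diff_form A 1 \<eta>" "\<And>i. i \<in> {1, 2, 3} \<Longrightarrow> diff_form A 2 (\<omega> i)" "diff_form A 4 v"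
      "\<And>i j. i \<in> {1, 2, 3} \<Longrightarrow> j \<in> {1, 2, 3} \<Longrightarrow>
         form_eq A 4 (form_wedge 2 2 (\<omega> i) (\<omega> j)) (if i = j then v else zero_form)"
      "nowhere_zero A 5 (form_wedge 4 1 v \<eta>)"
      "\<And>U \<phi> x X Y. (U, \<phi>) \<in> A \<Longrightarrow> x \<in> \<phi> ` U \<Longrightarrow>
         (\<And>Z. contract X (\<omega> 3 (U, \<phi>) x) [Z] = contract Y (\<omega> 1 (U, \<phi>) x) [Z]) \<Longrightarrow> \<omega> 2 (U, \<phi>) x [X, Y] \<ge> 0"
    and inv: "left_invariant G A 1 \<eta>" "\<And>i. i \<in> {1, 2, 3} \<Longrightarrow> left_invariant G A 2 (\<omega> i)"
      "left_invariant G A 4 v"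
  shows "SU2_structure (coset_atlas G \<Gamma> A) (descend G \<Gamma> A \<eta>) (\<lambda>i. descend G \<Gamma> A (\<omega> i))"
  unfolding SU2_structure_def
proof (intro conjI ballI exI[of _ "descend G \<Gamma> A v"])
  show "diff_form (coset_atlas G \<Gamma> A) 1 (descend G \<Gamma> A \<eta>)"
    by (intro descend_diff_form assms)
  show "diff_form (coset_atlas G \<Gamma> A) 4 (descend G \<Gamma> A v)"
    by (intro descend_diff_form assms)
  fix i :: nat assume i: "i \<in> {1, 2, 3}"
  show "diff_form (coset_atlas G \<Gamma> A) 2 (descend G \<Gamma> A (\<omega> i))"
    by (intro descend_diff_form assms i)
  fix j :: nat assume j: "j \<in> {1, 2, 3}"
  show "form_eq (coset_atlas G \<Gamma> A) 4 (form_wedge 2 2 (descend G \<Gamma> A (\<omega> i)) (descend G \<Gamma> A (\<omega> j)))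
          (if i = j then descend G \<Gamma> A v else zero_form)"
    using descend_form_eq[OF SU2(4)[OF i j], where G = G and \<Gamma> = \<Gamma>]
    by (auto simp: descend_form_wedge descend_zero_form)
next
  show "nowhere_zero (coset_atlas G \<Gamma> A) 5 (form_wedge 4 1 (descend G \<Gamma> A v) (descend G \<Gamma> A \<eta>))"
    using descend_nowhere_zero[OF SU2(5)] by (simp add: descend_form_wedge)
next
  fix c assume c: "c \<in> coset_atlas G \<Gamma> A"
  show "case c of (V, \<psi>) \<Rightarrow> \<forall>x\<in>\<psi> ` V. \<forall>X Y.
      (\<forall>Z. contract X (descend G \<Gamma> A (\<omega> 3) (V, \<psi>) x) [Z] = contract Y (descend G \<Gamma> A (\<omega> 1) (V, \<psi>) x) [Z]) \<longrightarrow>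
      0 \<le> descend G \<Gamma> A (\<omega> 2) (V, \<psi>) x [X, Y]"
  proof (cases c, simp only: prod.case, intro ballI allI impI)
    fix V \<psi> x X Y
    assume V: "c = (V, \<psi>)" and x: "x \<in> \<psi> ` V"
      and Z: "\<forall>Z. contract X (descend G \<Gamma> A (\<omega> 3) (V, \<psi>) x) [Z] = contract Y (descend G \<Gamma> A (\<omega> 1) (V, \<psi>) x) [Z]"
    obtain U \<phi> where U: "(U, \<phi>) \<in> A" "x \<in> \<phi> ` U" "\<And>\<alpha>. descend G \<Gamma> A \<alpha> (V, \<psi>) = \<alpha> (U, \<phi>)"
      using coset_chart_pointE[OF c[unfolded V] x] by blast
    show "0 \<le> descend G \<Gamma> A (\<omega> 2) (V, \<psi>) x [X, Y]"
      using SU2(6)[OF U(1,2)] Z by (simp add: U(3))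
  qed
qed

lemma descend_balanced:
  assumes "balanced A \<eta> \<omega>"
  shows "balanced (coset_atlas G \<Gamma> A) (descend G \<Gamma> A \<eta>) (\<lambda>i. descend G \<Gamma> A (\<omega> i))"
  using assms descend_form_eq[where A = A and \<beta> = zero_form and G = G and \<Gamma> = \<Gamma>]
  unfolding balanced_def descend_form_wedge[symmetric] descend_ext_deriv[symmetric]
  by (metis descend_zero_form)

section \<open>Partial derivatives and smooth families of linear maps\<close>

lemma frechet_derivative_chain:
  assumes "smooth_at p g" "smooth_at (g p) f"
  shows "frechet_derivative (\<lambda>x. f (g x)) (at p) v = frechet_derivative f (at (g p)) (frechet_derivative g (at p) v)"
  using frechet_derivativeI[OF has_derivative_compose[OF smooth_at_has_derivative[OF assms(1)] smooth_at_has_derivative[OF assms(2)]]]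
  by (rule fun_cong)

lemma smooth_at_partial2:
  fixes f :: "'a::euclidean_space \<times> 'b::euclidean_space \<Rightarrow> 'c::real_normed_vector"
  assumes "smooth_at (x, y) f"
  shows "smooth_at y (\<lambda>y. f (x, y))"
    and "frechet_derivative (\<lambda>y. f (x, y)) (at y) v = frechet_derivative f (at (x, y)) (0, v)"
proof -
  have s: "smooth_at y (\<lambda>y. (x, y))" by (intro smooth_at_Pair smooth_at_const smooth_at_ident)
  show "smooth_at y (\<lambda>y. f (x, y))" by (rule smooth_at_compose[OF assms s])
  have "frechet_derivative (\<lambda>y. (x, y)) (at y) v = (0, v)"
    by (rule fun_cong[OF frechet_derivativeI]) (auto intro!: derivative_eq_intros)
  then show "frechet_derivative (\<lambda>y. f (x, y)) (at y) v = frechet_derivative f (at (x, y)) (0, v)"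
    using frechet_derivative_chain[OF s assms] by simp
qed

lemma smooth_at_partial1:
  fixes f :: "'a::euclidean_space \<times> 'b::euclidean_space \<Rightarrow> 'c::real_normed_vector"
  assumes "smooth_at (x, y) f"
  shows "smooth_at x (\<lambda>x. f (x, y))"
    and "frechet_derivative (\<lambda>x. f (x, y)) (at x) v = frechet_derivative f (at (x, y)) (v, 0)"
proof -
  have s: "smooth_at x (\<lambda>x. (x, y))" by (intro smooth_at_Pair smooth_at_const smooth_at_ident)
  show "smooth_at x (\<lambda>x. f (x, y))" by (rule smooth_at_compose[OF assms s])
  have "frechet_derivative (\<lambda>x. (x, y)) (at x) v = (v, 0)"
    by (rule fun_cong[OF frechet_derivativeI]) (auto intro!: derivative_eq_intros)
  then show "frechet_derivative (\<lambda>x. f (x, y)) (at x) v = frechet_derivative f (at (x, y)) (v, 0)"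
    using frechet_derivative_chain[OF s assms] by simp
qed

lemma eventually_nhds_isCont:
  fixes f :: "'a::t2_space \<Rightarrow> 'b::topological_space"
  assumes "isCont f p" "\<forall>\<^sub>F y in nhds (f p). P y"
  shows "\<forall>\<^sub>F x in nhds p. P (f x)"
proof -
  obtain T where T: "open T" "f p \<in> T" "\<And>y. y \<in> T \<Longrightarrow> P y" using assms(2) by (auto simp: eventually_nhds)
  then obtain S where "open S" "p \<in> S" "\<forall>x\<in>S. f x \<in> T"
    using assms(1)[unfolded continuous_at_open, rule_format, of T] by auto
  then show ?thesis using T(3) unfolding eventually_nhds by blast
qed

lemma eventually_nhds_smooth_at:
  "smooth_at p f \<Longrightarrow> \<forall>\<^sub>F y in nhds (f p). P y \<Longrightarrow> \<forall>\<^sub>F x in nhds p. P (f x)"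
  using eventually_nhds_isCont smooth_at_isCont by blast

lemma eventually_nhds_pair1:
  fixes x :: "'a::t2_space" and y :: "'b::t2_space"
  shows "\<forall>\<^sub>F z in nhds (x, y). P z \<Longrightarrow> \<forall>\<^sub>F x in nhds x. P (x, y)"
  using eventually_nhds_isCont[of x "\<lambda>x. (x, y)" P] by simp

lemma eventually_nhds_pair2:
  fixes x :: "'a::t2_space" and y :: "'b::t2_space"
  shows "\<forall>\<^sub>F z in nhds (x, y). P z \<Longrightarrow> \<forall>\<^sub>F y in nhds y. P (x, y)"
  using eventually_nhds_isCont[of y "\<lambda>y. (x, y)" P] by simp

text \<open>This product rule carries the later computations with the Maurer-Cartan form, the
  commutator and invariant forms. As \<open>T\<close> is known only through its values, the proof
  sums over \<open>Basis\<close>.\<close>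

lemma frechet_derivative_linear_apply:
  fixes w :: "'a::real_normed_vector \<Rightarrow> 'b::euclidean_space" and T :: "'a \<Rightarrow> 'b \<Rightarrow> 'c::real_normed_vector"
  assumes T: "\<forall>\<^sub>F x in nhds p. linear (T x)" "\<And>b. smooth_at p (\<lambda>x. T x b)" and w: "smooth_at p w"
  shows "frechet_derivative (\<lambda>x. T x (w x)) (at p) u =
    frechet_derivative (\<lambda>x. T x (w p)) (at p) u + T p (frechet_derivative w (at p) u)"
proof -
  let ?w = "\<lambda>u. frechet_derivative w (at p) u" and ?T = "\<lambda>b u. frechet_derivative (\<lambda>x. T x b) (at p) u"
  have linT: "linear (T p)" using T(1) by (rule eventually_nhds_x_imp_x)
  have dT: "((\<lambda>x. T x b) has_derivative ?T b) (at p)" for b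
    using smooth_at_has_derivative[OF T(2)] .
  have dw: "(w has_derivative ?w) (at p)" using smooth_at_has_derivative[OF w] .
  have dwb: "((\<lambda>x. w x \<bullet> b) has_derivative (\<lambda>u. ?w u \<bullet> b)) (at p)" for b
    by (rule bounded_linear.has_derivative[OF bounded_linear_inner_left dw])
  have "((\<lambda>x. \<Sum>b\<in>Basis. (w x \<bullet> b) *\<^sub>R T x b) has_derivative
      (\<lambda>u. \<Sum>b\<in>Basis. (w p \<bullet> b) *\<^sub>R ?T b u + (?w u \<bullet> b) *\<^sub>R T p b)) (at p)"
    by (intro has_derivative_sum has_derivative_scaleR dwb dT)
  then have "frechet_derivative (\<lambda>x. \<Sum>b\<in>Basis. (w x \<bullet> b) *\<^sub>R T x b) (at p) u =
      (\<Sum>b\<in>Basis. (w p \<bullet> b) *\<^sub>R ?T b u + (?w u \<bullet> b) *\<^sub>R T p b)"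
    by (simp add: frechet_derivativeI)
  moreover have "frechet_derivative (\<lambda>x. T x (w x)) (at p) =
      frechet_derivative (\<lambda>x. \<Sum>b\<in>Basis. (w x \<bullet> b) *\<^sub>R T x b) (at p)"
    by (rule frechet_derivative_eventually_cong) (use T(1) in eventually_elim, metis linear_euclidean_expansion)
  moreover have "((\<lambda>x. \<Sum>b\<in>Basis. (w p \<bullet> b) *\<^sub>R T x b) has_derivative
      (\<lambda>u. \<Sum>b\<in>Basis. (w p \<bullet> b) *\<^sub>R ?T b u)) (at p)"
    by (intro has_derivative_sum has_derivative_scaleR_right dT)
  then have "frechet_derivative (\<lambda>x. \<Sum>b\<in>Basis. (w p \<bullet> b) *\<^sub>R T x b) (at p) u =
      (\<Sum>b\<in>Basis. (w p \<bullet> b) *\<^sub>R ?T b u)"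
    by (simp add: frechet_derivativeI)
  moreover have "frechet_derivative (\<lambda>x. T x (w p)) (at p) =
      frechet_derivative (\<lambda>x. \<Sum>b\<in>Basis. (w p \<bullet> b) *\<^sub>R T x b) (at p)"
    by (rule frechet_derivative_eventually_cong) (use T(1) in eventually_elim, metis linear_euclidean_expansion)
  ultimately show ?thesis
    using linear_euclidean_expansion[OF linT, of "?w u"] by (simp add: sum.distrib)
qed

lemma linear_frechet_derivative_parameter:
  assumes T: "\<forall>\<^sub>F x in nhds p. linear (T x)" "\<And>b. smooth_at p (\<lambda>x. T x b)"
  shows "linear (\<lambda>b. frechet_derivative (\<lambda>x. T x b) (at p) u)"
proof (rule linearI)
  have d: "((\<lambda>x. T x b) has_derivative (\<lambda>u. frechet_derivative (\<lambda>x. T x b) (at p) u)) (at p)" for b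
    using smooth_at_has_derivative[OF T(2)] .
  fix a b and r :: real
  have "frechet_derivative (\<lambda>x. T x (a + b)) (at p) = frechet_derivative (\<lambda>x. T x a + T x b) (at p)"
    by (rule frechet_derivative_eventually_cong) (use T(1) in eventually_elim, simp add: linear_add)
  then show "frechet_derivative (\<lambda>x. T x (a + b)) (at p) u =
      frechet_derivative (\<lambda>x. T x a) (at p) u + frechet_derivative (\<lambda>x. T x b) (at p) u"
    by (simp add: frechet_derivativeI[OF has_derivative_add[OF d d]])
  have "frechet_derivative (\<lambda>x. T x (r *\<^sub>R b)) (at p) = frechet_derivative (\<lambda>x. r *\<^sub>R T x b) (at p)"
    by (rule frechet_derivative_eventually_cong) (use T(1) in eventually_elim, simp add: linear_scale)
  then show "frechet_derivative (\<lambda>x. T x (r *\<^sub>R b)) (at p) u = r *\<^sub>R frechet_derivative (\<lambda>x. T x b) (at p) u"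
    by (simp add: frechet_derivativeI[OF has_derivative_scaleR_right[OF d]])
qed

subsection \<open>The Maurer--Cartan form\<close>

text \<open>The left Maurer-Cartan form g^-1 dg in coordinates, where \<open>\<phi>\<^sub>0\<close>
  is a chart at the identity and identifies the tangent space there with \<open>'e\<close>. The
  point x occurs twice: as the element to be inverted and as the place of differentiation.\<close>

definition maurer_cartan ::
  "('g, 'm) monoid_scheme \<Rightarrow> ('g \<Rightarrow> 'e) \<Rightarrow> ('g, 'e::euclidean_space) chart \<Rightarrow> 'e \<Rightarrow> 'e \<Rightarrow> 'e" where
  "maurer_cartan G \<phi>\<^sub>0 c x v = frechet_derivative
     (\<lambda>y. \<phi>\<^sub>0 (inv\<^bsub>G\<^esub> (inv_into (fst c) (snd c) x) \<otimes>\<^bsub>G\<^esub> inv_into (fst c) (snd c) y)) (at x) v"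

lemma eventually_product_in_chart:
  assumes G: "lie_group G A" and U: "(U, \<phi>) \<in> A" and V: "(V, \<psi>) \<in> A" and W: "(W, \<zeta>) \<in> A"
    and p: "p \<in> U" "q \<in> V" "p \<otimes>\<^bsub>G\<^esub> q \<in> W"
  shows "\<exists>S T. open S \<and> open T \<and> \<phi> p \<in> S \<and> \<psi> q \<in> T \<and>
    (\<forall>x\<in>S. \<forall>y\<in>T. x \<in> \<phi> ` U \<and> y \<in> \<psi> ` V \<and> inv_into U \<phi> x \<otimes>\<^bsub>G\<^esub> inv_into V \<psi> y \<in> W)"
proof -
  let ?X = "top_of_set (carrier G)"
  have m: "continuous_map (prod_topology ?X ?X) ?X (\<lambda>(x, y). x \<otimes>\<^bsub>G\<^esub> y)"
    using G by (simp add: lie_group_def smooth_map_def Let_def)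
  let ?P = "{z \<in> topspace (prod_topology ?X ?X). (\<lambda>(x, y). x \<otimes>\<^bsub>G\<^esub> y) z \<in> W}"
  have "openin (prod_topology ?X ?X) ?P"
    by (rule openin_continuous_map_preimage[OF m chart_openin[OF G W]])
  moreover have "(p, q) \<in> ?P" using p chart_subset[OF G U] chart_subset[OF G V] by simp
  ultimately have "\<exists>W1 W2. openin ?X W1 \<and> openin ?X W2 \<and> p \<in> W1 \<and> q \<in> W2 \<and> W1 \<times> W2 \<subseteq> ?P"
    unfolding openin_prod_topology_alt by (elim allE impE)
  then obtain W1 W2 where W12: "openin ?X W1" "openin ?X W2" "p \<in> W1" "q \<in> W2" "W1 \<times> W2 \<subseteq> ?P"
    by (elim exE conjE)
  have "open (\<phi> ` (U \<inter> W1))" "open (\<psi> ` (V \<inter> W2))"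
    using chart_open_image[OF G U W12(1)] chart_open_image[OF G V W12(2)] .
  moreover have "x \<in> \<phi> ` U \<and> y \<in> \<psi> ` V \<and> inv_into U \<phi> x \<otimes>\<^bsub>G\<^esub> inv_into V \<psi> y \<in> W"
    if "x \<in> \<phi> ` (U \<inter> W1)" "y \<in> \<psi> ` (V \<inter> W2)" for x y
  proof -
    obtain a b where "x = \<phi> a" "a \<in> U" "a \<in> W1" "y = \<psi> b" "b \<in> V" "b \<in> W2" using \<open>x \<in> _\<close> \<open>y \<in> _\<close> by blast
    moreover then have "(a, b) \<in> ?P" using W12(5) by blast
    ultimately show ?thesis by (simp add: chart_inv[OF G U] chart_inv[OF G V])
  qed
  ultimately show ?thesis using W12 p by (intro exI[of _ "\<phi> ` (U \<inter> W1)"] exI[of _ "\<psi> ` (V \<inter> W2)"]) auto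
qed

text \<open>On a product neighbourhood the inverse of the product chart is the pair of the two
  inverses. This turns smoothness with respect to \<open>prod_atlas\<close> into a formula with
  separate coordinates.\<close>

lemma smooth_at_mult:
  assumes G: "lie_group G A" and U: "(U, \<phi>) \<in> A" and V: "(V, \<psi>) \<in> A" and W: "(W, \<zeta>) \<in> A"
    and p: "p \<in> U" "q \<in> V" "p \<otimes>\<^bsub>G\<^esub> q \<in> W"
  shows "smooth_at (\<phi> p, \<psi> q) (\<lambda>z. \<zeta> (inv_into U \<phi> (fst z) \<otimes>\<^bsub>G\<^esub> inv_into V \<psi> (snd z)))"
proof -
  obtain S T where ST: "open S" "open T" "\<phi> p \<in> S" "\<psi> q \<in> T"
    "\<And>x y. x \<in> S \<Longrightarrow> y \<in> T \<Longrightarrow> x \<in> \<phi> ` U \<and> y \<in> \<psi> ` V \<and> inv_into U \<phi> x \<otimes>\<^bsub>G\<^esub> inv_into V \<psi> y \<in> W"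
    using eventually_product_in_chart[OF assms] by blast
  let ?m = "\<lambda>(x, y). x \<otimes>\<^bsub>G\<^esub> y"
  have "(U \<times> V, map_prod \<phi> \<psi>) \<in> prod_atlas A A" using U V by (auto simp: prod_atlas_def)
  moreover have "smooth_map (prod_topology (top_of_set (carrier G)) (top_of_set (carrier G))) (prod_atlas A A)
      (top_of_set (carrier G)) A ?m"
    using G by (simp add: lie_group_def Let_def)
  ultimately have s: "smooth_on (map_prod \<phi> \<psi> ` {r \<in> U \<times> V. ?m r \<in> W}) (\<zeta> \<circ> ?m \<circ> inv_into (U \<times> V) (map_prod \<phi> \<psi>))"
    using W unfolding smooth_map_def by blast
  have inj: "inj_on (map_prod \<phi> \<psi>) (U \<times> V)"
    using chart_inj[OF G U] chart_inj[OF G V] by (rule map_prod_inj_on)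
  have e: "z \<in> map_prod \<phi> \<psi> ` {r \<in> U \<times> V. ?m r \<in> W} \<and>
     (\<zeta> \<circ> ?m \<circ> inv_into (U \<times> V) (map_prod \<phi> \<psi>)) z = \<zeta> (inv_into U \<phi> (fst z) \<otimes>\<^bsub>G\<^esub> inv_into V \<psi> (snd z))"
    if z: "z \<in> S \<times> T" for z
  proof -
    obtain a b where ab: "fst z = \<phi> a" "a \<in> U" "snd z = \<psi> b" "b \<in> V" "a \<otimes>\<^bsub>G\<^esub> b \<in> W"
      using ST(5)[of "fst z" "snd z"] z chart_inv[OF G U] chart_inv[OF G V] by fastforce
    then have "z = map_prod \<phi> \<psi> (a, b)" by (metis map_prod_simp prod.collapse)
    moreover then have "inv_into (U \<times> V) (map_prod \<phi> \<psi>) z = (a, b)"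
      using inv_into_f_f[OF inj, of "(a, b)"] ab by simp
    ultimately show ?thesis using ab by (auto simp: chart_inv[OF G U] chart_inv[OF G V])
  qed
  have "smooth_at (\<phi> p, \<psi> q) (\<zeta> \<circ> ?m \<circ> inv_into (U \<times> V) (map_prod \<phi> \<psi>))"
    by (rule smooth_on_imp_smooth_at[of "S \<times> T"], rule smooth_on_subset[OF s])
      (use e ST in \<open>auto intro: open_Times\<close>)
  then show ?thesis
  proof (rule smooth_at_cong)
    have "\<forall>\<^sub>F z in nhds (\<phi> p, \<psi> q). z \<in> S \<times> T"
      using ST by (intro eventually_nhds_in_open open_Times) auto
    then show "\<forall>\<^sub>F z in nhds (\<phi> p, \<psi> q). (\<zeta> \<circ> ?m \<circ> inv_into (U \<times> V) (map_prod \<phi> \<psi>)) z =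
       \<zeta> (inv_into U \<phi> (fst z) \<otimes>\<^bsub>G\<^esub> inv_into V \<psi> (snd z))"
      by eventually_elim (use e in blast)
  qed
qed

lemma continuous_map_inverse:
  "lie_group G A \<Longrightarrow> continuous_map (top_of_set (carrier G)) (top_of_set (carrier G)) (\<lambda>x. inv\<^bsub>G\<^esub> x)"
  by (simp add: lie_group_def smooth_map_def Let_def)

lemma smooth_at_inverse:
  assumes G: "lie_group G A" and U: "(U, \<phi>) \<in> A" and V: "(V, \<psi>) \<in> A" and p: "p \<in> U" "inv\<^bsub>G\<^esub> p \<in> V"
  shows "smooth_at (\<phi> p) (\<lambda>x. \<psi> (inv\<^bsub>G\<^esub> (inv_into U \<phi> x)))"
proof -
  let ?X = "top_of_set (carrier G)"
  have "smooth_map ?X A ?X A (\<lambda>x. inv\<^bsub>G\<^esub> x)"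
    using G by (simp add: lie_group_def Let_def)
  then have s: "smooth_on (\<phi> ` {p \<in> U. inv\<^bsub>G\<^esub> p \<in> V}) (\<psi> \<circ> (\<lambda>x. inv\<^bsub>G\<^esub> x) \<circ> inv_into U \<phi>)"
    using U V unfolding smooth_map_def by blast
  have "openin ?X {x \<in> carrier G. inv\<^bsub>G\<^esub> x \<in> V}"
    using openin_continuous_map_preimage[OF continuous_map_inverse[OF G] chart_openin[OF G V]] by simp
  from chart_open_image[OF G U this] have "open (\<phi> ` (U \<inter> {x \<in> carrier G. inv\<^bsub>G\<^esub> x \<in> V}))" .
  moreover have "U \<inter> {x \<in> carrier G. inv\<^bsub>G\<^esub> x \<in> V} = {p \<in> U. inv\<^bsub>G\<^esub> p \<in> V}"
    using chart_subset[OF G U] by blast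
  ultimately have "smooth_at (\<phi> p) (\<psi> \<circ> (\<lambda>x. inv\<^bsub>G\<^esub> x) \<circ> inv_into U \<phi>)"
    using s p by (intro smooth_on_imp_smooth_at) auto
  then show ?thesis by (simp add: comp_def)
qed

lemma smooth_at_translation:
  assumes G: "lie_group G A" and U: "(U, \<phi>) \<in> A" and V: "(V, \<psi>) \<in> A"
    and h: "h \<in> carrier G" and p: "p \<in> U" "h \<otimes>\<^bsub>G\<^esub> p \<in> V"
  shows "smooth_at (\<phi> p) (\<lambda>x. \<psi> (h \<otimes>\<^bsub>G\<^esub> inv_into U \<phi> x))"
proof -
  obtain W \<zeta> where W: "(W, \<zeta>) \<in> A" "h \<in> W" using lie_group_chart_exists[OF G h] .
  show ?thesis
    using smooth_at_partial2(1)[OF smooth_at_mult[OF G W(1) U V W(2) p]]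
    by (simp add: chart_inv[OF G W])
qed

text \<open>Inversion and multiplication are composed through an auxiliary chart
  \<open>(W, \<zeta>)\<close> around the inverse of p, which need not lie in U or V.\<close>

lemma smooth_at_left_difference:
  fixes A :: "('g::topological_space, 'e::euclidean_space) atlas"
  assumes G: "lie_group G A" and U: "(U, \<phi>) \<in> A" and V: "(V, \<psi>) \<in> A"
    and p: "p \<in> U" "q \<in> U" "inv\<^bsub>G\<^esub> p \<otimes>\<^bsub>G\<^esub> q \<in> V"
  shows "smooth_at (\<phi> p, \<phi> q) (\<lambda>z. \<psi> (inv\<^bsub>G\<^esub> (inv_into U \<phi> (fst z)) \<otimes>\<^bsub>G\<^esub> inv_into U \<phi> (snd z)))"
proof -
  interpret group G using lie_group_group[OF G] .
  have pc: "p \<in> carrier G" using chart_subset[OF G U p(1)] .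
  obtain W \<zeta> where W: "(W, \<zeta>) \<in> A" "inv\<^bsub>G\<^esub> p \<in> W" using lie_group_chart_exists[OF G inv_closed[OF pc]] .
  let ?i = "\<lambda>x. \<zeta> (inv\<^bsub>G\<^esub> (inv_into U \<phi> x))"
  let ?m = "\<lambda>z. \<psi> (inv_into W \<zeta> (fst z) \<otimes>\<^bsub>G\<^esub> inv_into U \<phi> (snd z))"
  have fs: "smooth_at z fst" "smooth_at z snd" for z :: "'e \<times> 'e"
    by (auto intro: smooth_at_bounded_linear_self bounded_linear_fst bounded_linear_snd)
  have i: "smooth_at (\<phi> p) ?i" by (rule smooth_at_inverse[OF G U W(1) p(1) W(2)])
  have "smooth_at (\<phi> p, \<phi> q) (\<lambda>z. ?i (fst z))"
    by (rule smooth_at_compose[of fst]) (use i fs in simp_all)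
  then have g: "smooth_at (\<phi> p, \<phi> q) (\<lambda>z. (?i (fst z), snd z))" by (intro smooth_at_Pair fs)
  have "smooth_at (\<phi> p, \<phi> q) (\<lambda>z. ?m (?i (fst z), snd z))"
    by (rule smooth_at_compose[OF _ g])
      (use smooth_at_mult[OF G W(1) U V W(2) p(2,3)] in \<open>simp add: chart_inv[OF G U p(1)]\<close>)
  then show ?thesis
  proof (rule smooth_at_cong)
    have "\<forall>\<^sub>F x in nhds (\<phi> p). inv_into U \<phi> x \<in> U \<and> inv\<^bsub>G\<^esub> (inv_into U \<phi> x) \<in> W \<and> \<phi> (inv_into U \<phi> x) = x"
      by (rule chart_eventually[OF G U continuous_map_inverse[OF G] chart_openin[OF G W(1)] p(1) W(2)])
    then have "\<forall>\<^sub>F z in nhds (\<phi> p, \<phi> q). inv\<^bsub>G\<^esub> (inv_into U \<phi> (fst z)) \<in> W"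
      by (intro eventually_nhds_smooth_at[OF fs(1)[of "(\<phi> p, \<phi> q)"], of "\<lambda>x. inv\<^bsub>G\<^esub> (inv_into U \<phi> x) \<in> W"])
        (simp, elim eventually_mono conjE)
    then show "\<forall>\<^sub>F z in nhds (\<phi> p, \<phi> q). ?m (?i (fst z), snd z) =
        \<psi> (inv\<^bsub>G\<^esub> (inv_into U \<phi> (fst z)) \<otimes>\<^bsub>G\<^esub> inv_into U \<phi> (snd z))"
      by eventually_elim (simp add: chart_inv[OF G W(1)])
  qed
qed

locale lie_group_chart =
  fixes G :: "('g::topological_space, 'm) monoid_scheme" (structure)
    and A :: "('g, 'e::euclidean_space) atlas" and U\<^sub>0 \<phi>\<^sub>0
  assumes G: "lie_group G A" and U0: "(U\<^sub>0, \<phi>\<^sub>0) \<in> A" "\<one> \<in> U\<^sub>0"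
begin

sublocale group G using lie_group_group[OF G] .

abbreviation "\<Theta> \<equiv> maurer_cartan G \<phi>\<^sub>0"

text \<open>The identity (h p)^-1 (h y) = p^-1 y makes the functions differentiated on both sides
  agree after the translation; the rest is the chain rule.\<close>

lemma mc_invariant:
  assumes U: "(U, \<phi>) \<in> A" and V: "(V, \<psi>) \<in> A" and h: "h \<in> carrier G" and p: "p \<in> U" "h \<otimes> p \<in> V"
  shows "\<Theta> (U, \<phi>) (\<phi> p) v =
    \<Theta> (V, \<psi>) (\<psi> (h \<otimes> p)) (frechet_derivative (\<lambda>x. \<psi> (h \<otimes> inv_into U \<phi> x)) (at (\<phi> p)) v)"
proof -
  let ?T = "\<lambda>x. \<psi> (h \<otimes> inv_into U \<phi> x)" and ?H = "\<lambda>z. \<phi>\<^sub>0 (inv (h \<otimes> p) \<otimes> inv_into V \<psi> z)"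
  have pc: "p \<in> carrier G" using chart_subset[OF G U p(1)] .
  have T: "smooth_at (\<phi> p) ?T" by (rule smooth_at_translation[OF G U V h p])
  have Tp: "?T (\<phi> p) = \<psi> (h \<otimes> p)" by (simp add: chart_inv[OF G U p(1)])
  have H: "smooth_at (?T (\<phi> p)) ?H"
    unfolding Tp by (rule smooth_at_translation[OF G V U0(1) _ p(2)]) (use pc h U0(2) in simp_all)
  have "\<forall>\<^sub>F y in nhds (\<phi> p). inv_into U \<phi> y \<in> U \<and> h \<otimes> inv_into U \<phi> y \<in> V \<and> \<phi> (inv_into U \<phi> y) = y"
    by (rule chart_eventually[OF G U continuous_map_translation[OF G h] chart_openin[OF G V] p])
  then have "\<forall>\<^sub>F y in nhds (\<phi> p). \<phi>\<^sub>0 (inv p \<otimes> inv_into U \<phi> y) = ?H (?T y)"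
  proof eventually_elim
    case (elim y)
    then have yc: "inv_into U \<phi> y \<in> carrier G" using chart_subset[OF G U] by blast
    have "inv (h \<otimes> p) \<otimes> (h \<otimes> inv_into U \<phi> y) = inv p \<otimes> (inv h \<otimes> (h \<otimes> inv_into U \<phi> y))"
      using h pc yc by (simp add: inv_mult_group m_assoc)
    also have "inv h \<otimes> (h \<otimes> inv_into U \<phi> y) = inv_into U \<phi> y"
      using h yc by (simp add: m_assoc[symmetric])
    finally show ?case using elim by (simp add: chart_inv[OF G V])
  qed
  then have "\<Theta> (U, \<phi>) (\<phi> p) v = frechet_derivative (\<lambda>y. ?H (?T y)) (at (\<phi> p)) v"
    by (simp add: maurer_cartan_def chart_inv[OF G U p(1)] frechet_derivative_eventually_cong)
  also have "\<dots> = frechet_derivative ?H (at (\<psi> (h \<otimes> p))) (frechet_derivative ?T (at (\<phi> p)) v)"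
    using frechet_derivative_chain[OF T H] by (simp add: Tp)
  finally show ?thesis by (simp add: maurer_cartan_def chart_inv[OF G V p(2)])
qed

lemma eventually_chart0: "\<forall>\<^sub>F y in nhds (\<phi>\<^sub>0 \<one>). inv_into U\<^sub>0 \<phi>\<^sub>0 y \<in> U\<^sub>0 \<and> \<phi>\<^sub>0 (inv_into U\<^sub>0 \<phi>\<^sub>0 y) = y"
  using chart_eventually_in[OF G U0(1) chart_openin[OF G U0(1)] U0(2) U0(2)] by eventually_elim blast

lemma inv_chart0_one: "inv_into U\<^sub>0 \<phi>\<^sub>0 (\<phi>\<^sub>0 \<one>) = \<one>"
  by (rule chart_inv[OF G U0])

lemma chart0_carrier: "p \<in> U\<^sub>0 \<Longrightarrow> p \<in> carrier G"
  by (rule chart_subset[OF G U0(1)])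

lemma mc_one: "\<Theta> (U\<^sub>0, \<phi>\<^sub>0) (\<phi>\<^sub>0 \<one>) v = v"
proof -
  have "\<forall>\<^sub>F y in nhds (\<phi>\<^sub>0 \<one>). \<phi>\<^sub>0 (inv \<one> \<otimes> inv_into U\<^sub>0 \<phi>\<^sub>0 y) = y"
    using eventually_chart0 by eventually_elim (simp add: chart0_carrier)
  then show ?thesis
    by (simp add: maurer_cartan_def inv_chart0_one frechet_derivative_eventually_cong)
qed

text \<open>The two occurrences of the base point are decoupled: \<Theta> is a partial derivative,
  on the diagonal, of one smooth function of two variables. Smoothness in the base point follows
  from this form.\<close>

lemma mc_eq_partial:
  assumes U: "(U, \<phi>) \<in> A" and x: "x \<in> \<phi> ` U"
  shows "smooth_at (x, x) (\<lambda>z. \<phi>\<^sub>0 (inv (inv_into U \<phi> (fst z)) \<otimes> inv_into U \<phi> (snd z)))"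
    and "\<Theta> (U, \<phi>) x v =
      frechet_derivative (\<lambda>z. \<phi>\<^sub>0 (inv (inv_into U \<phi> (fst z)) \<otimes> inv_into U \<phi> (snd z))) (at (x, x)) (0, v)"
proof -
  obtain p where p: "x = \<phi> p" "p \<in> U" using x by blast
  show s: "smooth_at (x, x) (\<lambda>z. \<phi>\<^sub>0 (inv (inv_into U \<phi> (fst z)) \<otimes> inv_into U \<phi> (snd z)))"
    unfolding p(1)
    by (rule smooth_at_left_difference[OF G U U0(1) p(2,2)]) (use U0(2) chart_subset[OF G U p(2)] in simp)
  show "\<Theta> (U, \<phi>) x v =
      frechet_derivative (\<lambda>z. \<phi>\<^sub>0 (inv (inv_into U \<phi> (fst z)) \<otimes> inv_into U \<phi> (snd z))) (at (x, x)) (0, v)"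
    using smooth_at_partial2(2)[OF s] by (simp add: maurer_cartan_def)
qed

lemma mc_smooth:
  assumes U: "(U, \<phi>) \<in> A" and x: "x \<in> \<phi> ` U"
  shows "smooth_at x (\<lambda>x. \<Theta> (U, \<phi>) x v)"
proof -
  let ?f = "\<lambda>z. \<phi>\<^sub>0 (inv (inv_into U \<phi> (fst z)) \<otimes> inv_into U \<phi> (snd z))"
  have "smooth_at x (\<lambda>x. frechet_derivative ?f (at (x, x)) (0, v))"
    by (rule smooth_at_compose[where f = "\<lambda>z. frechet_derivative ?f (at z) (0, v)" and g = "\<lambda>x. (x, x)"])
      (intro smooth_at_frechet mc_eq_partial(1)[OF U x] smooth_at_Pair smooth_at_ident)+
  then show ?thesis
  proof (rule smooth_at_cong)
    have "\<forall>\<^sub>F y in nhds x. y \<in> \<phi> ` U"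
      using chart_open_image_self[OF G U] x by (rule eventually_nhds_in_open)
    then show "\<forall>\<^sub>F x in nhds x. frechet_derivative ?f (at (x, x)) (0, v) = \<Theta> (U, \<phi>) x v"
      by eventually_elim (simp add: mc_eq_partial(2)[OF U])
  qed
qed

lemma mc_linear:
  assumes U: "(U, \<phi>) \<in> A" and x: "x \<in> \<phi> ` U"
  shows "linear (\<Theta> (U, \<phi>) x)"
proof -
  have "smooth_at x (\<lambda>y. \<phi>\<^sub>0 (inv (inv_into U \<phi> x) \<otimes> inv_into U \<phi> y))"
    using smooth_at_partial2(1)[OF mc_eq_partial(1)[OF assms]] by simp
  from smooth_at_linear[OF this] show ?thesis by (simp add: maurer_cartan_def[abs_def])
qed

lemma mc_eventually_linear:
  assumes U: "(U, \<phi>) \<in> A" and x: "x \<in> \<phi> ` U"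
  shows "\<forall>\<^sub>F y in nhds x. linear (\<Theta> (U, \<phi>) y)"
  using eventually_nhds_in_open[OF chart_open_image_self[OF G U] x]
  by eventually_elim (rule mc_linear[OF U])

lemma mc_translation:
  assumes U: "(U, \<phi>) \<in> A" and p: "p \<in> U"
  shows "\<Theta> (U, \<phi>) (\<phi> p) v = frechet_derivative (\<lambda>x. \<phi>\<^sub>0 (inv p \<otimes> inv_into U \<phi> x)) (at (\<phi> p)) v"
  by (simp add: maurer_cartan_def chart_inv[OF G U p])

text \<open>At the identity element \<Theta> is the identity map, so by invariance the differential
  of the translation by p is a right inverse of \<Theta> at p.\<close>

lemma mc_surj:
  assumes U: "(U, \<phi>) \<in> A" and x: "x \<in> \<phi> ` U"
  shows "surj (\<Theta> (U, \<phi>) x)"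
proof -
  obtain p where p: "x = \<phi> p" "p \<in> U" using x by blast
  have pc: "p \<in> carrier G" using chart_subset[OF G U p(2)] .
  have "\<Theta> (U, \<phi>) x (frechet_derivative (\<lambda>x. \<phi> (p \<otimes> inv_into U\<^sub>0 \<phi>\<^sub>0 x)) (at (\<phi>\<^sub>0 \<one>)) v) = v" for v
    using mc_invariant[OF U0(1) U pc U0(2), of v] p pc by (simp add: mc_one)
  then show ?thesis by (metis surjI)
qed

end

subsection \<open>The bracket as derivative of the commutator\<close>

lemma has_derivative_eventually_cong:
  assumes "(f has_derivative D) (at p)" "\<forall>\<^sub>F x in nhds p. f x = g x"
  shows "(g has_derivative D) (at p)"
proof -
  obtain T where T: "open T" "p \<in> T" "\<And>x. x \<in> T \<Longrightarrow> f x = g x"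
    using assms(2) by (auto simp: eventually_nhds)
  show ?thesis by (rule has_derivative_transform_open[OF T assms(1)])
qed

lemma smooth_at_fst: "smooth_at z fst"
  by (intro smooth_at_bounded_linear_self bounded_linear_fst)

lemma smooth_at_snd: "smooth_at z snd"
  by (intro smooth_at_bounded_linear_self bounded_linear_snd)

lemma smooth_at_swap:
  fixes z :: "'a::euclidean_space \<times> 'b::euclidean_space"
  shows "smooth_at z (\<lambda>z. (snd z, fst z))"
  by (intro smooth_at_Pair smooth_at_fst smooth_at_snd)

lemma frechet_derivative_Pair:
  assumes "smooth_at p f" "smooth_at p g"
  shows "frechet_derivative (\<lambda>x. (f x, g x)) (at p) v = (frechet_derivative f (at p) v, frechet_derivative g (at p) v)"
  using frechet_derivativeI[OF has_derivative_Pair[OF smooth_at_has_derivative[OF assms(1)] smooth_at_has_derivative[OF assms(2)]]]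
  by (rule fun_cong)

context lie_group_chart
begin

abbreviation "x\<^sub>0 \<equiv> \<phi>\<^sub>0 \<one>"
abbreviation "\<gamma> \<equiv> inv_into U\<^sub>0 \<phi>\<^sub>0"

definition local_mult :: "'e \<times> 'e \<Rightarrow> 'e" where
  "local_mult z = \<phi>\<^sub>0 (\<gamma> (fst z) \<otimes> \<gamma> (snd z))"

definition local_inv :: "'e \<Rightarrow> 'e" where
  "local_inv x = \<phi>\<^sub>0 (inv (\<gamma> x))"

text \<open>The bilinear part B of the multiplication at the identity, m(x_0 + u, x_0 + v) = x_0 + u
  + v + B(u, v) + ... in the chart.\<close>

definition mixed :: "'e \<Rightarrow> 'e \<Rightarrow> 'e" where
  "mixed u v = frechet_derivative (\<lambda>z. frechet_derivative local_mult (at z) (0, v)) (at (x\<^sub>0, x\<^sub>0)) (u, 0)"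

definition commutator :: "'g \<Rightarrow> 'g \<Rightarrow> 'g" where
  "commutator x y = x \<otimes> y \<otimes> inv x \<otimes> inv y"

definition local_commutator :: "'e \<times> 'e \<Rightarrow> 'e" where
  "local_commutator z = \<phi>\<^sub>0 (commutator (\<gamma> (fst z)) (\<gamma> (snd z)))"

text \<open>At y = 1 the map y -> x y x^-1 y^-1 has differential Ad(x) - id. Since x -> Ad(x) has
  differential ad at 1, \<open>bracket\<close> is the Lie bracket with its usual sign.\<close>

definition Ad_minus_id :: "'e \<Rightarrow> 'e \<Rightarrow> 'e" where
  "Ad_minus_id x v = frechet_derivative local_commutator (at (x, x\<^sub>0)) (0, v)"

definition bracket :: "'e \<Rightarrow> 'e \<Rightarrow> 'e" where
  "bracket u v = frechet_derivative (\<lambda>x. Ad_minus_id x v) (at x\<^sub>0) u"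

lemma chart0_left_inverse: "p \<in> U\<^sub>0 \<Longrightarrow> \<gamma> (\<phi>\<^sub>0 p) = p"
  by (rule chart_inv[OF G U0(1)])

lemma local_mult_smooth: "smooth_at (x\<^sub>0, x\<^sub>0) local_mult"
  using smooth_at_mult[OF G U0(1) U0(1) U0(1) U0(2) U0(2)] U0(2) by (simp add: local_mult_def[abs_def])

lemma local_inv_smooth: "smooth_at x\<^sub>0 local_inv"
  using smooth_at_inverse[OF G U0(1) U0(1) U0(2)] U0(2) by (simp add: local_inv_def[abs_def])

lemma eventually_local_mult:
  "\<forall>\<^sub>F z in nhds (x\<^sub>0, x\<^sub>0). \<gamma> (fst z) \<in> U\<^sub>0 \<and> \<gamma> (snd z) \<in> U\<^sub>0 \<and> \<gamma> (fst z) \<otimes> \<gamma> (snd z) \<in> U\<^sub>0"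
proof -
  have "\<one> \<otimes> \<one> \<in> U\<^sub>0" using U0(2) by simp
  then obtain S T where ST: "open S" "open T" "x\<^sub>0 \<in> S" "x\<^sub>0 \<in> T"
    "\<And>x y. x \<in> S \<Longrightarrow> y \<in> T \<Longrightarrow> x \<in> \<phi>\<^sub>0 ` U\<^sub>0 \<and> y \<in> \<phi>\<^sub>0 ` U\<^sub>0 \<and> \<gamma> x \<otimes> \<gamma> y \<in> U\<^sub>0"
    using eventually_product_in_chart[OF G U0(1) U0(1) U0(1) U0(2) U0(2)] by blast
  have "\<forall>\<^sub>F z in nhds (x\<^sub>0, x\<^sub>0). z \<in> S \<times> T"
    using ST by (intro eventually_nhds_in_open open_Times) auto
  then show ?thesis
    by eventually_elim (use ST(5) in \<open>auto simp: inv_into_into\<close>)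
qed

lemma eventually_local_inv: "\<forall>\<^sub>F x in nhds x\<^sub>0. \<gamma> x \<in> U\<^sub>0 \<and> inv (\<gamma> x) \<in> U\<^sub>0"
  using chart_eventually[OF G U0(1) continuous_map_inverse[OF G] chart_openin[OF G U0(1)] U0(2)] U0(2)
  by (auto elim: eventually_mono)

lemma local_mult_units:
  "\<forall>\<^sub>F x in nhds x\<^sub>0. local_mult (x\<^sub>0, x) = x \<and> local_mult (x, x\<^sub>0) = x"
  using eventually_chart0 by eventually_elim (simp add: local_mult_def inv_chart0_one chart0_carrier)

lemma local_mult_one: "local_mult (x\<^sub>0, x\<^sub>0) = x\<^sub>0"
  by (simp add: local_mult_def inv_chart0_one)

lemma local_inv_one: "local_inv x\<^sub>0 = x\<^sub>0"
  by (simp add: local_inv_def inv_chart0_one)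

text \<open>Differentiate \<open>\<Theta>\<^sub>x (\<partial>\<^sub>2m(x, 1) v) = v\<close>, where \<open>m\<close> is the multiplication in the chart.\<close>

lemma mc_derivative_one:
  "frechet_derivative (\<lambda>x. \<Theta> (U\<^sub>0, \<phi>\<^sub>0) x v) (at x\<^sub>0) u = - mixed u v"
proof -
  let ?\<theta> = "\<Theta> (U\<^sub>0, \<phi>\<^sub>0)"
  let ?D = "\<lambda>z. frechet_derivative local_mult (at z) (0, v)"
  let ?w = "\<lambda>x. ?D (x, x\<^sub>0)"
  have x0: "x\<^sub>0 \<in> \<phi>\<^sub>0 ` U\<^sub>0" using U0(2) by blast
  have D: "smooth_at (x\<^sub>0, x\<^sub>0) ?D" by (intro smooth_at_frechet local_mult_smooth)
  have w: "smooth_at x\<^sub>0 ?w" by (rule smooth_at_partial1(1)[OF D])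
  have dw: "frechet_derivative ?w (at x\<^sub>0) u = mixed u v"
    using smooth_at_partial1(2)[OF D] by (simp add: mixed_def)
  have "frechet_derivative (\<lambda>y. local_mult (x\<^sub>0, y)) (at x\<^sub>0) = frechet_derivative (\<lambda>y. y) (at x\<^sub>0)"
    by (rule frechet_derivative_eventually_cong) (use local_mult_units in eventually_elim, simp)
  then have w0: "?w x\<^sub>0 = v"
    using smooth_at_partial2(2)[OF local_mult_smooth, of v] by simp
  have "\<forall>\<^sub>F x in nhds x\<^sub>0. smooth_at (x, x\<^sub>0) local_mult"
    using eventually_nhds_pair1[OF smooth_at_eventually[OF local_mult_smooth]] .
  then have "\<forall>\<^sub>F x in nhds x\<^sub>0. ?\<theta> x (?w x) = v"
    using eventually_chart0
  proof eventually_elim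
    case (elim x)
    have c: "\<gamma> x \<in> carrier G" using elim chart0_carrier by blast
    have "v = ?\<theta> (\<phi>\<^sub>0 (\<gamma> x \<otimes> \<one>)) (frechet_derivative (\<lambda>y. \<phi>\<^sub>0 (\<gamma> x \<otimes> \<gamma> y)) (at x\<^sub>0) v)"
      using mc_invariant[OF U0(1) U0(1) c U0(2), of v] elim c by (simp add: mc_one)
    also have "frechet_derivative (\<lambda>y. \<phi>\<^sub>0 (\<gamma> x \<otimes> \<gamma> y)) (at x\<^sub>0) v = ?w x"
      using smooth_at_partial2(2)[of x x\<^sub>0 local_mult v] elim by (simp add: local_mult_def)
    finally show ?case using c elim by simp
  qed
  then have "frechet_derivative (\<lambda>x. ?\<theta> x (?w x)) (at x\<^sub>0) = frechet_derivative (\<lambda>x. v) (at x\<^sub>0)"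
    by (rule frechet_derivative_eventually_cong)
  moreover have "frechet_derivative (\<lambda>x. ?\<theta> x (?w x)) (at x\<^sub>0) u =
    frechet_derivative (\<lambda>x. ?\<theta> x (?w x\<^sub>0)) (at x\<^sub>0) u + ?\<theta> x\<^sub>0 (frechet_derivative ?w (at x\<^sub>0) u)"
    by (intro frechet_derivative_linear_apply mc_eventually_linear[OF U0(1) x0] mc_smooth[OF U0(1) x0] w)
  ultimately show ?thesis by (simp add: w0 dw mc_one eq_neg_iff_add_eq_0)
qed

text \<open>As x y x^-1 y^-1 = (x y) (y x)^-1, the commutator is a composite of local multiplication
  and inversion. The claims share the fact \<open>key\<close>: near the identity every intermediate
  product stays in the chart.\<close>

lemma eventually_local_commutator:
  "smooth_at (x\<^sub>0, x\<^sub>0) local_commutator"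
  "\<forall>\<^sub>F z in nhds (x\<^sub>0, x\<^sub>0). commutator (\<gamma> (fst z)) (\<gamma> (snd z)) \<in> U\<^sub>0"
  "\<forall>\<^sub>F z in nhds (x\<^sub>0, x\<^sub>0). local_mult z = local_mult (local_commutator z, local_mult (snd z, fst z))"
proof -
  define h where "h z = (local_mult z, local_inv (local_mult (snd z, fst z)))" for z
  have ms: "smooth_at (x\<^sub>0, x\<^sub>0) (\<lambda>z. local_mult (snd z, fst z))"
    by (rule smooth_at_compose[OF _ smooth_at_swap]) (simp add: local_mult_smooth)
  have "smooth_at (x\<^sub>0, x\<^sub>0) (\<lambda>z. local_inv (local_mult (snd z, fst z)))"
    by (rule smooth_at_compose[OF _ ms]) (simp add: local_mult_one local_inv_smooth)
  then have h: "smooth_at (x\<^sub>0, x\<^sub>0) h"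
    unfolding h_def by (intro smooth_at_Pair local_mult_smooth)
  have h1: "h (x\<^sub>0, x\<^sub>0) = (x\<^sub>0, x\<^sub>0)" by (simp add: h_def local_mult_one local_inv_one)
  have 2: "\<forall>\<^sub>F z in nhds (x\<^sub>0, x\<^sub>0). \<gamma> (snd z) \<otimes> \<gamma> (fst z) \<in> U\<^sub>0"
    using eventually_nhds_smooth_at[OF smooth_at_swap[of "(x\<^sub>0, x\<^sub>0)"],
        of "\<lambda>z. \<gamma> (fst z) \<in> U\<^sub>0 \<and> \<gamma> (snd z) \<in> U\<^sub>0 \<and> \<gamma> (fst z) \<otimes> \<gamma> (snd z) \<in> U\<^sub>0"] eventually_local_mult
    by (auto elim: eventually_mono)
  have 3: "\<forall>\<^sub>F z in nhds (x\<^sub>0, x\<^sub>0). inv (\<gamma> (local_mult (snd z, fst z))) \<in> U\<^sub>0"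
    using eventually_nhds_smooth_at[OF ms, of "\<lambda>x. \<gamma> x \<in> U\<^sub>0 \<and> inv (\<gamma> x) \<in> U\<^sub>0"] eventually_local_inv
    by (auto elim: eventually_mono simp: local_mult_one)
  have 4: "\<forall>\<^sub>F z in nhds (x\<^sub>0, x\<^sub>0). \<gamma> (fst (h z)) \<otimes> \<gamma> (snd (h z)) \<in> U\<^sub>0"
    using eventually_nhds_smooth_at[OF h,
        of "\<lambda>z. \<gamma> (fst z) \<in> U\<^sub>0 \<and> \<gamma> (snd z) \<in> U\<^sub>0 \<and> \<gamma> (fst z) \<otimes> \<gamma> (snd z) \<in> U\<^sub>0"] eventually_local_mult
    by (auto elim: eventually_mono simp: h1)
  have key: "\<forall>\<^sub>F z in nhds (x\<^sub>0, x\<^sub>0). \<gamma> (fst z) \<in> U\<^sub>0 \<and> \<gamma> (snd z) \<in> U\<^sub>0 \<and>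
      \<gamma> (snd z) \<otimes> \<gamma> (fst z) \<in> U\<^sub>0 \<and>
      commutator (\<gamma> (fst z)) (\<gamma> (snd z)) \<in> U\<^sub>0 \<and> local_mult (h z) = local_commutator z"
    using eventually_local_mult 2 3 4
  proof eventually_elim
    case (elim z)
    let ?a = "\<gamma> (fst z)" and ?b = "\<gamma> (snd z)"
    have c: "?a \<in> carrier G" "?b \<in> carrier G" using elim chart0_carrier by auto
    have m: "\<gamma> (local_mult z) = ?a \<otimes> ?b" "\<gamma> (local_mult (snd z, fst z)) = ?b \<otimes> ?a"
      using elim by (simp_all add: local_mult_def chart0_left_inverse)
    then have "\<gamma> (snd (h z)) = inv (?b \<otimes> ?a)"
      using elim by (simp add: h_def local_inv_def chart0_left_inverse)
    then have "\<gamma> (fst (h z)) \<otimes> \<gamma> (snd (h z)) = commutator ?a ?b"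
      using c by (simp add: h_def m commutator_def inv_mult_group m_assoc)
    then show ?case using elim by (simp add: local_mult_def local_commutator_def)
  qed
  show "\<forall>\<^sub>F z in nhds (x\<^sub>0, x\<^sub>0). commutator (\<gamma> (fst z)) (\<gamma> (snd z)) \<in> U\<^sub>0"
    using key by eventually_elim blast
  have "smooth_at (x\<^sub>0, x\<^sub>0) (\<lambda>z. local_mult (h z))"
    by (rule smooth_at_compose[OF _ h]) (simp add: h1 local_mult_smooth)
  then show "smooth_at (x\<^sub>0, x\<^sub>0) local_commutator"
    by (rule smooth_at_cong) (use key in eventually_elim, blast)
  show "\<forall>\<^sub>F z in nhds (x\<^sub>0, x\<^sub>0). local_mult z = local_mult (local_commutator z, local_mult (snd z, fst z))"
    using key
  proof eventually_elim
    case (elim z)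
    let ?a = "\<gamma> (fst z)" and ?b = "\<gamma> (snd z)"
    have c: "?a \<in> carrier G" "?b \<in> carrier G" using elim chart0_carrier by auto
    have "commutator ?a ?b \<otimes> (?b \<otimes> ?a) = ?a \<otimes> ?b \<otimes> (inv (?b \<otimes> ?a) \<otimes> (?b \<otimes> ?a))"
      using c by (simp add: commutator_def inv_mult_group m_assoc)
    also have "\<dots> = ?a \<otimes> ?b" using c by simp
    finally show ?case
      using elim by (simp add: local_mult_def local_commutator_def chart0_left_inverse)
  qed
qed

lemma local_commutator_units:
  "\<forall>\<^sub>F x in nhds x\<^sub>0. local_commutator (x, x\<^sub>0) = x\<^sub>0 \<and> local_commutator (x\<^sub>0, x) = x\<^sub>0"
  using eventually_chart0
  by eventually_elim (simp add: local_commutator_def commutator_def inv_chart0_one chart0_carrier)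

lemma Ad_minus_id_smooth: "smooth_at x\<^sub>0 (\<lambda>x. Ad_minus_id x v)"
  unfolding Ad_minus_id_def
  using smooth_at_partial1(1)[OF smooth_at_frechet[OF eventually_local_commutator(1)]] .

lemma Ad_minus_id_linear: "\<forall>\<^sub>F x in nhds x\<^sub>0. linear (Ad_minus_id x)"
  using eventually_nhds_pair1[OF smooth_at_eventually[OF eventually_local_commutator(1)]]
proof eventually_elim
  case (elim x)
  have "linear (\<lambda>v. (0::'e, v::'e))" by (auto intro: linearI)
  from linear_compose[OF this smooth_at_linear[OF elim]] show ?case
    by (simp add: Ad_minus_id_def[abs_def] comp_def)
qed

lemma Ad_minus_id_one: "Ad_minus_id x\<^sub>0 v = 0"
proof -
  have "frechet_derivative (\<lambda>y. local_commutator (x\<^sub>0, y)) (at x\<^sub>0) = frechet_derivative (\<lambda>y. x\<^sub>0) (at x\<^sub>0)"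
    by (rule frechet_derivative_eventually_cong) (use local_commutator_units in eventually_elim, simp)
  then show ?thesis
    using smooth_at_partial2(2)[OF eventually_local_commutator(1), of v] by (simp add: Ad_minus_id_def)
qed

text \<open>Differentiate \<open>m(x, y) = m([x, y], m(y, x))\<close> in \<open>y\<close> and then in \<open>x\<close>, both at \<open>1\<close>.\<close>

lemma bracket_eq_mixed: "bracket u v = mixed u v - mixed v u"
proof -
  let ?D = "\<lambda>z. frechet_derivative local_mult (at z)" and ?m = local_mult and ?C = local_commutator
  let ?R = "\<lambda>x w. ?D (x\<^sub>0, x) (w, 0)"
  let ?K = Ad_minus_id
  \<comment> \<open>The derivative in y at y = 1, with x still free, since the result is to be
    differentiated again in x. \<open>?R x\<close> is the differential at 1 of right multiplication
    by x.\<close>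
  have 1: "\<forall>\<^sub>F x in nhds x\<^sub>0. ?D (x, x\<^sub>0) (0, v) = ?R x (?K x v) + ?R x v"
  proof -
    have a: "\<forall>\<^sub>F x in nhds x\<^sub>0. \<forall>\<^sub>F z in nhds (x, x\<^sub>0). ?m z = ?m (?C z, ?m (snd z, fst z))"
      by (rule eventually_nhds_pair1) (use eventually_local_commutator(3) in \<open>simp add: eventually_eventually\<close>)
    have b: "\<forall>\<^sub>F x in nhds x\<^sub>0. smooth_at (x, x\<^sub>0) ?m" "\<forall>\<^sub>F x in nhds x\<^sub>0. smooth_at (x, x\<^sub>0) ?C"
      using eventually_nhds_pair1 smooth_at_eventually local_mult_smooth eventually_local_commutator(1) by blast+
    have c: "\<forall>\<^sub>F x in nhds x\<^sub>0. smooth_at (x\<^sub>0, x) ?m"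
      using eventually_nhds_pair2 smooth_at_eventually local_mult_smooth by blast
    have d: "\<forall>\<^sub>F x in nhds x\<^sub>0. \<forall>\<^sub>F y in nhds x. ?m (x\<^sub>0, y) = y \<and> ?m (y, x\<^sub>0) = y"
      using local_mult_units by (simp add: eventually_eventually)
    show ?thesis
      using a b c d local_mult_units local_commutator_units
    proof eventually_elim
      case (elim x)
      let ?g = "\<lambda>z. (?C z, ?m (snd z, fst z))"
      have s: "smooth_at (x, x\<^sub>0) (\<lambda>z. ?m (snd z, fst z))"
        by (rule smooth_at_compose[OF _ smooth_at_swap]) (simp add: elim)
      have g: "smooth_at (x, x\<^sub>0) ?g" using elim s by (intro smooth_at_Pair)
      have gx: "?g (x, x\<^sub>0) = (x\<^sub>0, x)" using elim by simp
      have "((\<lambda>z. (snd z, fst z)) has_derivative (\<lambda>z. (snd z, fst z))) (at (x, x\<^sub>0))"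
        by (intro has_derivative_Pair has_derivative_fst has_derivative_snd has_derivative_ident)
      from frechet_derivativeI[OF this]
      have sw: "frechet_derivative (\<lambda>z. (snd z, fst z)) (at (x, x\<^sub>0)) (0, v) = (v, 0)" by simp
      have ds: "frechet_derivative (\<lambda>z. ?m (snd z, fst z)) (at (x, x\<^sub>0)) (0, v) = ?R x v"
        using frechet_derivative_chain[of "(x, x\<^sub>0)" "\<lambda>z. (snd z, fst z)" ?m, OF smooth_at_swap] elim
        by (simp add: sw)
      have "?D (x, x\<^sub>0) (0, v) = frechet_derivative (\<lambda>z. ?m (?g z)) (at (x, x\<^sub>0)) (0, v)"
        using frechet_derivative_eventually_cong[OF elim(1)] by simp
      also have "\<dots> = ?D (x\<^sub>0, x) (frechet_derivative ?g (at (x, x\<^sub>0)) (0, v))"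
        using frechet_derivative_chain[OF g, of ?m] elim gx by simp
      also have "frechet_derivative ?g (at (x, x\<^sub>0)) (0, v) = (?K x v, ?R x v)"
        using frechet_derivative_Pair[OF elim(3) s] ds by (simp add: Ad_minus_id_def)
      also have "(?K x v, ?R x v) = (?K x v, 0) + (0, ?R x v)" by simp
      also have "?D (x\<^sub>0, x) \<dots> = ?R x (?K x v) + ?D (x\<^sub>0, x) (0, ?R x v)"
        using smooth_at_linear[OF elim(4)] by (rule linear_add)
      also have "?D (x\<^sub>0, x) (0, ?R x v) = frechet_derivative (\<lambda>y. ?m (x\<^sub>0, y)) (at x) (?R x v)"
        using smooth_at_partial2(2)[OF elim(4)] by simp
      also have "frechet_derivative (\<lambda>y. ?m (x\<^sub>0, y)) (at x) = frechet_derivative (\<lambda>y. y) (at x)"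
        by (rule frechet_derivative_eventually_cong) (use elim(5) in eventually_elim, simp)
      finally show ?case by simp
    qed
  qed
  have D: "smooth_at (x\<^sub>0, x\<^sub>0) (\<lambda>z. ?D z w)" for w by (intro smooth_at_frechet local_mult_smooth)
  have R: "smooth_at x\<^sub>0 (\<lambda>x. ?R x w)" for w by (rule smooth_at_partial2(1)[OF D])
  have linR: "\<forall>\<^sub>F x in nhds x\<^sub>0. linear (?R x)"
    using eventually_nhds_pair2[OF smooth_at_eventually[OF local_mult_smooth]]
  proof eventually_elim
    case (elim x)
    have "linear (\<lambda>v. (v::'e, 0::'e))" by (auto intro: linearI)
    from linear_compose[OF this smooth_at_linear[OF elim]] show ?case by (simp add: comp_def)
  qed
  have R1: "?R x\<^sub>0 w = w" for w
  proof -
    have "frechet_derivative (\<lambda>y. ?m (y, x\<^sub>0)) (at x\<^sub>0) = frechet_derivative (\<lambda>y. y) (at x\<^sub>0)"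
      by (rule frechet_derivative_eventually_cong) (use local_mult_units in eventually_elim, simp)
    then show ?thesis using smooth_at_partial1(2)[OF local_mult_smooth, of w] by simp
  qed
  have RK: "smooth_at x\<^sub>0 (\<lambda>x. ?R x (?K x v))"
    by (rule smooth_at_linear_apply[OF linR R Ad_minus_id_smooth])
  \<comment> \<open>At 1 the vector \<open>?K x v\<close> vanishes and \<open>?R\<close> is the
    identity, so only the derivative of \<open>?K\<close> survives.\<close>
  have dRK: "frechet_derivative (\<lambda>x. ?R x (?K x v)) (at x\<^sub>0) u = bracket u v"
  proof -
    have "frechet_derivative (\<lambda>x. ?R x 0) (at x\<^sub>0) = frechet_derivative (\<lambda>x. 0) (at x\<^sub>0)"
      by (rule frechet_derivative_eventually_cong) (use linR in eventually_elim, rule linear_0)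
    then show ?thesis
      unfolding frechet_derivative_linear_apply[OF linR R Ad_minus_id_smooth] R1 Ad_minus_id_one
      by (simp add: bracket_def)
  qed
  \<comment> \<open>Here the order of differentiation is exchanged: \<open>?R\<close> differentiates
    in the first factor first, \<open>mixed\<close> in the second.\<close>
  have dR: "frechet_derivative (\<lambda>x. ?R x v) (at x\<^sub>0) u = mixed v u"
    using smooth_at_partial2(2)[OF D[of "(v, 0)"], of u]
      frechet_derivative_symmetric[OF local_mult_smooth, of "(v, 0)" "(0, u)"] by (simp add: mixed_def)
  have "mixed u v = frechet_derivative (\<lambda>x. ?D (x, x\<^sub>0) (0, v)) (at x\<^sub>0) u"
    using smooth_at_partial1(2)[OF D[of "(0, v)"], of u] by (simp add: mixed_def)
  also have "\<dots> = frechet_derivative (\<lambda>x. ?R x (?K x v) + ?R x v) (at x\<^sub>0) u"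
    using frechet_derivative_eventually_cong[OF 1] by simp
  also have "\<dots> = bracket u v + mixed v u"
    using frechet_derivativeI[OF has_derivative_add[OF smooth_at_has_derivative[OF RK] smooth_at_has_derivative[OF R]]]
    by (simp add: dRK dR)
  finally show ?thesis by simp
qed

lemma bracket_linear: "linear (bracket u)"
  unfolding bracket_def by (rule linear_frechet_derivative_parameter[OF Ad_minus_id_linear Ad_minus_id_smooth])

lemma bracket_antisym: "bracket u v = - bracket v u"
  by (simp add: bracket_eq_mixed)

lemma mc_structure_one:
  "frechet_derivative (\<lambda>x. \<Theta> (U\<^sub>0, \<phi>\<^sub>0) x v) (at x\<^sub>0) u - frechet_derivative (\<lambda>x. \<Theta> (U\<^sub>0, \<phi>\<^sub>0) x u) (at x\<^sub>0) v
    = - bracket u v"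
  by (simp add: mc_derivative_one bracket_eq_mixed)

text \<open>Translation by p^-1 moves the point to 1. Differentiating the invariance of \<Theta>
  yields the derivative of \<Theta> at 1 and a second derivative of the translation; the latter is
  symmetric and disappears on antisymmetrizing.\<close>

lemma mc_structure:
  assumes U: "(U, \<phi>) \<in> A" and x: "x \<in> \<phi> ` U"
  shows "frechet_derivative (\<lambda>y. \<Theta> (U, \<phi>) y v) (at x) u - frechet_derivative (\<lambda>y. \<Theta> (U, \<phi>) y u) (at x) v
    = - bracket (\<Theta> (U, \<phi>) x u) (\<Theta> (U, \<phi>) x v)"
proof -
  obtain p where p: "x = \<phi> p" "p \<in> U" using x by blast
  have pc: "p \<in> carrier G" using chart_subset[OF G U p(2)] .
  let ?T = "\<lambda>y. \<phi>\<^sub>0 (inv p \<otimes> inv_into U \<phi> y)"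
  let ?DT = "\<lambda>y. frechet_derivative ?T (at y)"
  let ?\<theta> = "\<Theta> (U\<^sub>0, \<phi>\<^sub>0)"
  have ip: "inv p \<otimes> p \<in> U\<^sub>0" using pc U0(2) by simp
  have T: "smooth_at x ?T" unfolding p(1)
    by (rule smooth_at_translation[OF G U U0(1) _ p(2) ip]) (use pc in simp)
  have Tx: "?T x = x\<^sub>0" using pc by (simp add: p chart_inv[OF G U])
  have \<Theta>x: "\<Theta> (U, \<phi>) x w = ?DT x w" for w unfolding p(1) by (rule mc_translation[OF U p(2)])
  have x0: "x\<^sub>0 \<in> \<phi>\<^sub>0 ` U\<^sub>0" using U0(2) by blast
  have "\<forall>\<^sub>F y in nhds x. inv_into U \<phi> y \<in> U \<and> inv p \<otimes> inv_into U \<phi> y \<in> U\<^sub>0 \<and> \<phi> (inv_into U \<phi> y) = y"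
    unfolding p(1) using pc
    by (intro chart_eventually[OF G U continuous_map_translation[OF G] chart_openin[OF G U0(1)] p(2) ip]) simp
  then have e: "\<forall>\<^sub>F y in nhds x. \<Theta> (U, \<phi>) y w = ?\<theta> (?T y) (?DT y w)" for w
  proof eventually_elim
    case (elim y)
    then show ?case using mc_invariant[OF U U0(1) inv_closed[OF pc], of "inv_into U \<phi> y" w] by simp
  qed
  have lin: "\<forall>\<^sub>F y in nhds x. linear (?\<theta> (?T y))"
    using eventually_nhds_smooth_at[OF T, of "\<lambda>y. linear (?\<theta> y)"] mc_eventually_linear[OF U0(1) x0]
    unfolding Tx by blast
  have s: "smooth_at x (\<lambda>y. ?\<theta> (?T y) b)" for b
    by (rule smooth_at_compose[OF _ T]) (simp only: Tx mc_smooth[OF U0(1) x0])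
  have "frechet_derivative (\<lambda>y. \<Theta> (U, \<phi>) y w) (at x) z =
    frechet_derivative (\<lambda>y. ?\<theta> y (?DT x w)) (at x\<^sub>0) (?DT x z) + frechet_derivative (\<lambda>y. ?DT y w) (at x) z" for w z
  proof -
    have "frechet_derivative (\<lambda>y. \<Theta> (U, \<phi>) y w) (at x) z = frechet_derivative (\<lambda>y. ?\<theta> (?T y) (?DT y w)) (at x) z"
      using frechet_derivative_eventually_cong[OF e] by simp
    also have "\<dots> = frechet_derivative (\<lambda>y. ?\<theta> (?T y) (?DT x w)) (at x) z + ?\<theta> (?T x) (frechet_derivative (\<lambda>y. ?DT y w) (at x) z)"
      by (rule frechet_derivative_linear_apply[OF lin s smooth_at_frechet[OF T]])
    also have "frechet_derivative (\<lambda>y. ?\<theta> (?T y) (?DT x w)) (at x) z =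
        frechet_derivative (\<lambda>y. ?\<theta> y (?DT x w)) (at x\<^sub>0) (?DT x z)"
      using frechet_derivative_chain[OF T, of "\<lambda>y. ?\<theta> y (?DT x w)"] mc_smooth[OF U0(1) x0] by (simp only: Tx)
    finally show ?thesis unfolding Tx mc_one .
  qed
  moreover have "frechet_derivative (\<lambda>y. ?DT y v) (at x) u = frechet_derivative (\<lambda>y. ?DT y u) (at x) v"
    by (rule frechet_derivative_symmetric[OF T])
  ultimately show ?thesis
    using mc_structure_one[of "?DT x v" "?DT x u"] by (simp add: \<Theta>x)
qed

subsection \<open>Nilpotency of the bracket\<close>

text \<open>In an iterated commutator the outer entries stay fixed while the innermost variable
  tends to 1. So the conditions on x are pointwise, and the last one allows a neighbourhood in y
  that depends on x.\<close>

definition good_point :: "'e \<Rightarrow> bool" where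
  "good_point x \<longleftrightarrow> smooth_at (x, x\<^sub>0) local_commutator \<and> local_commutator (x, x\<^sub>0) = x\<^sub>0 \<and> \<gamma> x \<in> U\<^sub>0 \<and>
     (\<forall>\<^sub>F y in nhds x\<^sub>0. commutator (\<gamma> x) (\<gamma> y) \<in> U\<^sub>0)"

lemma eventually_good_point: "\<forall>\<^sub>F x in nhds x\<^sub>0. good_point x"
proof -
  \<comment> \<open>Asking for a neighbourhood of every nearby z ensures that a neighbourhood in y
    is left after restricting z to the pairs \<open>(x, x\<^sub>0)\<close>.\<close>
  have "\<forall>\<^sub>F z in nhds (x\<^sub>0, x\<^sub>0). \<forall>\<^sub>F z' in nhds z. commutator (\<gamma> (fst z')) (\<gamma> (snd z')) \<in> U\<^sub>0"
    using eventually_local_commutator(2) by (simp add: eventually_eventually)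
  from eventually_nhds_pair1[OF this]
  have "\<forall>\<^sub>F x in nhds x\<^sub>0. \<forall>\<^sub>F y in nhds x\<^sub>0. commutator (\<gamma> x) (\<gamma> y) \<in> U\<^sub>0"
  proof eventually_elim
    case (elim x)
    from eventually_nhds_pair2[OF elim] show ?case by simp
  qed
  then show ?thesis
    using eventually_nhds_pair1[OF smooth_at_eventually[OF eventually_local_commutator(1)]]
      local_commutator_units eventually_chart0
    unfolding good_point_def by eventually_elim blast
qed

definition commutators :: "'e list \<Rightarrow> 'g \<Rightarrow> 'g" where
  "commutators xs h = foldr (\<lambda>x. commutator (\<gamma> x)) xs h"

text \<open>Each further commutator raises the step in the series by one. That 1 is fixed is
  recorded because it lets the chain rule take all differentials at the same point.\<close>

lemma commutators_lower_central_series: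
  assumes "list_all good_point xs" "h \<in> carrier G"
  shows "commutators xs h \<in> lower_central_series G (length xs) \<and> commutators xs \<one> = \<one>"
  using assms(1)
proof (induction xs)
  case Nil
  then show ?case using assms(2) by (simp add: commutators_def)
next
  case (Cons x xs)
  then have x: "\<gamma> x \<in> carrier G" and IH: "commutators xs h \<in> lower_central_series G (length xs)" "commutators xs \<one> = \<one>"
    by (auto simp: good_point_def chart0_carrier)
  have "commutators (x # xs) h = \<gamma> x \<otimes> commutators xs h \<otimes> inv (\<gamma> x) \<otimes> inv (commutators xs h)"
    by (simp add: commutators_def commutator_def)
  then have "commutators (x # xs) h \<in> lower_central_series G (length (x # xs))"
    using x IH(1) by (auto intro!: generate.incl)
  moreover have "commutators (x # xs) \<one> = \<one>"
    using IH(2) x by (simp add: commutators_def commutator_def)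
  ultimately show ?case by blast
qed

text \<open>All maps y -> [x, y] fix 1, so the differential of their composite at 1 is the product
  of the differentials. The chart condition is carried through the induction in order to cancel the
  chart against its inverse between two factors.\<close>

lemma commutators_derivative:
  assumes "list_all good_point xs"
  shows "((\<lambda>y. \<phi>\<^sub>0 (commutators xs (\<gamma> y))) has_derivative foldr Ad_minus_id xs) (at x\<^sub>0) \<and>
    (\<forall>\<^sub>F y in nhds x\<^sub>0. commutators xs (\<gamma> y) \<in> U\<^sub>0)"
  using assms
proof (induction xs)
  case Nil
  have "((\<lambda>y. \<phi>\<^sub>0 (\<gamma> y)) has_derivative (\<lambda>y. y)) (at x\<^sub>0)"
    by (rule has_derivative_eventually_cong[OF has_derivative_ident]) (use eventually_chart0 in eventually_elim, simp)
  then show ?case using eventually_chart0 by (auto simp: commutators_def id_def elim: eventually_mono)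
next
  case (Cons x xs)
  let ?f = "\<lambda>y. \<phi>\<^sub>0 (commutators xs (\<gamma> y))"
  have x: "good_point x" and xs: "list_all good_point xs" using Cons.prems by auto
  note IH = Cons.IH[OF xs]
  have f0: "?f x\<^sub>0 = x\<^sub>0"
    using commutators_lower_central_series[OF xs one_closed] by (simp add: inv_chart0_one)
  have c: "isCont ?f x\<^sub>0" using IH has_derivative_continuous by blast
  have "((\<lambda>y. local_commutator (x, y)) has_derivative Ad_minus_id x) (at x\<^sub>0)"
  proof -
    have "smooth_at (x, x\<^sub>0) local_commutator" using x by (simp add: good_point_def)
    from smooth_at_has_derivative[OF smooth_at_partial2(1)[OF this]] smooth_at_partial2(2)[OF this]
    show ?thesis by (simp add: Ad_minus_id_def[abs_def])
  qed
  then have "((\<lambda>y. local_commutator (x, y)) has_derivative Ad_minus_id x) (at (?f x\<^sub>0))" by (simp only: f0)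
  from has_derivative_compose[OF conjunct1[OF IH] this]
  have "((\<lambda>y. local_commutator (x, ?f y)) has_derivative foldr Ad_minus_id (x # xs)) (at x\<^sub>0)"
    by (simp add: comp_def)
  then have 1: "((\<lambda>y. \<phi>\<^sub>0 (commutators (x # xs) (\<gamma> y))) has_derivative foldr Ad_minus_id (x # xs)) (at x\<^sub>0)"
    by (rule has_derivative_eventually_cong)
      (use conjunct2[OF IH] in eventually_elim, simp add: local_commutator_def commutators_def chart0_left_inverse)
  have "\<forall>\<^sub>F y in nhds (?f x\<^sub>0). commutator (\<gamma> x) (\<gamma> y) \<in> U\<^sub>0" using x unfolding f0 by (simp add: good_point_def)
  from eventually_nhds_isCont[OF c this]
  have "\<forall>\<^sub>F y in nhds x\<^sub>0. commutator (\<gamma> x) (\<gamma> (?f y)) \<in> U\<^sub>0" .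
  then have "\<forall>\<^sub>F y in nhds x\<^sub>0. commutators (x # xs) (\<gamma> y) \<in> U\<^sub>0"
    using conjunct2[OF IH] by eventually_elim (simp add: commutators_def chart0_left_inverse)
  then show ?case using 1 by blast
qed

lemma Ad_minus_id_nilpotent:
  assumes "lower_central_series G N = {\<one>}" "list_all good_point xs" "length xs = N"
  shows "foldr Ad_minus_id xs v = 0"
proof -
  have "\<forall>\<^sub>F y in nhds x\<^sub>0. \<phi>\<^sub>0 (commutators xs (\<gamma> y)) = x\<^sub>0"
    using eventually_chart0
  proof eventually_elim
    case (elim y)
    then show ?case using commutators_lower_central_series[OF assms(2), of "\<gamma> y"] assms chart0_carrier by simp
  qed
  from has_derivative_eventually_cong[OF conjunct1[OF commutators_derivative[OF assms(2)]] this]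
  have "foldr Ad_minus_id xs = (\<lambda>v. 0)"
    using has_derivative_unique has_derivative_const by blast
  then show ?thesis by simp
qed

lemma foldr_bracket_linear: "linear (foldr bracket us)"
proof (induction us)
  case Nil
  show ?case by (auto intro: linearI)
next
  case (Cons u us)
  show ?case using linear_compose[OF Cons bracket_linear] by (simp add: comp_def)
qed

text \<open>Factors \<open>Ad_minus_id x\<close> are traded for brackets one at a time: a product
  that vanishes for all x near 1 has zero derivative at 1, and the linear map formed by the outer
  brackets commutes with this derivative. Appending u at the end of us makes its bracket act
  directly on the remaining product, which is why the induction runs from the right.\<close>

lemma bracket_Ad_nilpotent:
  assumes "lower_central_series G N = {\<one>}" "list_all good_point xs" "length us + length xs = N"
  shows "foldr bracket us (foldr Ad_minus_id xs v) = 0"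
  using assms(2,3)
proof (induction us arbitrary: xs rule: rev_induct)
  case Nil
  then show ?case using Ad_minus_id_nilpotent[OF assms(1)] by simp
next
  case (snoc u us)
  let ?w = "foldr Ad_minus_id xs v" and ?L = "foldr bracket us"
  have bl: "bounded_linear ?L" using foldr_bracket_linear linear_conv_bounded_linear by blast
  have "\<forall>\<^sub>F x in nhds x\<^sub>0. ?L (Ad_minus_id x ?w) = 0"
    using eventually_good_point
  proof eventually_elim
    case (elim x)
    show ?case using snoc.IH[of "x # xs"] snoc.prems elim by simp
  qed
  from has_derivative_eventually_cong[OF bounded_linear.has_derivative[OF bl smooth_at_has_derivative[OF Ad_minus_id_smooth]] this]
  have "(\<lambda>u. ?L (frechet_derivative (\<lambda>x. Ad_minus_id x ?w) (at x\<^sub>0) u)) = (\<lambda>u. 0)"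
    using has_derivative_unique has_derivative_const by blast
  from fun_cong[OF this, of u] show ?case by (simp add: bracket_def[of u])
qed

lemma bracket_nilpotent:
  assumes "lower_central_series G N = {\<one>}" "length us = N"
  shows "foldr bracket us v = 0"
  using bracket_Ad_nilpotent[OF assms(1), of "[]" us v] assms(2) by simp

end

section \<open>Invariant coframes\<close>

text \<open>A coframe with values in the model space, abstracted from \<Theta> so that a linear
  change of coordinates can make the adapted basis the standard one. Each \<theta> is an
  isomorphism, because it is a surjective linear map of a finite-dimensional space to
  itself.\<close>

locale invariant_frame =
  fixes G :: "('g::topological_space, 'm) monoid_scheme" (structure)
    and A :: "('g, 'e::euclidean_space) atlas"
    and \<theta> :: "('g, 'e) chart \<Rightarrow> 'e \<Rightarrow> 'e \<Rightarrow> 'e"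
    and br :: "'e \<Rightarrow> 'e \<Rightarrow> 'e"
  assumes G: "lie_group G A"
    and frame_linear: "(U, \<phi>) \<in> A \<Longrightarrow> x \<in> \<phi> ` U \<Longrightarrow> linear (\<theta> (U, \<phi>) x)"
    and frame_surj: "(U, \<phi>) \<in> A \<Longrightarrow> x \<in> \<phi> ` U \<Longrightarrow> surj (\<theta> (U, \<phi>) x)"
    and frame_smooth: "(U, \<phi>) \<in> A \<Longrightarrow> x \<in> \<phi> ` U \<Longrightarrow> smooth_at x (\<lambda>x. \<theta> (U, \<phi>) x v)"
    and frame_invariant: "(U, \<phi>) \<in> A \<Longrightarrow> (V, \<psi>) \<in> A \<Longrightarrow> h \<in> carrier G \<Longrightarrow> p \<in> U \<Longrightarrow> h \<otimes> p \<in> V \<Longrightarrow>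
      \<theta> (U, \<phi>) (\<phi> p) v =
      \<theta> (V, \<psi>) (\<psi> (h \<otimes> p)) (frechet_derivative (\<lambda>x. \<psi> (h \<otimes> inv_into U \<phi> x)) (at (\<phi> p)) v)"
    and frame_structure: "(U, \<phi>) \<in> A \<Longrightarrow> x \<in> \<phi> ` U \<Longrightarrow>
      frechet_derivative (\<lambda>y. \<theta> (U, \<phi>) y v) (at x) u - frechet_derivative (\<lambda>y. \<theta> (U, \<phi>) y u) (at x) v =
      - br (\<theta> (U, \<phi>) x u) (\<theta> (U, \<phi>) x v)"

lemma (in lie_group_chart) mc_frame: "invariant_frame G A \<Theta> bracket"
  by (rule invariant_frame.intro) (fact G mc_linear mc_surj mc_smooth mc_invariant mc_structure)+

lemma (in invariant_frame) linear_change: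
  assumes L: "linear L" "surj L" and L': "\<And>x. L' (L x) = x"
  shows "invariant_frame G A (\<lambda>c x v. L (\<theta> c x v)) (\<lambda>u v. L (br (L' u) (L' v)))"
proof (rule invariant_frame.intro)
  show "lie_group G A" by (rule G)
  fix U and \<phi> :: "'g \<Rightarrow> 'e" and x assume U: "(U, \<phi>) \<in> A" and x: "x \<in> \<phi> ` U"
  show "linear (\<lambda>v. L (\<theta> (U, \<phi>) x v))"
    using linear_compose[OF frame_linear[OF U x] L(1)] by (simp add: comp_def)
  show "surj (\<lambda>v. L (\<theta> (U, \<phi>) x v))"
    using comp_surj[OF frame_surj[OF U x] L(2)] by (simp add: comp_def)
  fix v
  show "smooth_at x (\<lambda>x. L (\<theta> (U, \<phi>) x v))"
    by (rule smooth_at_linear_compose[OF L(1) frame_smooth[OF U x]])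
  fix u
  have d: "frechet_derivative (\<lambda>y. L (\<theta> (U, \<phi>) y v)) (at x) u = L (frechet_derivative (\<lambda>y. \<theta> (U, \<phi>) y v) (at x) u)" for u v
    using L(1) linear_conv_bounded_linear
      frechet_derivativeI[OF bounded_linear.has_derivative[OF _ smooth_at_has_derivative[OF frame_smooth[OF U x]]]]
    by metis
  show "frechet_derivative (\<lambda>y. L (\<theta> (U, \<phi>) y v)) (at x) u - frechet_derivative (\<lambda>y. L (\<theta> (U, \<phi>) y u)) (at x) v =
      - L (br (L' (L (\<theta> (U, \<phi>) x u))) (L' (L (\<theta> (U, \<phi>) x v))))"
    using frame_structure[OF U x, of v u] by (simp add: d L' linear_diff[OF L(1), symmetric] linear_neg[OF L(1), symmetric])
next
  fix U V h p v and \<phi> \<psi> :: "'g \<Rightarrow> 'e"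
  assume "(U, \<phi>) \<in> A" "(V, \<psi>) \<in> A" "h \<in> carrier G" "p \<in> U" "h \<otimes> p \<in> V"
  from frame_invariant[OF this, of v]
  show "L (\<theta> (U, \<phi>) (\<phi> p) v) =
      L (\<theta> (V, \<psi>) (\<psi> (h \<otimes> p)) (frechet_derivative (\<lambda>x. \<psi> (h \<otimes> inv_into U \<phi> x)) (at (\<phi> p)) v))"
    by simp
qed

subsection \<open>A basis adapted to a nilpotent bracket\<close>

lemma UNIV_5: "(UNIV :: 5 set) = {1, 2, 3, 4, 5}"
proof -
  have "x \<in> {1, 2, 3, 4, 5}" for x :: 5
  proof (induct x)
    case (of_int z)
    then have "z \<in> {0, 1, 2, 3, 4}" by auto
    then show ?case by auto
  qed
  then show ?thesis by auto
qed

lemma forall_5: "(\<forall>i::5. P i) \<longleftrightarrow> P 1 \<and> P 2 \<and> P 3 \<and> P 4 \<and> P 5"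
  using UNIV_5 by (metis UNIV_I insert_iff empty_iff)

lemma antisymmetric_self:
  fixes br :: "'e::real_vector \<Rightarrow> 'e \<Rightarrow> 'e"
  assumes "\<And>u v. br u v = - br v u"
  shows "br u u = 0"
proof -
  have "br u u + br u u = 0" using assms[of u u] by (metis add.right_inverse)
  then have "2 *\<^sub>R br u u = 0" by (simp only: scaleR_2)
  then show ?thesis by simp
qed

text \<open>Otherwise every vector outside S could be bracketed to another vector outside S, and N
  repetitions would give a vector outside S that is 0. This replaces the choice of a central element
  in a quotient.\<close>

lemma ex_bracket_in_subspace:
  fixes br :: "'e::real_vector \<Rightarrow> 'e \<Rightarrow> 'e"
  assumes nil: "\<And>us v. length us = N \<Longrightarrow> foldr br us v = 0" and S: "subspace S" "S \<noteq> UNIV"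
  obtains f where "f \<notin> S" "\<And>u. br u f \<in> S"
proof (rule ccontr)
  assume n: "\<not> thesis"
  have *: "f \<notin> S \<Longrightarrow> \<exists>u. br u f \<notin> S" for f using n that by blast
  obtain f where f: "f \<notin> S" using S(2) by blast
  have "\<exists>us. length us = n \<and> foldr br us f \<notin> S" for n
  proof (induction n)
    case 0
    then show ?case using f by simp
  next
    case (Suc n)
    then obtain us where us: "length us = n" "foldr br us f \<notin> S" by blast
    then obtain u where "br u (foldr br us f) \<notin> S" using * by blast
    then show ?case using us by (intro exI[of _ "u # us"]) simp
  qed
  then show False using nil subspace_0[OF S(1)] by metis
qed

lemma scaleR_add_eq_0_span:
  fixes f :: "'e::real_vector"
  assumes "f \<notin> span S" "s \<in> span S" "c *\<^sub>R f + s = 0"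
  shows "c = 0"
proof (rule ccontr)
  assume c: "c \<noteq> 0"
  have "c *\<^sub>R f = - s" using assms(3) by (simp add: eq_neg_iff_add_eq_0)
  then have "inverse c *\<^sub>R (c *\<^sub>R f) = inverse c *\<^sub>R (- s)" by (rule arg_cong)
  then have "f = (- inverse c) *\<^sub>R s" using c by simp
  then show False using assms(1,2) span_scale by metis
qed

text \<open>The span of fewer than five vectors is proper, so the preceding existence result
  supplies the next vector each time, starting with f5. For f1 independence is enough: antisymmetry
  expresses its brackets through those listed.\<close>

lemma nilpotent_flag:
  fixes br :: "real^5 \<Rightarrow> real^5 \<Rightarrow> real^5"
  assumes nil: "\<And>us v. length us = N \<Longrightarrow> foldr br us v = 0"
  obtains f1 f2 f3 f4 f5 where
    "\<And>c1 c2 c3 c4 c5. c1 *\<^sub>R f1 + c2 *\<^sub>R f2 + c3 *\<^sub>R f3 + c4 *\<^sub>R f4 + c5 *\<^sub>R f5 = 0 \<Longrightarrow>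
      c1 = 0 \<and> c2 = 0 \<and> c3 = 0 \<and> c4 = 0 \<and> c5 = 0"
    "\<And>u. br u f5 = 0" "\<And>u. \<exists>a. br u f4 = a *\<^sub>R f5" "\<And>u. \<exists>a b. br u f3 = a *\<^sub>R f4 + b *\<^sub>R f5"
    "\<And>u. \<exists>a b c. br u f2 = a *\<^sub>R f3 + b *\<^sub>R f4 + c *\<^sub>R f5"
proof -
  have ne: "span F \<noteq> UNIV" if "finite F" "card F < 5" for F :: "(real^5) set"
  proof
    assume "span F = UNIV"
    then have "dim (UNIV :: (real^5) set) \<le> card F" using dim_le_card[of UNIV F] that by simp
    then show False using that by simp
  qed
  have ex: "\<exists>f. f \<notin> span F \<and> (\<forall>u. br u f \<in> span F)" if "finite F" "card F < 5" for F
    using ex_bracket_in_subspace[OF nil subspace_span ne[OF that]] by metis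
  obtain f5 where f5: "f5 \<notin> span {}" "\<And>u. br u f5 \<in> span {}" using ex[of "{}"] by auto
  have "card {f5} < 5" by simp
  then obtain f4 where f4: "f4 \<notin> span {f5}" "\<And>u. br u f4 \<in> span {f5}" using ex[of "{f5}"] by auto
  have "card {f4, f5} \<le> Suc (Suc 0)" by (intro card_insert_le_m1) auto
  then have "card {f4, f5} < 5" by simp
  then obtain f3 where f3: "f3 \<notin> span {f4, f5}" "\<And>u. br u f3 \<in> span {f4, f5}" using ex[of "{f4, f5}"] by auto
  have "card {f3, f4, f5} \<le> Suc (Suc (Suc 0))" by (intro card_insert_le_m1) auto
  then have "card {f3, f4, f5} < 5" by simp
  then obtain f2 where f2: "f2 \<notin> span {f3, f4, f5}" "\<And>u. br u f2 \<in> span {f3, f4, f5}" using ex[of "{f3, f4, f5}"] by auto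
  have "card {f2, f3, f4, f5} \<le> Suc (Suc (Suc (Suc 0)))" by (intro card_insert_le_m1) auto
  then have "card {f2, f3, f4, f5} < 5" by simp
  then obtain f1 where f1: "f1 \<notin> span {f2, f3, f4, f5}" using ex[of "{f2, f3, f4, f5}"] by auto
  show thesis
  proof (rule that)
    fix c1 c2 c3 c4 c5
    assume 0: "c1 *\<^sub>R f1 + c2 *\<^sub>R f2 + c3 *\<^sub>R f3 + c4 *\<^sub>R f4 + c5 *\<^sub>R f5 = 0"
    have c1: "c1 = 0"
      by (rule scaleR_add_eq_0_span[OF f1, of "c2 *\<^sub>R f2 + c3 *\<^sub>R f3 + c4 *\<^sub>R f4 + c5 *\<^sub>R f5"])
        (use 0 in \<open>auto intro!: span_add span_scale intro: span_base simp: add.assoc\<close>)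
    have c2: "c2 = 0"
      by (rule scaleR_add_eq_0_span[OF f2(1), of "c3 *\<^sub>R f3 + c4 *\<^sub>R f4 + c5 *\<^sub>R f5"])
        (use 0 c1 in \<open>auto intro!: span_add span_scale intro: span_base simp: add.assoc\<close>)
    have c3: "c3 = 0"
      by (rule scaleR_add_eq_0_span[OF f3(1), of "c4 *\<^sub>R f4 + c5 *\<^sub>R f5"])
        (use 0 c1 c2 in \<open>auto intro!: span_add span_scale intro: span_base simp: add.assoc\<close>)
    have c4: "c4 = 0"
      by (rule scaleR_add_eq_0_span[OF f4(1), of "c5 *\<^sub>R f5"])
        (use 0 c1 c2 c3 in \<open>auto intro!: span_scale intro: span_base\<close>)
    have "c5 = 0" using 0 c1 c2 c3 c4 f5(1) by auto
    then show "c1 = 0 \<and> c2 = 0 \<and> c3 = 0 \<and> c4 = 0 \<and> c5 = 0" using c1 c2 c3 c4 by simp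
  next
    fix u
    show "br u f5 = 0" using f5(2)[of u] by simp
    show "\<exists>a. br u f4 = a *\<^sub>R f5" using f4(2)[of u] by (auto simp: span_singleton)
    show "\<exists>a b. br u f3 = a *\<^sub>R f4 + b *\<^sub>R f5"
      using f3(2)[of u] by (auto simp: span_breakdown_eq span_singleton) (metis diff_eq_eq add.commute)
    show "\<exists>a b c. br u f2 = a *\<^sub>R f3 + b *\<^sub>R f4 + c *\<^sub>R f5"
    proof -
      obtain a b c where "br u f2 - a *\<^sub>R f3 - b *\<^sub>R f4 = c *\<^sub>R f5"
        using f2(2)[of u] by (auto simp: span_breakdown_eq span_singleton)
      then have "br u f2 = a *\<^sub>R f3 + b *\<^sub>R f4 + c *\<^sub>R f5" by (simp add: algebra_simps)
      then show ?thesis by blast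
    qed
  qed
qed

text \<open>In terms of the flag, \<open>b\<^sub>4 = f\<^sub>5\<close> and \<open>b\<^sub>5 = f\<^sub>4\<close>; the three cases of the proof depend on where the linear form
  \<open>u \<mapsto> [u, f\<^sub>4] \<in> \<langle>f\<^sub>5\<rangle>\<close> is nonzero, since \<open>b\<^sub>2, b\<^sub>3\<close> have to lie in its kernel. The Jacobi identity is never used.\<close>

lemma nilpotent_adapted_basis:
  fixes br :: "real^5 \<Rightarrow> real^5 \<Rightarrow> real^5"
  assumes lin: "\<And>u. linear (br u)" and anti: "\<And>u v. br u v = - br v u"
    and nil: "\<And>us v. length us = N \<Longrightarrow> foldr br us v = 0"
  obtains b1 b2 b3 b4 b5 p q r1 r2 r3 s1 s2 s3 s4 where
    "\<And>c1 c2 c3 c4 c5. c1 *\<^sub>R b1 + c2 *\<^sub>R b2 + c3 *\<^sub>R b3 + c4 *\<^sub>R b4 + c5 *\<^sub>R b5 = 0 \<Longrightarrow>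
      c1 = 0 \<and> c2 = 0 \<and> c3 = 0 \<and> c4 = 0 \<and> c5 = 0"
    "br b1 b2 = q *\<^sub>R b3 + s1 *\<^sub>R b4 + r1 *\<^sub>R b5" "br b1 b3 = s2 *\<^sub>R b4 + r2 *\<^sub>R b5"
    "br b2 b3 = p *\<^sub>R b1 + s3 *\<^sub>R b4 + r3 *\<^sub>R b5"
    "\<And>u. br u b4 = 0" "br b1 b5 = s4 *\<^sub>R b4" "br b2 b5 = 0" "br b3 b5 = 0"
proof -
  obtain f1 f2 f3 f4 f5 where
    ind: "\<And>c1 c2 c3 c4 c5. c1 *\<^sub>R f1 + c2 *\<^sub>R f2 + c3 *\<^sub>R f3 + c4 *\<^sub>R f4 + c5 *\<^sub>R f5 = 0 \<Longrightarrow>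
      c1 = 0 \<and> c2 = 0 \<and> c3 = 0 \<and> c4 = 0 \<and> c5 = 0"
    and F: "\<And>u. br u f5 = 0" "\<And>u. \<exists>a. br u f4 = a *\<^sub>R f5" "\<And>u. \<exists>a b. br u f3 = a *\<^sub>R f4 + b *\<^sub>R f5"
    "\<And>u. \<exists>a b c. br u f2 = a *\<^sub>R f3 + b *\<^sub>R f4 + c *\<^sub>R f5"
    using nilpotent_flag[OF nil] by metis
  obtain d e h where f4: "br f1 f4 = d *\<^sub>R f5" "br f2 f4 = e *\<^sub>R f5" "br f3 f4 = h *\<^sub>R f5"
    using F(2) by metis
  obtain a13 b13 a23 b23 where f3: "br f1 f3 = a13 *\<^sub>R f4 + b13 *\<^sub>R f5" "br f2 f3 = a23 *\<^sub>R f4 + b23 *\<^sub>R f5"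
    using F(3) by metis
  obtain a b c where f2: "br f1 f2 = a *\<^sub>R f3 + b *\<^sub>R f4 + c *\<^sub>R f5" using F(4) by metis
  have self: "br u u = 0" for u by (rule antisymmetric_self[OF anti])
  note lr = linear_add[OF lin] linear_diff[OF lin] linear_scale[OF lin]
  have ll: "br (u - r *\<^sub>R w) v = br u v - r *\<^sub>R br w v" for u v w r
    using anti[of "u - r *\<^sub>R w" v] anti[of u v] anti[of w v] by (simp add: lr)
  have swap: "br f2 f1 = - br f1 f2" "br f3 f1 = - br f1 f3" "br f3 f2 = - br f2 f3"
    using anti by blast+
  consider "h \<noteq> 0" | "h = 0" "e \<noteq> 0" | "h = 0" "e = 0" by blast
  then show thesis
  proof cases
    case 1
    show thesis
    \<comment> \<open>Multiples of f3 push f1 and f2 into the kernel, and f3 becomes b1. The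
      component a of [f1, f2] along f3 then plays the role of p, and q is 0; in the other two cases
      it is p that is 0.\<close>
    proof (rule that[of f3 "f1 - (d / h) *\<^sub>R f3" "f2 - (e / h) *\<^sub>R f3" f5 f4
        0 "- b13" "- a13" "- b23" "- a23" a "c - (e / h) * b13 + (d / h) * b23" "b - (e / h) * a13 + (d / h) * a23" h])
      fix c1 c2 c3 c4 c5
      assume "c1 *\<^sub>R f3 + c2 *\<^sub>R (f1 - (d / h) *\<^sub>R f3) + c3 *\<^sub>R (f2 - (e / h) *\<^sub>R f3) + c4 *\<^sub>R f5 + c5 *\<^sub>R f4 = 0"
      then have "c2 *\<^sub>R f1 + c3 *\<^sub>R f2 + (c1 - c2 * (d / h) - c3 * (e / h)) *\<^sub>R f3 + c5 *\<^sub>R f4 + c4 *\<^sub>R f5 = 0"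
        by (simp add: algebra_simps)
      from ind[OF this] show "c1 = 0 \<and> c2 = 0 \<and> c3 = 0 \<and> c4 = 0 \<and> c5 = 0" by auto
    qed (simp_all only: ll lr swap self f2 f3 f4 F(1), use 1 in \<open>simp_all add: algebra_simps\<close>)
  next
    case 2
    show thesis
    \<comment> \<open>Now f2 is b1 and f1 is corrected to b2, so [b1, b2] = -[f1, f2]; hence the
      signs of q, s1 and r1.\<close>
    proof (rule that[of f2 "f1 - (d / e) *\<^sub>R f2" f3 f5 f4
        "- a" "- c" "- b" b23 a23 0 "b13 - (d / e) * b23" "a13 - (d / e) * a23" e])
      fix c1 c2 c3 c4 c5
      assume "c1 *\<^sub>R f2 + c2 *\<^sub>R (f1 - (d / e) *\<^sub>R f2) + c3 *\<^sub>R f3 + c4 *\<^sub>R f5 + c5 *\<^sub>R f4 = 0"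
      then have "c2 *\<^sub>R f1 + (c1 - c2 * (d / e)) *\<^sub>R f2 + c3 *\<^sub>R f3 + c5 *\<^sub>R f4 + c4 *\<^sub>R f5 = 0"
        by (simp add: algebra_simps)
      from ind[OF this] show "c1 = 0 \<and> c2 = 0 \<and> c3 = 0 \<and> c4 = 0 \<and> c5 = 0" by auto
    qed (simp_all only: ll lr swap self f2 f3 f4 F(1), use 2 in \<open>simp_all add: algebra_simps\<close>)
  next
    case 3
    show thesis
    proof (rule that[of f1 f2 f3 f5 f4 a c b b13 a13 0 b23 a23 d])
      fix c1 c2 c3 c4 c5
      assume "c1 *\<^sub>R f1 + c2 *\<^sub>R f2 + c3 *\<^sub>R f3 + c4 *\<^sub>R f5 + c5 *\<^sub>R f4 = 0"
      then have "c1 *\<^sub>R f1 + c2 *\<^sub>R f2 + c3 *\<^sub>R f3 + c5 *\<^sub>R f4 + c4 *\<^sub>R f5 = 0" by (simp only: add.assoc add.commute[of "c5 *\<^sub>R f4"])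
      from ind[OF this] show "c1 = 0 \<and> c2 = 0 \<and> c3 = 0 \<and> c4 = 0 \<and> c5 = 0" by auto
    qed (simp_all only: f2 f3 f4 F(1) 3, simp_all only: scaleR_zero_left add.assoc add.commute[of "b *\<^sub>R f4"] add.commute[of "a13 *\<^sub>R f4"] add.commute[of "a23 *\<^sub>R f4"] add_0)
  qed
qed

text \<open>The 2-form e^i \<and> e^j.\<close>

definition plane_minor :: "5 \<Rightarrow> 5 \<Rightarrow> real^5 \<Rightarrow> real^5 \<Rightarrow> real" where
  "plane_minor i j X Y = X $ i * Y $ j - X $ j * Y $ i"

text \<open>These are the structure equations: component k of br is -de^k. Apart from s4 e^15 only
  e^12, e^13 and e^23 occur, and de^2 = 0; this is what forces repeated indices in the closedness
  computations.\<close>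

definition adapted_bracket :: "(real^5 \<Rightarrow> real^5 \<Rightarrow> real^5) \<Rightarrow> bool" where
  "adapted_bracket br \<longleftrightarrow> (\<exists>p q r1 r2 r3 s1 s2 s3 s4. \<forall>X Y.
     br X Y $ 1 = p * plane_minor 2 3 X Y \<and> br X Y $ 2 = 0 \<and> br X Y $ 3 = q * plane_minor 1 2 X Y \<and>
     br X Y $ 4 = s1 * plane_minor 1 2 X Y + s2 * plane_minor 1 3 X Y + s3 * plane_minor 2 3 X Y + s4 * plane_minor 1 5 X Y \<and>
     br X Y $ 5 = r1 * plane_minor 1 2 X Y + r2 * plane_minor 1 3 X Y + r3 * plane_minor 2 3 X Y)"

text \<open>M rebuilds a vector from its coordinates in the adapted basis, and L is its inverse. In
  the bracket of two such combinations only four minors survive, since b4 is central and b5 commutes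
  with b2 and b3.\<close>

lemma nilpotent_adapted_coordinates:
  fixes br :: "real^5 \<Rightarrow> real^5 \<Rightarrow> real^5"
  assumes lin: "\<And>u. linear (br u)" and anti: "\<And>u v. br u v = - br v u"
    and nil: "\<And>us v. length us = N \<Longrightarrow> foldr br us v = 0"
  obtains L L' where "linear L" "surj L" "\<And>x. L' (L x) = x" "adapted_bracket (\<lambda>u v. L (br (L' u) (L' v)))"
proof (rule nilpotent_adapted_basis[OF lin anti nil])
  fix b1 b2 b3 b4 b5 p q r1 r2 r3 s1 s2 s3 s4
  assume
    ind: "\<And>c1 c2 c3 c4 c5. c1 *\<^sub>R b1 + c2 *\<^sub>R b2 + c3 *\<^sub>R b3 + c4 *\<^sub>R b4 + c5 *\<^sub>R b5 = 0 \<Longrightarrow>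
      c1 = 0 \<and> c2 = 0 \<and> c3 = 0 \<and> c4 = 0 \<and> c5 = 0" and
    b: "br b1 b2 = q *\<^sub>R b3 + s1 *\<^sub>R b4 + r1 *\<^sub>R b5" "br b1 b3 = s2 *\<^sub>R b4 + r2 *\<^sub>R b5"
    "br b2 b3 = p *\<^sub>R b1 + s3 *\<^sub>R b4 + r3 *\<^sub>R b5"
    "\<And>u. br u b4 = 0" "br b1 b5 = s4 *\<^sub>R b4" "br b2 b5 = 0" "br b3 b5 = 0"
  define M :: "real^5 \<Rightarrow> real^5" where
    "M X = X $ 1 *\<^sub>R b1 + X $ 2 *\<^sub>R b2 + X $ 3 *\<^sub>R b3 + X $ 4 *\<^sub>R b4 + X $ 5 *\<^sub>R b5" for X
  have M: "linear M" by (rule linearI) (simp_all add: M_def algebra_simps)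
  have injM: "inj M"
    unfolding linear_injective_0[OF M]
  proof (intro allI impI)
    fix x assume "M x = 0"
    from ind[OF this[unfolded M_def]] show "x = 0" by (simp add: vec_eq_iff forall_5)
  qed
  have surjM: "surj M" using linear_injective_imp_surjective[OF M injM] by simp
  define L where "L = inv_into UNIV M"
  have L_M: "L (M x) = x" and M_L: "M (L x) = x" for x
    using injM surjM by (simp_all add: L_def surj_f_inv_f)
  have L: "linear L"
  proof (rule linearI)
    show "L (x + y) = L x + L y" for x y using L_M M_L linear_add[OF M] by metis
    show "L (r *\<^sub>R x) = r *\<^sub>R L x" for r x using L_M M_L linear_scale[OF M] by metis
  qed
  have self: "br u u = 0" for u by (rule antisymmetric_self[OF anti])
  note lr = linear_add[OF lin] linear_scale[OF lin]
  have ll: "br (u + w) v = br u v + br w v" "br (r *\<^sub>R u) v = r *\<^sub>R br u v" for u v w r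
    using anti[of "u + w" v] anti[of "r *\<^sub>R u" v] anti[of u v] anti[of w v] by (simp_all add: lr)
  have b': "br b2 b1 = - br b1 b2" "br b3 b1 = - br b1 b3" "br b3 b2 = - br b2 b3"
    "br b5 b1 = - br b1 b5" "br b5 b2 = 0" "br b5 b3 = 0" "br b4 u = 0" for u
    using anti[of b2 b1] anti[of b3 b1] anti[of b3 b2] anti[of b5 b1] anti[of b5 b2] anti[of b5 b3] anti[of b4 u] b
    by simp_all
  define Z :: "real^5 \<Rightarrow> real^5 \<Rightarrow> real^5" where
    "Z X Y = (\<chi> i. if i = 1 then p * plane_minor 2 3 X Y else if i = 2 then 0 else
      if i = 3 then q * plane_minor 1 2 X Y else
      if i = 4 then s1 * plane_minor 1 2 X Y + s2 * plane_minor 1 3 X Y + s3 * plane_minor 2 3 X Y + s4 * plane_minor 1 5 X Y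
      else r1 * plane_minor 1 2 X Y + r2 * plane_minor 1 3 X Y + r3 * plane_minor 2 3 X Y)" for X Y
  have Z: "Z X Y $ 1 = p * plane_minor 2 3 X Y" "Z X Y $ 2 = 0" "Z X Y $ 3 = q * plane_minor 1 2 X Y"
     "Z X Y $ 4 = s1 * plane_minor 1 2 X Y + s2 * plane_minor 1 3 X Y + s3 * plane_minor 2 3 X Y + s4 * plane_minor 1 5 X Y"
     "Z X Y $ 5 = r1 * plane_minor 1 2 X Y + r2 * plane_minor 1 3 X Y + r3 * plane_minor 2 3 X Y" for X Y
    by (simp_all add: Z_def)
  have "br (M X) (M Y) = M (Z X Y)" for X Y
  proof -
    have "br (M X) (M Y) =
      plane_minor 1 2 X Y *\<^sub>R br b1 b2 + plane_minor 1 3 X Y *\<^sub>R br b1 b3 + plane_minor 2 3 X Y *\<^sub>R br b2 b3 +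
      plane_minor 1 5 X Y *\<^sub>R br b1 b5"
      unfolding M_def lr ll by (simp add: b(4,6,7) b' self plane_minor_def algebra_simps)
    also have "\<dots> = M (Z X Y)"
      unfolding b M_def Z by (simp add: algebra_simps)
    finally show ?thesis .
  qed
  then have brZ: "L (br (M X) (M Y)) = Z X Y" for X Y by (simp add: L_M)
  have "adapted_bracket (\<lambda>u v. L (br (M u) (M v)))"
    unfolding adapted_bracket_def brZ
    by (rule exI[of _ p], rule exI[of _ q], rule exI[of _ r1], rule exI[of _ r2], rule exI[of _ r3],
        rule exI[of _ s1], rule exI[of _ s2], rule exI[of _ s3], rule exI[of _ s4]) (intro allI conjI Z)
  moreover have "surj L" using L_M by (metis surjI)
  ultimately show thesis using that[OF L _ M_L] by blast
qed

lemma adapted_frame_exists: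
  fixes A :: "('g::topological_space, real^5) atlas"
  assumes G: "lie_group G A" and nil: "nilpotent_group G"
  obtains \<theta> br where "invariant_frame G A \<theta> br" "adapted_bracket br"
proof -
  interpret group G using lie_group_group[OF G] .
  obtain U \<phi> where U: "(U, \<phi>) \<in> A" "\<one>\<^bsub>G\<^esub> \<in> U" using lie_group_chart_exists[OF G one_closed] .
  interpret C: lie_group_chart G A U \<phi> by unfold_locales (fact G U)+
  obtain N where N: "lower_central_series G N = {\<one>\<^bsub>G\<^esub>}" using nil by (auto simp: nilpotent_group_def)
  show thesis
  proof (rule nilpotent_adapted_coordinates[OF C.bracket_linear C.bracket_antisym C.bracket_nilpotent[OF N]])
    fix L L'
    assume L: "linear L" "surj L" "\<And>x. L' (L x) = x" "adapted_bracket (\<lambda>u v. L (C.bracket (L' u) (L' v)))"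
    show thesis
      using that[OF invariant_frame.linear_change[OF C.mc_frame L(1-3)] L(4)] .
  qed
qed

subsection \<open>Wedge products of low degree\<close>

lemma lessThan_numeral_nat:
  "{..<3::nat} = {0, 1, 2}" "{..<4::nat} = {0, 1, 2, 3}"
  by auto

text \<open>With F abstract the permutation sum is expanded once, and the wedge products only
  instantiate it.\<close>

lemma sum_permutations_3:
  "(\<Sum>p | p permutes {..<3::nat}. of_int (sign p) * F (p 0) (p 1) (p 2)) =
   F 0 1 2 - F 0 2 1 - F 1 0 2 + F 1 2 0 + F 2 0 1 - (F 2 1 0 :: real)"
proof -
  have f: "finite {1, 2 :: nat}" "0 \<notin> {1, 2 :: nat}" "finite {2 :: nat}" "1 \<notin> {2 :: nat}" by auto
  show ?thesis
    unfolding lessThan_numeral_nat sum_over_permutations_insert[OF f(1,2)] sum_over_permutations_insert[OF f(3,4)] permutes_sing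
    by (simp add: sign_swap_id permutation_swap_id sign_compose sign_id transpose_def)
qed

lemma sum_permutations_4:
  "(\<Sum>p | p permutes {..<4::nat}. of_int (sign p) * F (p 0) (p 1) (p 2) (p 3)) =
   F 0 1 2 3 - F 0 1 3 2 - F 0 2 1 3 + F 0 2 3 1 + F 0 3 1 2 - F 0 3 2 1
   - F 1 0 2 3 + F 1 0 3 2 + F 1 2 0 3 - F 1 2 3 0 - F 1 3 0 2 + F 1 3 2 0
   + F 2 0 1 3 - F 2 0 3 1 - F 2 1 0 3 + F 2 1 3 0 + F 2 3 0 1 - F 2 3 1 0
   - F 3 0 1 2 + F 3 0 2 1 + F 3 1 0 2 - F 3 1 2 0 - F 3 2 0 1 + (F 3 2 1 0 :: real)"
proof -
  have f: "finite {1, 2, 3 :: nat}" "0 \<notin> {1, 2, 3 :: nat}" "finite {2, 3 :: nat}" "1 \<notin> {2, 3 :: nat}"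
    "finite {3 :: nat}" "2 \<notin> {3 :: nat}" by auto
  show ?thesis
    unfolding lessThan_numeral_nat sum_over_permutations_insert[OF f(1,2)] sum_over_permutations_insert[OF f(3,4)]
      sum_over_permutations_insert[OF f(5,6)] permutes_sing
    by (simp add: sign_swap_id permutation_swap_id permutation_compose sign_compose sign_id transpose_def)
qed

lemma upt_numerals:
  "[0..<1::nat] = [0]" "[0..<2::nat] = [0, 1]" "[0..<4::nat] = [0, 1, 2, 3]"
  "[2..<2 + 1::nat] = [2]" "[2..<2 + 2::nat] = [2, 3]" "[4..<4 + 1::nat] = [4]"
  by (simp_all add: upt_rec)

lemma wedge_2_1:
  assumes "\<And>u v. a [u, v] = - a [v, u]"
  shows "wedge 2 1 a b [x, y, z] = a [x, y] * b [z] - a [x, z] * b [y] + a [y, z] * b [x]"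
proof -
  have w: "wedge 2 1 a b [x, y, z] = (\<Sum>p | p permutes {..<3}. of_int (sign p) *
      (a [[x, y, z] ! p 0, [x, y, z] ! p 1] * b [[x, y, z] ! p 2])) / 2"
    by (simp add: wedge_def upt_numerals mult.assoc)
  show ?thesis
    using assms[of y x] assms[of z x] assms[of z y]
    unfolding w sum_permutations_3[of "\<lambda>i j k. a [[x, y, z] ! i, [x, y, z] ! j] * b [[x, y, z] ! k]"]
    by simp
qed

lemma wedge_2_2:
  assumes a: "\<And>u v. a [u, v] = - a [v, u]" and b: "\<And>u v. b [u, v] = - b [v, u]"
  shows "wedge 2 2 a b [x, y, z, w] =
    a [x, y] * b [z, w] - a [x, z] * b [y, w] + a [x, w] * b [y, z] +
    a [y, z] * b [x, w] - a [y, w] * b [x, z] + a [z, w] * b [x, y]"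
proof -
  let ?v = "\<lambda>i. [x, y, z, w] ! i"
  have eq: "wedge 2 2 a b [x, y, z, w] = (\<Sum>p | p permutes {..<4}. of_int (sign p) *
      (a [?v (p 0), ?v (p 1)] * b [?v (p 2), ?v (p 3)])) / 4"
    by (simp add: wedge_def upt_numerals mult.assoc)
  show ?thesis
    using a[of y x] a[of z x] a[of w x] a[of z y] a[of w y] a[of w z]
      b[of y x] b[of z x] b[of w x] b[of z y] b[of w y] b[of w z]
    unfolding eq sum_permutations_4[of "\<lambda>i j k l. a [?v i, ?v j] * b [?v k, ?v l]"]
    by simp
qed

text \<open>Only permutations fixing \<open>4\<close> contribute when \<open>b\<close> vanishes on the first four vectors.\<close>

lemma wedge_4_1:
  assumes b: "b [x] = 0" "b [y] = 0" "b [z] = 0" "b [w] = 0"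
  shows "wedge 4 1 a b [x, y, z, w, t] =
    (\<Sum>p | p permutes {..<4}. of_int (sign p) *
      a [[x, y, z, w] ! p 0, [x, y, z, w] ! p 1, [x, y, z, w] ! p 2, [x, y, z, w] ! p 3]) * b [t] / 24"
proof -
  let ?v = "\<lambda>i. [x, y, z, w, t] ! i"
  let ?f = "\<lambda>p. of_int (sign p) * a [?v (p 0), ?v (p 1), ?v (p 2), ?v (p 3)] * b [?v (p 4)]"
  have "wedge 4 1 a b [x, y, z, w, t] = (\<Sum>p | p permutes {..<5}. ?f p) / 24"
    by (simp add: wedge_def upt_numerals fact_numeral)
  also have "(\<Sum>p | p permutes {..<5}. ?f p) = (\<Sum>p | p permutes {..<4}. ?f p)"
  proof (rule sum.mono_neutral_right)
    show "finite {p. p permutes {..<5::nat}}" by (simp add: finite_permutations)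
    show "{p. p permutes {..<4}} \<subseteq> {p. p permutes {..<5::nat}}" 
      by (intro subsetI CollectI, elim CollectE) (rule permutes_subset[of _ "{..<4}"], simp_all)
    show "\<forall>p\<in>{p. p permutes {..<5}} - {p. p permutes {..<4}}. ?f p = 0"
    proof
      fix p assume p: "p \<in> {p. p permutes {..<5}} - {p. p permutes {..<4::nat}}"
      have "p 4 \<noteq> 4"
      proof
        assume "p 4 = 4"
        have "p permutes {..<4}"
        proof (rule permutes_superset[of p "{..<5}"])
          show "p permutes {..<5}" using p by blast
          fix x :: nat assume "x \<in> {..<5} - {..<4}"
          then have "x = 4" by simp
          then show "p x = x" using \<open>p 4 = 4\<close> by simp
        qed
        then show False using p by blast
      qed
      moreover have "p 4 < 5" using p permutes_in_image[of p "{..<5}" 4] by auto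
      ultimately have "p 4 \<in> {0, 1, 2, 3}" by auto
      then show "?f p = 0" using b by auto
    qed
  qed
  also have "\<dots> = (\<Sum>p | p permutes {..<4}. of_int (sign p) *
      a [[x, y, z, w] ! p 0, [x, y, z, w] ! p 1, [x, y, z, w] ! p 2, [x, y, z, w] ! p 3] * b [t])"
  proof (rule sum.cong)
    fix p assume "p \<in> {p. p permutes {..<4::nat}}"
    then have p: "p permutes {..<4}" by simp
    have "p 4 = 4" using permutes_not_in[OF p, of 4] by simp
    moreover have "?v (p i) = [x, y, z, w] ! p i" if "i < 4" for i
    proof -
      have "p i < 4" using permutes_in_image[OF p, of i] that by simp
      then have "p i \<in> {0, 1, 2, 3}" by auto
      then show ?thesis by auto
    qed
    ultimately show "?f p = of_int (sign p) *
      a [[x, y, z, w] ! p 0, [x, y, z, w] ! p 1, [x, y, z, w] ! p 2, [x, y, z, w] ! p 3] * b [t]"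
      by simp
  qed simp
  finally show ?thesis by (simp add: sum_distrib_right)
qed

text \<open>Wedge products of forms pulled back along a coframe can thus be computed on constant
  forms of the model space.\<close>

lemma wedge_map:
  assumes "length vs = k + l"
  shows "wedge k l (\<lambda>vs. a (map L vs)) (\<lambda>vs. b (map L vs)) vs = wedge k l a b (map L vs)"
proof -
  have m: "map L (map (\<lambda>i. vs ! p i) I) = map (\<lambda>i. map L vs ! p i) I"
    if "p permutes {..<k + l}" "set I \<subseteq> {..<k + l}" for p I
    using that permutes_in_image[OF that(1)] assms by auto
  show ?thesis
    unfolding wedge_def
  proof (intro arg_cong2[of _ _ _ _ "(/)"] sum.cong refl)
    fix p assume "p \<in> {p. p permutes {..<k + l}}"
    then have p: "p permutes {..<k + l}" by simp
    have "set [0..<k] \<subseteq> {..<k + l}" "set [k..<k + l] \<subseteq> {..<k + l}" by auto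
    from m[OF p this(1)] m[OF p this(2)]
    show "of_int (sign p) * a (map L (map (\<lambda>i. vs ! p i) [0..<k])) * b (map L (map (\<lambda>i. vs ! p i) [k..<k + l])) =
        of_int (sign p) * a (map (\<lambda>i. map L vs ! p i) [0..<k]) * b (map (\<lambda>i. map L vs ! p i) [k..<k + l])"
      by (simp only:)
  qed
qed

subsection \<open>Forms with constant coefficients in an invariant frame\<close>

text \<open>The part of \<open>alternating\<close> on which differentiation rests. The inductions
  over k freeze the first argument.\<close>

definition multilinear :: "nat \<Rightarrow> ('e::real_vector list \<Rightarrow> real) \<Rightarrow> bool" where
  "multilinear k a \<longleftrightarrow> (\<forall>vs i. length vs = k \<and> i < k \<longrightarrow> linear (\<lambda>v. a (vs[i := v])))"

lemma multilinear_Cons: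
  assumes "multilinear (Suc k) a"
  shows "multilinear k (\<lambda>vs. a (b # vs))"
  unfolding multilinear_def
proof (intro allI impI)
  fix vs :: "'a list" and i assume "length vs = k \<and> i < k"
  then have "linear (\<lambda>v. a ((b # vs)[Suc i := v]))"
    using assms by (simp add: multilinear_def del: list_update.simps)
  then show "linear (\<lambda>v. a (b # vs[i := v]))" by simp
qed

lemma smooth_at_multilinear:
  fixes a :: "'e::euclidean_space list \<Rightarrow> real"
  assumes "multilinear k a" "length ws = k" "\<And>w. w \<in> set ws \<Longrightarrow> smooth_at x w"
  shows "smooth_at x (\<lambda>y. a (map (\<lambda>w. w y) ws))"
  using assms
proof (induction k arbitrary: a ws)
  case 0
  then show ?case by (simp add: smooth_at_const)
next
  case (Suc k)
  then obtain w ws' where ws: "ws = w # ws'" "length ws' = k" by (metis length_Suc_conv)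
  have m: "multilinear k (\<lambda>vs. a (b # vs))" for b
    using Suc.prems(1) by (rule multilinear_Cons)
  have l: "linear (\<lambda>v. a (v # map (\<lambda>w. w y) ws'))" for y
    using Suc.prems(1)[unfolded multilinear_def, rule_format, of "0 # map (\<lambda>w. w y) ws'" 0] ws(2) by simp
  have "smooth_at x (\<lambda>y. a (w y # map (\<lambda>w. w y) ws'))"
    by (rule smooth_at_linear_apply[of "\<lambda>y v. a (v # map (\<lambda>w. w y) ws')"])
      (use l Suc.IH[OF m ws(2)] Suc.prems(3) ws in auto)
  then show ?case by (simp add: ws)
qed

lemma alternating_map:
  assumes L: "linear L" and a: "alternating k a"
  shows "alternating k (\<lambda>vs. a (map L vs))"
  unfolding alternating_def
proof (intro conjI allI impI)
  fix vs :: "'a list" and i assume "length vs = k \<and> i < k"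
  then have "linear (\<lambda>v. a ((map L vs)[i := v]))" using a by (simp add: alternating_def)
  from linear_compose[OF L this] show "linear (\<lambda>v. a (map L (vs[i := v])))" by (simp add: comp_def map_update)
next
  fix vs :: "'a list" assume "length vs = k \<and> \<not> distinct vs"
  then show "a (map L vs) = 0" using a by (auto simp: alternating_def distinct_map)
qed

context invariant_frame
begin

text \<open>The pullback of a constant form by the coframe, so that all dependence on the point sits
  in \<theta>.\<close>

definition frame_form :: "('e list \<Rightarrow> real) \<Rightarrow> ('g, 'e) form" where
  "frame_form a c x vs = a (map (\<theta> c x) vs)"

lemma frame_form_left_invariant: "left_invariant G A k (frame_form a)"
proof -
  have "frame_form a (U, \<phi>) (\<phi> p) vs = frame_form a (V, \<psi>) (\<psi> (h \<otimes> p))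
      (map (frechet_derivative (\<psi> \<circ> (\<otimes>) h \<circ> inv_into U \<phi>) (at (\<phi> p))) vs)"
    if "(U, \<phi>) \<in> A" "(V, \<psi>) \<in> A" "h \<in> carrier G" "p \<in> U" "h \<otimes> p \<in> V" for U \<phi> V \<psi> h p vs
    by (auto simp: frame_form_def comp_def intro!: arg_cong[of _ _ a] frame_invariant[OF that])
  then show ?thesis unfolding left_invariant_def is_pullback_def by blast
qed

lemma frame_form_diff_form:
  assumes a: "alternating k a"
  shows "diff_form A k (frame_form a)"
proof -
  interpret group G using lie_group_group[OF G] .
  have alt: "alternating k (frame_form a (U, \<phi>) x)" if "(U, \<phi>) \<in> A" "x \<in> \<phi> ` U" for U \<phi> x
    unfolding frame_form_def[abs_def] by (rule alternating_map[OF frame_linear[OF that] a])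
  have ml: "multilinear k a" using a by (simp add: multilinear_def alternating_def)
  have sm: "smooth_on (\<phi> ` U) (\<lambda>x. frame_form a (U, \<phi>) x vs)" if U: "(U, \<phi>) \<in> A" "length vs = k" for U \<phi> vs
  proof (rule smooth_at_imp_smooth_on)
    fix x assume x: "x \<in> \<phi> ` U"
    have "smooth_at x (\<lambda>y. a (map (\<lambda>w. w y) (map (\<lambda>v y. \<theta> (U, \<phi>) y v) vs)))"
      by (rule smooth_at_multilinear[OF ml]) (use U frame_smooth[OF U(1) x] in auto)
    then show "smooth_at x (\<lambda>x. frame_form a (U, \<phi>) x vs)"
      by (simp add: frame_form_def comp_def)
  qed
  have "frame_form a (U, \<phi>) (\<phi> p) vs = frame_form a (V, \<psi>) (\<psi> p)
      (map (frechet_derivative (\<psi> \<circ> (\<lambda>p. p) \<circ> inv_into U \<phi>) (at (\<phi> p))) vs)"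
    if UV: "(U, \<phi>) \<in> A" "(V, \<psi>) \<in> A" "p \<in> U" "p \<in> V" for U \<phi> V \<psi> p vs
  proof -
    \<comment> \<open>A change of charts is translation by the identity element, so the
      transformation rule is a special case of \<open>frame_invariant\<close>.\<close>
    have p1: "\<one> \<otimes> p = p" using chart_subset[OF G UV(1,3)] by simp
    have "\<forall>\<^sub>F y in nhds (\<phi> p). (\<psi> \<circ> (\<lambda>p. p) \<circ> inv_into U \<phi>) y = \<psi> (\<one> \<otimes> inv_into U \<phi> y)"
      using chart_eventually_in[OF G UV(1) chart_openin[OF G UV(1)] UV(3,3)]
      by eventually_elim (use chart_subset[OF G UV(1)] in simp)
    then have "frechet_derivative (\<psi> \<circ> (\<lambda>p. p) \<circ> inv_into U \<phi>) (at (\<phi> p)) =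
        frechet_derivative (\<lambda>x. \<psi> (\<one> \<otimes> inv_into U \<phi> x)) (at (\<phi> p))"
      by (rule frechet_derivative_eventually_cong)
    then have "\<theta> (U, \<phi>) (\<phi> p) v = \<theta> (V, \<psi>) (\<psi> p) (frechet_derivative (\<psi> \<circ> (\<lambda>p. p) \<circ> inv_into U \<phi>) (at (\<phi> p)) v)" for v
      using frame_invariant[OF UV(1,2) one_closed UV(3), of v] UV(4) by (simp only: p1)
    then show ?thesis
      unfolding frame_form_def map_map by (intro arg_cong[of _ _ a] map_cong) (simp_all only: o_apply)
  qed
  then have "is_pullback A A (\<lambda>p. p) k (frame_form a) (frame_form a)"
    unfolding is_pullback_def by blast
  moreover have "\<forall>c\<in>A. case c of (U, \<phi>) \<Rightarrow> (\<forall>x\<in>\<phi> ` U. alternating k (frame_form a (U, \<phi>) x)) \<and>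
      (\<forall>vs. length vs = k \<longrightarrow> smooth_on (\<phi> ` U) (\<lambda>x. frame_form a (U, \<phi>) x vs))"
    by (clarify, intro conjI ballI allI impI alt sm)
  ultimately show ?thesis unfolding diff_form_def by blast
qed

lemma frame_form_wedge:
  assumes "length vs = k + l"
  shows "form_wedge k l (frame_form a) (frame_form b) c x vs = wedge k l a b (map (\<theta> c x) vs)"
  unfolding form_wedge_def frame_form_def[abs_def] by (rule wedge_map[OF assms])

lemma frame_preimage:
  assumes "(U, \<phi>) \<in> A" "x \<in> \<phi> ` U"
  obtains v where "\<theta> (U, \<phi>) x v = w"
  using frame_surj[OF assms] by (metis surjD)

end

section \<open>The exterior derivative in an invariant coframe\<close>

lemma frechet_derivative_multilinear:
  fixes a :: "'e::euclidean_space list \<Rightarrow> real"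
  assumes "multilinear k a" "length ws = k" "\<And>w. w \<in> set ws \<Longrightarrow> smooth_at x w"
  shows "frechet_derivative (\<lambda>y. a (map (\<lambda>w. w y) ws)) (at x) u =
    (\<Sum>j<k. a ((map (\<lambda>w. w x) ws)[j := frechet_derivative (ws ! j) (at x) u]))"
  using assms
proof (induction k arbitrary: a ws)
  case 0
  then show ?case by simp
next
  case (Suc k)
  then obtain w ws' where ws: "ws = w # ws'" "length ws' = k" by (metis length_Suc_conv)
  have m: "multilinear k (\<lambda>vs. a (b # vs))" for b
    using Suc.prems(1) by (rule multilinear_Cons)
  have l: "linear (\<lambda>v. a (v # map (\<lambda>w. w y) ws'))" for y
    using Suc.prems(1)[unfolded multilinear_def, rule_format, of "0 # map (\<lambda>w. w y) ws'" 0] ws(2) by simp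
  have s: "smooth_at x (\<lambda>y. a (b # map (\<lambda>w. w y) ws'))" for b
    using smooth_at_multilinear[OF m ws(2)] Suc.prems(3) ws by simp
  have "frechet_derivative (\<lambda>y. a (w y # map (\<lambda>w. w y) ws')) (at x) u =
      frechet_derivative (\<lambda>y. a (w x # map (\<lambda>w. w y) ws')) (at x) u +
      a (frechet_derivative w (at x) u # map (\<lambda>w. w x) ws')"
    by (rule frechet_derivative_linear_apply[where p = x and T = "\<lambda>y v. a (v # map (\<lambda>w. w y) ws')" and w = w])
      (use l s Suc.prems(3) ws in auto)
  also have "frechet_derivative (\<lambda>y. a (w x # map (\<lambda>w. w y) ws')) (at x) u =
      (\<Sum>j<k. a (w x # (map (\<lambda>w. w x) ws')[j := frechet_derivative (ws' ! j) (at x) u]))"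
    by (rule Suc.IH[OF m ws(2)]) (use Suc.prems(3) ws in auto)
  finally show ?case by (simp add: ws sum.lessThan_Suc_shift del: sum.lessThan_Suc)
qed

text \<open>Both a and the vectors vs are constant in the chart, so every derivative falls on
  \<theta>; the bracket enters only through the structure equation.\<close>

lemma (in invariant_frame) ext_deriv_frame_form:
  assumes a: "alternating k a" and U: "(U, \<phi>) \<in> A" and x: "x \<in> \<phi> ` U" and vs: "length vs = Suc k"
  shows "ext_deriv k (frame_form a) (U, \<phi>) x vs = (\<Sum>i\<le>k. (-1) ^ i * (\<Sum>j<k.
    a ((map (\<theta> (U, \<phi>) x) (take i vs @ drop (Suc i) vs))
      [j := frechet_derivative (\<lambda>y. \<theta> (U, \<phi>) y ((take i vs @ drop (Suc i) vs) ! j)) (at x) (vs ! i)])))"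
proof -
  have ml: "multilinear k a" using a by (simp add: multilinear_def alternating_def)
  have "frechet_derivative (\<lambda>y. frame_form a (U, \<phi>) y ws) (at x) u =
    (\<Sum>j<k. a ((map (\<theta> (U, \<phi>) x) ws)[j := frechet_derivative (\<lambda>y. \<theta> (U, \<phi>) y (ws ! j)) (at x) u]))"
    if "length ws = k" for ws u
  proof -
    have "frechet_derivative (\<lambda>y. a (map (\<lambda>w. w y) (map (\<lambda>v y. \<theta> (U, \<phi>) y v) ws))) (at x) u =
      (\<Sum>j<k. a ((map (\<lambda>w. w x) (map (\<lambda>v y. \<theta> (U, \<phi>) y v) ws))
        [j := frechet_derivative (map (\<lambda>v y. \<theta> (U, \<phi>) y v) ws ! j) (at x) u]))"
      by (rule frechet_derivative_multilinear[OF ml]) (use that frame_smooth[OF U x] in auto)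
    then show ?thesis using that by (simp add: frame_form_def comp_def)
  qed
  then show ?thesis unfolding ext_deriv_def using vs by (intro sum.cong refl) simp
qed

text \<open>In the application \<open>w i\<close> is \<theta> v_i and \<open>t i j\<close> is the
  derivative of \<theta> v_j along v_i. The terms with \<open>t i j\<close> and \<open>t j i\<close>
  pair off into \<open>b i j\<close> = [w_i, w_j], which gives the Chevalley-Eilenberg differential,
  the sum over i < j of (-1)^(i+j) P([w_i, w_j], ...).\<close>

lemma alternating_cancel_3:
  fixes P :: "'v::real_vector \<Rightarrow> 'v \<Rightarrow> 'v \<Rightarrow> real"
  assumes P: "\<And>x y z. P y x z = - P x y z" "\<And>x y z. P y z x = P x y z"
    and lin: "\<And>x x' y z. P (x - x') y z = P x y z - P x' y z"
    and t: "\<And>i j. t i j - t j i = - b i j"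
  shows "P (t 0 1) (w 2) (w 3) + P (w 1) (t 0 2) (w 3) + P (w 1) (w 2) (t 0 3)
    - (P (t 1 0) (w 2) (w 3) + P (w 0) (t 1 2) (w 3) + P (w 0) (w 2) (t 1 3))
    + (P (t 2 0) (w 1) (w 3) + P (w 0) (t 2 1) (w 3) + P (w 0) (w 1) (t 2 3))
    - (P (t 3 0) (w 1) (w 2) + P (w 0) (t 3 1) (w 2) + P (w 0) (w 1) (t 3 (2::nat)))
   = - (P (b 0 1) (w 2) (w 3) - P (b 0 2) (w 1) (w 3) + P (b 0 3) (w 1) (w 2)
      + P (b 1 2) (w 0) (w 3) - P (b 1 3) (w 0) (w 2) + P (b 2 3) (w 0) (w (1::nat)))"
proof -
  have "b i j = t j i - t i j" for i j using t[of i j] by (metis minus_diff_eq minus_minus)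
  then have b: "P (b i j) y z = P (t j i) y z - P (t i j) y z" for i j y z using lin by simp
  have "P (w k) (t i j) z = - P (t i j) (w k) z" "P (w k) (w l) (t i j) = P (t i j) (w k) (w l)" for i j k l z
    using P by blast+
  then show ?thesis by (simp add: b)
qed

text \<open>The same pairing for a 4-form on five vectors.\<close>

lemma alternating_cancel_4:
  fixes P :: "'v::real_vector \<Rightarrow> 'v \<Rightarrow> 'v \<Rightarrow> 'v \<Rightarrow> real"
  assumes P: "\<And>x y z u. P y x z u = - P x y z u" "\<And>x y z u. P y z x u = P x y z u" "\<And>x y z u. P y z u x = - P x y z u"
    and lin: "\<And>x x' y z u. P (x - x') y z u = P x y z u - P x' y z u"
    and t: "\<And>i j. t i j - t j i = - b i j"
  shows "P (t 0 1) (w 2) (w 3) (w 4) + P (w 1) (t 0 2) (w 3) (w 4) + P (w 1) (w 2) (t 0 3) (w 4) + P (w 1) (w 2) (w 3) (t 0 4)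
    - (P (t 1 0) (w 2) (w 3) (w 4) + P (w 0) (t 1 2) (w 3) (w 4) + P (w 0) (w 2) (t 1 3) (w 4) + P (w 0) (w 2) (w 3) (t 1 4))
    + (P (t 2 0) (w 1) (w 3) (w 4) + P (w 0) (t 2 1) (w 3) (w 4) + P (w 0) (w 1) (t 2 3) (w 4) + P (w 0) (w 1) (w 3) (t 2 4))
    - (P (t 3 0) (w 1) (w 2) (w 4) + P (w 0) (t 3 1) (w 2) (w 4) + P (w 0) (w 1) (t 3 2) (w 4) + P (w 0) (w 1) (w 2) (t 3 4))
    + (P (t 4 0) (w 1) (w 2) (w 3) + P (w 0) (t 4 1) (w 2) (w 3) + P (w 0) (w 1) (t 4 2) (w 3) + P (w 0) (w 1) (w 2) (t 4 (3::nat)))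
   = - (P (b 0 1) (w 2) (w 3) (w 4) - P (b 0 2) (w 1) (w 3) (w 4) + P (b 0 3) (w 1) (w 2) (w 4) - P (b 0 4) (w 1) (w 2) (w 3)
      + P (b 1 2) (w 0) (w 3) (w 4) - P (b 1 3) (w 0) (w 2) (w 4) + P (b 1 4) (w 0) (w 2) (w 3)
      + P (b 2 3) (w 0) (w 1) (w 4) - P (b 2 4) (w 0) (w 1) (w 3) + P (b 3 4) (w 0) (w 1) (w (2::nat)))"
proof -
  have "b i j = t j i - t i j" for i j using t[of i j] by (metis minus_diff_eq minus_minus)
  then have b: "P (b i j) y z u = P (t j i) y z u - P (t i j) y z u" for i j y z u using lin by simp
  have "P (w k) (t i j) z u = - P (t i j) (w k) z u" "P (w k) (w l) (t i j) u = P (t i j) (w k) (w l) u"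
    "P (w k) (w l) (w m) (t i j) = - P (t i j) (w k) (w l) (w m)" for i j k l m z u
    using P by blast+
  then show ?thesis by (simp add: b)
qed

subsection \<open>The standard \<open>SU(2)\<close>-structure on \<open>\<real>\<^sup>5\<close>\<close>

definition std_eta :: "(real^5) list \<Rightarrow> real" where
  "std_eta vs = vs ! 0 $ 1"

definition std_omega :: "nat \<Rightarrow> (real^5) list \<Rightarrow> real" where
  "std_omega i vs =
    (if i = 1 then plane_minor 2 4 (vs ! 0) (vs ! 1) + plane_minor 5 3 (vs ! 0) (vs ! 1)
     else if i = 2 then plane_minor 2 5 (vs ! 0) (vs ! 1) + plane_minor 3 4 (vs ! 0) (vs ! 1)
     else plane_minor 2 3 (vs ! 0) (vs ! 1) + plane_minor 4 5 (vs ! 0) (vs ! 1))"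

text \<open>The form e^2345, expanded as the shuffle product of e^23 and e^45.\<close>

definition minor_2345 :: "real^5 \<Rightarrow> real^5 \<Rightarrow> real^5 \<Rightarrow> real^5 \<Rightarrow> real" where
  "minor_2345 x y z w =
    plane_minor 2 3 x y * plane_minor 4 5 z w - plane_minor 2 3 x z * plane_minor 4 5 y w +
    plane_minor 2 3 x w * plane_minor 4 5 y z + plane_minor 2 3 y z * plane_minor 4 5 x w -
    plane_minor 2 3 y w * plane_minor 4 5 x z + plane_minor 2 3 z w * plane_minor 4 5 x y"

text \<open>The factor 2 comes from \<omega>_i \<and> \<omega>_i = 2 e^2345.\<close>

definition std_vol :: "(real^5) list \<Rightarrow> real" where
  "std_vol vs = 2 * minor_2345 (vs ! 0) (vs ! 1) (vs ! 2) (vs ! 3)"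

text \<open>The shuffle form of \<omega>_i \<and> \<eta>, which can be differentiated without
  permutation sums.\<close>

definition std_omega_eta :: "nat \<Rightarrow> (real^5) list \<Rightarrow> real" where
  "std_omega_eta i vs = std_omega i [vs ! 0, vs ! 1] * (vs ! 2 $ 1) -
     std_omega i [vs ! 0, vs ! 2] * (vs ! 1 $ 1) + std_omega i [vs ! 1, vs ! 2] * (vs ! 0 $ 1)"

lemma plane_minor_linear:
  "plane_minor i j (x + x') y = plane_minor i j x y + plane_minor i j x' y"
  "plane_minor i j (x - x') y = plane_minor i j x y - plane_minor i j x' y"
  "plane_minor i j (r *\<^sub>R x) y = r * plane_minor i j x y"
  "plane_minor i j x (y + y') = plane_minor i j x y + plane_minor i j x y'"
  "plane_minor i j x (y - y') = plane_minor i j x y - plane_minor i j x y'"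
  "plane_minor i j x (r *\<^sub>R y) = r * plane_minor i j x y"
  by (simp_all add: plane_minor_def algebra_simps)

lemma plane_minor_self: "plane_minor i j x x = 0"
  by (simp add: plane_minor_def)

lemma minor_2345_alternating:
  "minor_2345 x x z w = 0" "minor_2345 x y x w = 0" "minor_2345 x y z x = 0"
  "minor_2345 x y y w = 0" "minor_2345 x y z y = 0" "minor_2345 x y z z = 0"
  by (simp_all add: minor_2345_def plane_minor_def algebra_simps)

lemma minor_2345_linear:
  "minor_2345 (x + x') y z w = minor_2345 x y z w + minor_2345 x' y z w"
  "minor_2345 (x - x') y z w = minor_2345 x y z w - minor_2345 x' y z w"
  "minor_2345 (r *\<^sub>R x) y z w = r * minor_2345 x y z w"
  "minor_2345 x (y + y') z w = minor_2345 x y z w + minor_2345 x y' z w"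
  "minor_2345 x (r *\<^sub>R y) z w = r * minor_2345 x y z w"
  "minor_2345 x y (z + z') w = minor_2345 x y z w + minor_2345 x y z' w"
  "minor_2345 x y (r *\<^sub>R z) w = r * minor_2345 x y z w"
  "minor_2345 x y z (w + w') = minor_2345 x y z w + minor_2345 x y z w'"
  "minor_2345 x y z (r *\<^sub>R w) = r * minor_2345 x y z w"
  by (simp_all add: minor_2345_def plane_minor_linear algebra_simps)

lemma minor_2345_swap:
  "minor_2345 y x z u = - minor_2345 x y z u" "minor_2345 y z x u = minor_2345 x y z u"
  "minor_2345 y z u x = - minor_2345 x y z u"
  by (simp_all add: minor_2345_def plane_minor_def algebra_simps)

lemma length_numeral_cases:
  "length vs = (1::nat) \<longleftrightarrow> (\<exists>x. vs = [x])"
  "length vs = (2::nat) \<longleftrightarrow> (\<exists>x y. vs = [x, y])"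
  "length vs = (3::nat) \<longleftrightarrow> (\<exists>x y z. vs = [x, y, z])"
  "length vs = (4::nat) \<longleftrightarrow> (\<exists>x y z w. vs = [x, y, z, w])"
  "length vs = (5::nat) \<longleftrightarrow> (\<exists>x y z w t. vs = [x, y, z, w, t])"
  by (auto simp: eval_nat_numeral length_Suc_conv)

lemma std_eta_alternating: "alternating 1 std_eta"
  unfolding alternating_def length_numeral_cases
  by (auto simp: std_eta_def intro!: linearI)

lemma std_omega_alternating: "alternating 2 (std_omega i)"
  unfolding alternating_def length_numeral_cases
  by (auto simp: less_2_cases_iff std_omega_def plane_minor_self plane_minor_linear algebra_simps intro!: linearI)

lemma std_vol_alternating: "alternating 4 std_vol"
proof -
  have c: "i = 0 \<or> i = 1 \<or> i = 2 \<or> i = 3" if "i < 4" for i :: nat using that by auto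
  show ?thesis
    unfolding alternating_def length_numeral_cases
    by (auto dest!: c simp: std_vol_def minor_2345_alternating minor_2345_linear algebra_simps intro!: linearI)
qed

lemma std_omega_swap: "std_omega i [u, v] = - std_omega i [v, u]"
  by (simp add: std_omega_def plane_minor_def algebra_simps)

lemma std_omega_eta_alternating: "alternating 3 (std_omega_eta i)"
proof -
  have c: "i = 0 \<or> i = 1 \<or> i = 2" if "i < 3" for i :: nat using that by auto
  have l: "std_omega i [x + x', y] = std_omega i [x, y] + std_omega i [x', y]"
    "std_omega i [x, y + y'] = std_omega i [x, y] + std_omega i [x, y']"
    "std_omega i [r *\<^sub>R x, y] = r * std_omega i [x, y]" "std_omega i [x, r *\<^sub>R y] = r * std_omega i [x, y]"
    "std_omega i [x, x] = 0" for x x' y y' r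
    by (simp_all add: std_omega_def plane_minor_self plane_minor_linear algebra_simps)
  show ?thesis
    unfolding alternating_def
  proof (intro conjI allI impI)
    fix vs :: "(real^5) list" and n :: nat assume "length vs = 3 \<and> n < 3"
    then show "linear (\<lambda>v. std_omega_eta i (vs[n := v]))"
      unfolding length_numeral_cases
      by (auto dest!: c simp: std_omega_eta_def l algebra_simps intro!: linearI)
  next
    fix vs :: "(real^5) list" assume "length vs = 3 \<and> \<not> distinct vs"
    then obtain x y z where vs: "vs = [x, y, z]" and "x = y \<or> x = z \<or> y = z"
      unfolding length_numeral_cases by auto
    then show "std_omega_eta i vs = 0"
      using std_omega_swap[of i y x] by (auto simp: std_omega_eta_def l)
  qed
qed

lemma std_omega_wedge:
  assumes "i \<in> {1, 2, 3}" "j \<in> {1, 2, 3}" "length vs = 4"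
  shows "wedge 2 2 (std_omega i) (std_omega j) vs = (if i = j then std_vol vs else 0)"
proof -
  obtain x y z w where vs: "vs = [x, y, z, w]" using assms(3)[unfolded length_numeral_cases] by blast
  show ?thesis
    using assms(1,2) unfolding vs wedge_2_2[of "std_omega i" "std_omega j", OF std_omega_swap std_omega_swap]
    by (elim insertE emptyE) (simp_all add: std_omega_def std_vol_def minor_2345_def plane_minor_def algebra_simps)
qed

lemma std_omega_wedge_eta:
  assumes "length vs = 3"
  shows "wedge 2 1 (std_omega i) std_eta vs = std_omega_eta i vs"
proof -
  obtain x y z where vs: "vs = [x, y, z]" using assms[unfolded length_numeral_cases] by blast
  show ?thesis
    unfolding vs wedge_2_1[of "std_omega i", OF std_omega_swap] by (simp add: std_omega_eta_def std_eta_def)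
qed

text \<open>The vector e_1 is placed last because \<eta> kills the other four, as
  \<open>wedge_4_1\<close> requires.\<close>

lemma std_vol_wedge_eta:
  "wedge 4 1 std_vol std_eta [axis 2 1, axis 3 1, axis 4 1, axis 5 1, axis 1 1] = 2"
proof -
  have s: "std_eta [axis 2 1] = 0" "std_eta [axis 3 1] = 0" "std_eta [axis 4 1] = 0" "std_eta [axis 5 1] = 0"
    "std_eta [axis 1 1] = 1"
    by (simp_all add: std_eta_def axis_def)
  let ?e = "\<lambda>i. [axis 2 1, axis 3 1, axis 4 1, axis 5 1] ! i"
  show ?thesis
    unfolding wedge_4_1[of std_eta, OF s(1-4)]
      sum_permutations_4[of "\<lambda>i j k l. std_vol [?e i, ?e j, ?e k, ?e l]"]
    by (simp add: s std_vol_def minor_2345_def plane_minor_def) (simp add: axis_def)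
qed

text \<open>Testing with basis vectors expresses the last four coordinates of X through those of Y;
  then \<omega>_2(X, Y) is the sum of the squares of these coordinates of Y.\<close>

lemma std_SU2_orientation:
  assumes "\<And>Z. std_omega 3 [X, Z] = std_omega 1 [Y, Z]"
  shows "std_omega 2 [X, Y] \<ge> 0"
proof -
  have "X $ 2 = Y $ 5" "X $ 3 = Y $ 4" "X $ 4 = - Y $ 3" "X $ 5 = - Y $ 2"
    using assms[of "axis 3 1"] assms[of "axis 2 1"] assms[of "axis 5 1"] assms[of "axis 4 1"]
    by (simp_all add: std_omega_def plane_minor_def axis_def)
  then have "std_omega 2 [X, Y] = Y $ 5 * Y $ 5 + Y $ 2 * Y $ 2 + Y $ 4 * Y $ 4 + Y $ 3 * Y $ 3"
    by (simp add: std_omega_def plane_minor_def)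
  then show ?thesis by simp
qed

section \<open>Closedness of the standard forms in an adapted frame\<close>

text \<open>Each coefficient of the bracket multiplies a form with a repeated index. For \<omega>_3
  this would fail: de^1 \<and> e^45 contributes p times e^2345.\<close>

lemma adapted_bracket_omega_eta:
  assumes "adapted_bracket br" and P: "\<And>x y z. P x y z = std_omega_eta i [x, y, z]" and i: "i \<in> {1, 2}"
  shows "P (br x y) z w - P (br x z) y w + P (br x w) y z + P (br y z) x w - P (br y w) x z + P (br z w) x y = 0"
proof -
  obtain p q r1 r2 r3 s1 s2 s3 s4 where br:
    "\<forall>X Y. br X Y $ 1 = p * plane_minor 2 3 X Y \<and> br X Y $ 2 = 0 \<and> br X Y $ 3 = q * plane_minor 1 2 X Y \<and>
     br X Y $ 4 = s1 * plane_minor 1 2 X Y + s2 * plane_minor 1 3 X Y + s3 * plane_minor 2 3 X Y + s4 * plane_minor 1 5 X Y \<and>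
     br X Y $ 5 = r1 * plane_minor 1 2 X Y + r2 * plane_minor 1 3 X Y + r3 * plane_minor 2 3 X Y"
    using assms(1) unfolding adapted_bracket_def by (elim exE) (rule that)
  show ?thesis
    using i unfolding P
    by (elim insertE emptyE) (simp_all add: std_omega_eta_def std_omega_def plane_minor_def br algebra_simps)
qed

definition minor3 :: "5 \<Rightarrow> 5 \<Rightarrow> 5 \<Rightarrow> real^5 \<Rightarrow> real^5 \<Rightarrow> real^5 \<Rightarrow> real" where
  "minor3 i j k x y z = x $ i * plane_minor j k y z - y $ i * plane_minor j k x z + z $ i * plane_minor j k x y"

text \<open>The shuffle product of a 2-form and a 3-form. It allows the identity in five vectors to
  be split by coefficients of the bracket instead of being expanded as one large polynomial.\<close>

definition wedge_2_3 :: "('v \<Rightarrow> 'v \<Rightarrow> real) \<Rightarrow> ('v \<Rightarrow> 'v \<Rightarrow> 'v \<Rightarrow> real) \<Rightarrow> 'v \<Rightarrow> 'v \<Rightarrow> 'v \<Rightarrow> 'v \<Rightarrow> 'v \<Rightarrow> real" where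
  "wedge_2_3 a b x y z w t = a x y * b z w t - a x z * b y w t + a x w * b y z t - a x t * b y z w
      + a y z * b x w t - a y w * b x z t + a y t * b x z w
      + a z w * b x y t - a z t * b x y w + a w t * b x y z"

text \<open>The reason is e^i \<and> e^i = 0; the three statements cover the positions of the common
  index in the 3-form.\<close>

lemma wedge_repeated:
  "wedge_2_3 (plane_minor p i) (minor3 i j k) x y z w t = 0"
  "wedge_2_3 (plane_minor p i) (minor3 j i k) x y z w t = 0"
  "wedge_2_3 (plane_minor p i) (minor3 j k i) x y z w t = 0"
proof -
  show 1: "wedge_2_3 (plane_minor p i) (minor3 i j k) x y z w t = 0" for i j k
    by (simp add: wedge_2_3_def minor3_def plane_minor_def algebra_simps)
  have "minor3 j i k = (\<lambda>x y z. - minor3 i j k x y z)" "minor3 j k i = minor3 i j k"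
    by (auto simp: fun_eq_iff minor3_def plane_minor_def algebra_simps)
  then show "wedge_2_3 (plane_minor p i) (minor3 j i k) x y z w t = 0"
    "wedge_2_3 (plane_minor p i) (minor3 j k i) x y z w t = 0"
    using 1[of i j k] by (simp_all add: wedge_2_3_def)
qed

lemma minor_2345_expand:
  "minor_2345 b y z w = b $ 2 * minor3 3 4 5 y z w - b $ 3 * minor3 2 4 5 y z w
    + b $ 4 * minor3 2 3 5 y z w - b $ 5 * minor3 2 3 4 y z w"
  by (simp add: minor_2345_def minor3_def plane_minor_def algebra_simps)

text \<open>The expansion has one product for each coefficient in components 3, 4 and 5 of the
  bracket, and in each of them the index 2, 3 or 5 is repeated.\<close>

lemma adapted_bracket_minor:
  assumes "adapted_bracket br"
  shows "minor_2345 (br x y) z w t - minor_2345 (br x z) y w t + minor_2345 (br x w) y z t - minor_2345 (br x t) y z w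
      + minor_2345 (br y z) x w t - minor_2345 (br y w) x z t + minor_2345 (br y t) x z w
      + minor_2345 (br z w) x y t - minor_2345 (br z t) x y w + minor_2345 (br w t) x y z = 0" (is "?S = 0")
proof -
  obtain p q r1 r2 r3 s1 s2 s3 s4 where br:
    "\<forall>X Y. br X Y $ 1 = p * plane_minor 2 3 X Y \<and> br X Y $ 2 = 0 \<and> br X Y $ 3 = q * plane_minor 1 2 X Y \<and>
     br X Y $ 4 = s1 * plane_minor 1 2 X Y + s2 * plane_minor 1 3 X Y + s3 * plane_minor 2 3 X Y + s4 * plane_minor 1 5 X Y \<and>
     br X Y $ 5 = r1 * plane_minor 1 2 X Y + r2 * plane_minor 1 3 X Y + r3 * plane_minor 2 3 X Y"
    using assms(1) unfolding adapted_bracket_def by (elim exE) (rule that)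
  note S = wedge_repeated[of 1 2 4 5] wedge_repeated[of 1 2 3 5] wedge_repeated[of 1 3 2 5]
    wedge_repeated[of 2 3 2 5] wedge_repeated[of 1 5 2 3] wedge_repeated[of 1 2 3 4] wedge_repeated[of 1 3 2 4]
    wedge_repeated[of 2 3 2 4]
  have "?S = - q * wedge_2_3 (plane_minor 1 2) (minor3 2 4 5) x y z w t
    + s1 * wedge_2_3 (plane_minor 1 2) (minor3 2 3 5) x y z w t
    + s2 * wedge_2_3 (plane_minor 1 3) (minor3 2 3 5) x y z w t
    + s3 * wedge_2_3 (plane_minor 2 3) (minor3 2 3 5) x y z w t
    + s4 * wedge_2_3 (plane_minor 1 5) (minor3 2 3 5) x y z w t
    - r1 * wedge_2_3 (plane_minor 1 2) (minor3 2 3 4) x y z w t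
    - r2 * wedge_2_3 (plane_minor 1 3) (minor3 2 3 4) x y z w t
    - r3 * wedge_2_3 (plane_minor 2 3) (minor3 2 3 4) x y z w t"
    unfolding minor_2345_expand wedge_2_3_def by (simp add: br algebra_simps)
  then show ?thesis by (simp only: S mult_zero_right add_0 diff_0_right)
qed

lemma frame_omega_eta_closed:
  fixes A :: "('g::topological_space, real^5) atlas"
  assumes "invariant_frame G A \<theta> br" and br: "adapted_bracket br" and i: "i \<in> {1, 2}"
    and U: "(U, \<phi>) \<in> A" "x \<in> \<phi> ` U" and vs: "length vs = 4"
  shows "ext_deriv 3 (invariant_frame.frame_form \<theta> (std_omega_eta i)) (U, \<phi>) x vs = 0"
proof -
  interpret invariant_frame G A \<theta> br by (rule assms(1))
  define w where "w n = \<theta> (U, \<phi>) x (vs ! n)" for n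
  define t where "t m n = frechet_derivative (\<lambda>y. \<theta> (U, \<phi>) y (vs ! n)) (at x) (vs ! m)" for m n
  define P where "P u v w = std_omega_eta i [u, v, w]" for u v w
  have t: "t m n - t n m = - br (w m) (w n)" for m n
    unfolding t_def w_def by (rule frame_structure[OF U])
  have P1: "P v u w = - P u v w" "P v w u = P u v w" "P (u - u') v w = P u v w - P u' v w" for u u' v w
    by (simp_all add: P_def std_omega_eta_def std_omega_def plane_minor_def algebra_simps)
  obtain v0 v1 v2 v3 where v: "vs = [v0, v1, v2, v3]" using vs[unfolded length_numeral_cases] by blast
  have l: "length vs = Suc 3" using vs by simp
  have "ext_deriv 3 (frame_form (std_omega_eta i)) (U, \<phi>) x vs =
    P (t 0 1) (w 2) (w 3) + P (w 1) (t 0 2) (w 3) + P (w 1) (w 2) (t 0 3)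
    - (P (t 1 0) (w 2) (w 3) + P (w 0) (t 1 2) (w 3) + P (w 0) (w 2) (t 1 3))
    + (P (t 2 0) (w 1) (w 3) + P (w 0) (t 2 1) (w 3) + P (w 0) (w 1) (t 2 3))
    - (P (t 3 0) (w 1) (w 2) + P (w 0) (t 3 1) (w 2) + P (w 0) (w 1) (t 3 2))"
    unfolding ext_deriv_frame_form[OF std_omega_eta_alternating U l]
    by (simp add: v P_def t_def w_def eval_nat_numeral)
  also have "\<dots> = 0"
    unfolding alternating_cancel_3[of P t "\<lambda>m n. br (w m) (w n)", OF P1 t]
    using adapted_bracket_omega_eta[OF br P_def i] by simp
  finally show ?thesis .
qed

lemma frame_vol_closed:
  fixes A :: "('g::topological_space, real^5) atlas"
  assumes "invariant_frame G A \<theta> br" and br: "adapted_bracket br"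
    and U: "(U, \<phi>) \<in> A" "x \<in> \<phi> ` U" and vs: "length vs = 5"
  shows "ext_deriv 4 (invariant_frame.frame_form \<theta> std_vol) (U, \<phi>) x vs = 0"
proof -
  interpret invariant_frame G A \<theta> br by (rule assms(1))
  define w where "w n = \<theta> (U, \<phi>) x (vs ! n)" for n
  define t where "t m n = frechet_derivative (\<lambda>y. \<theta> (U, \<phi>) y (vs ! n)) (at x) (vs ! m)" for m n
  let ?P = minor_2345
  have t: "t m n - t n m = - br (w m) (w n)" for m n
    unfolding t_def w_def by (rule frame_structure[OF U])
  obtain v0 v1 v2 v3 v4 where v: "vs = [v0, v1, v2, v3, v4]" using vs[unfolded length_numeral_cases] by blast
  have l: "length vs = Suc 4" using vs by simp
  have "ext_deriv 4 (frame_form std_vol) (U, \<phi>) x vs = 2 * (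
    ?P (t 0 1) (w 2) (w 3) (w 4) + ?P (w 1) (t 0 2) (w 3) (w 4) + ?P (w 1) (w 2) (t 0 3) (w 4) + ?P (w 1) (w 2) (w 3) (t 0 4)
    - (?P (t 1 0) (w 2) (w 3) (w 4) + ?P (w 0) (t 1 2) (w 3) (w 4) + ?P (w 0) (w 2) (t 1 3) (w 4) + ?P (w 0) (w 2) (w 3) (t 1 4))
    + (?P (t 2 0) (w 1) (w 3) (w 4) + ?P (w 0) (t 2 1) (w 3) (w 4) + ?P (w 0) (w 1) (t 2 3) (w 4) + ?P (w 0) (w 1) (w 3) (t 2 4))
    - (?P (t 3 0) (w 1) (w 2) (w 4) + ?P (w 0) (t 3 1) (w 2) (w 4) + ?P (w 0) (w 1) (t 3 2) (w 4) + ?P (w 0) (w 1) (w 2) (t 3 4))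
    + (?P (t 4 0) (w 1) (w 2) (w 3) + ?P (w 0) (t 4 1) (w 2) (w 3) + ?P (w 0) (w 1) (t 4 2) (w 3) + ?P (w 0) (w 1) (w 2) (t 4 3)))"
    unfolding ext_deriv_frame_form[OF std_vol_alternating U l]
    by (simp add: v std_vol_def t_def w_def eval_nat_numeral)
  also have "\<dots> = 0"
    unfolding alternating_cancel_4[of ?P t "\<lambda>m n. br (w m) (w n)", OF minor_2345_swap minor_2345_linear(2) t]
      adapted_bracket_minor[OF br] by simp
  finally show ?thesis .
qed

theorem proposition2p4:
  fixes G :: "('g::topological_space, 'm) monoid_scheme"
    and \<Gamma> :: "'g set" and A :: "('g, real^5) atlas"
  assumes "compact_nilmanifold G \<Gamma> A"
  shows "\<exists>\<eta> \<omega>. SU2_structure (coset_atlas G \<Gamma> A) \<eta> \<omega> \<and>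
           invariant_form G \<Gamma> A 1 \<eta> \<and> (\<forall>i\<in>{1, 2, 3}. invariant_form G \<Gamma> A 2 (\<omega> i)) \<and>
           balanced (coset_atlas G \<Gamma> A) \<eta> \<omega>"
proof -
  have G: "lie_group G A" and nil: "nilpotent_group G" and \<Gamma>: "subgroup \<Gamma> G"
    using assms by (simp_all add: compact_nilmanifold_def)
  obtain \<theta> br where frame: "invariant_frame G A \<theta> br" and br: "adapted_bracket br"
    using adapted_frame_exists[OF G nil] by blast
  interpret invariant_frame G A \<theta> br by (rule frame)
  let ?\<eta> = "frame_form std_eta" and ?\<omega> = "\<lambda>i. frame_form (std_omega i)" and ?v = "frame_form std_vol"
  \<comment> \<open>This equality and the next hold for all c and x, also outside the chart image,
    and so can be used under a derivative.\<close>
  have ww: "form_wedge 2 2 (?\<omega> i) (?\<omega> j) c x vs = (if i = j then ?v else zero_form) c x vs"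
    if "i \<in> {1, 2, 3}" "j \<in> {1, 2, 3}" "length vs = 4" for i j c x vs
    using frame_form_wedge[of vs 2 2] std_omega_wedge[OF that(1,2)] that(3)
    by (simp add: frame_form_def zero_form_def)
  have we: "form_wedge 2 1 (?\<omega> i) ?\<eta> c x vs = frame_form (std_omega_eta i) c x vs" if "length vs = 3" for i c x vs
    using frame_form_wedge[of vs 2 1] std_omega_wedge_eta that by (simp add: frame_form_def)
  have "SU2_structure (coset_atlas G \<Gamma> A) (descend G \<Gamma> A ?\<eta>) (\<lambda>i. descend G \<Gamma> A (?\<omega> i))"
  proof (rule descend_SU2_structure[OF G \<Gamma>, of _ _ ?v])
    show "form_eq A 4 (form_wedge 2 2 (?\<omega> i) (?\<omega> j)) (if i = j then ?v else zero_form)"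
      if "i \<in> {1, 2, 3}" "j \<in> {1, 2, 3}" for i j
      unfolding form_eq_def using ww[OF that] by blast
    show "nowhere_zero A 5 (form_wedge 4 1 ?v ?\<eta>)"
      unfolding nowhere_zero_def
    proof (clarify)
      fix U \<phi> y assume U: "(U, \<phi>) \<in> A" "y \<in> U"
      then have y: "\<phi> y \<in> \<phi> ` U" by blast
      \<comment> \<open>The frame dual to the coframe at this point.\<close>
      define e where "e i = inv_into UNIV (\<theta> (U, \<phi>) (\<phi> y)) (axis i 1)" for i :: 5
      have e: "\<theta> (U, \<phi>) (\<phi> y) (e i) = axis i 1" for i
        unfolding e_def by (rule surj_f_inv_f[OF frame_surj[OF U(1) y]])
      have "form_wedge 4 1 ?v ?\<eta> (U, \<phi>) (\<phi> y) [e 2, e 3, e 4, e 5, e 1] = 2"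
        using frame_form_wedge[of "[e 2, e 3, e 4, e 5, e 1]" 4 1 std_vol std_eta] std_vol_wedge_eta by (simp add: e)
      then show "\<exists>vs. length vs = 5 \<and> form_wedge 4 1 ?v ?\<eta> (U, \<phi>) (\<phi> y) vs \<noteq> 0"
        by (intro exI[of _ "[e 2, e 3, e 4, e 5, e 1]"]) simp
    qed
    fix U \<phi> x X Y
    assume U: "(U, \<phi>) \<in> A" "x \<in> \<phi> ` U"
      and Z: "\<And>Z. contract X (?\<omega> 3 (U, \<phi>) x) [Z] = contract Y (?\<omega> 1 (U, \<phi>) x) [Z]"
    \<comment> \<open>By surjectivity of \<theta> every test vector W comes from a tangent vector,
      so the hypothesis on contractions passes to the model space.\<close>
    have "std_omega 3 [\<theta> (U, \<phi>) x X, W] = std_omega 1 [\<theta> (U, \<phi>) x Y, W]" for W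
    proof -
      obtain V where "\<theta> (U, \<phi>) x V = W" using frame_preimage[OF U] .
      then show ?thesis using Z[of V] by (simp add: contract_def frame_form_def)
    qed
    then show "0 \<le> ?\<omega> 2 (U, \<phi>) x [X, Y]"
      using std_SU2_orientation by (simp add: frame_form_def)
  qed (intro frame_form_diff_form frame_form_left_invariant std_eta_alternating std_omega_alternating std_vol_alternating)+
  moreover have "invariant_form G \<Gamma> A 1 (descend G \<Gamma> A ?\<eta>)" "invariant_form G \<Gamma> A 2 (descend G \<Gamma> A (?\<omega> i))" for i
    by (intro descend_invariant_form[OF G \<Gamma>] frame_form_left_invariant frame_form_diff_form
        std_eta_alternating std_omega_alternating)+
  moreover have "balanced A ?\<eta> ?\<omega>"
  proof -
    have 3: "form_eq A 4 (ext_deriv 3 (form_wedge 2 1 (?\<omega> i) ?\<eta>)) zero_form" if "i \<in> {1, 2}" for i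
      unfolding form_eq_def
    proof (clarify)
      fix U \<phi> y and vs :: "(real^5) list" assume U: "(U, \<phi>) \<in> A" "y \<in> U" and vs: "length vs = 4"
      have "ext_deriv 3 (form_wedge 2 1 (?\<omega> i) ?\<eta>) (U, \<phi>) (\<phi> y) vs =
          ext_deriv 3 (frame_form (std_omega_eta i)) (U, \<phi>) (\<phi> y) vs"
        unfolding ext_deriv_def using vs by (intro sum.cong refl) (simp add: we del: One_nat_def)
      then show "ext_deriv 3 (form_wedge 2 1 (?\<omega> i) ?\<eta>) (U, \<phi>) (\<phi> y) vs = zero_form (U, \<phi>) (\<phi> y) vs"
        using frame_omega_eta_closed[OF frame br that U(1) _ vs] U(2) by (simp add: zero_form_def)
    qed
    have "form_eq A 5 (ext_deriv 4 (form_wedge 2 2 (?\<omega> 3) (?\<omega> 3))) zero_form"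
      unfolding form_eq_def
    proof (clarify)
      fix U \<phi> y and vs :: "(real^5) list" assume U: "(U, \<phi>) \<in> A" "y \<in> U" and vs: "length vs = 5"
      have "ext_deriv 4 (form_wedge 2 2 (?\<omega> 3) (?\<omega> 3)) (U, \<phi>) (\<phi> y) vs = ext_deriv 4 ?v (U, \<phi>) (\<phi> y) vs"
        unfolding ext_deriv_def using vs by (intro sum.cong refl) (simp add: ww)
      then show "ext_deriv 4 (form_wedge 2 2 (?\<omega> 3) (?\<omega> 3)) (U, \<phi>) (\<phi> y) vs = zero_form (U, \<phi>) (\<phi> y) vs"
        using frame_vol_closed[OF frame br U(1) _ vs] U(2) by (simp add: zero_form_def)
    qed
    then show ?thesis unfolding balanced_def using 3 by simp
  qed
  then have "balanced (coset_atlas G \<Gamma> A) (descend G \<Gamma> A ?\<eta>) (\<lambda>i. descend G \<Gamma> A (?\<omega> i))"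
    by (rule descend_balanced)
  ultimately show ?thesis by blast
qed

end
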